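(* Let $X$ be a real Hilbert space and $A$ a nonnegative self-adjoint operator with dense domain in $X$. Fix a sign $\pm$ and consider $$\tfrac{d}{dt}q=p,\qquad \tfrac{d}{dt}p=-c_\pm(q)^2Aq,\qquad c_\pm(q)=\frac1{1\pm\langle q,Aq\rangle}.$$ Let $s\ge1$, $T>0$, and let $\Omega\subset\mathcal H^\infty$ (for the sign $-$, with $\langle q,Aq\rangle<1$ for all $(q,p)\in\Omega$) be a set that is bounded in $\mathcal H^s$, equicontinuous in $\mathcal H^s$, and satisfies $$\sup_{(q,p)\in\Omega}H_\pm(q,p)<\infty,\qquad H_\pm(q,p)=\tfrac12\Bigl[\langle p,p\rangle+\frac{\langle q,Aq\rangle}{1\pm\langle q,Aq\rangle}\Bigr].$$ Then the set of orbits $$\bigl\{(q(t),p(t)) : (q,p)\text{ is a global }\mathcal H^\infty\text{ solution with }(q(0),p(0))\in\Omega,\ |t|\le T\bigr\}$$ is bounded in $\mathcal H^s$ and equicontinuous in $\mathcal H^s$.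
   Context: Functions of $A$ are defined by the spectral functional calculus. For $s\in\mathbb R$, $H^s$ is the completion of the domain of $(1+A)^{s/2}$ in the norm $\|\phi\|_{H^s}^2=\langle\phi,(1+A)^s\phi\rangle$. For $s\ge1$, $\mathcal H^s=\{(q,p)\in X\times X: A^{1/2}q\in H^{s-1},\ p\in H^{s-1}\}$ with $\|(q,p)\|_{\mathcal H^s}^2=\|A^{1/2}q\|_{H^{s-1}}^2+\|p\|_{H^{s-1}}^2$, and $\mathcal H^\infty=\bigcap_{s\ge1}\mathcal H^s$. The expression $\langle q,Aq\rangle$ means $\|A^{1/2}q\|^2$. For $s\ge1$ and an open interval $I$, an $\mathcal H^s$ solution on $I$ is a map $t\mapsto(q(t),p(t))\in\mathcal H^s$ such that $A^{1/2}q,p\in C(I;H^{s-1})$, $q\in C^1(I;X)$ with $\frac{d}{dt}q=p$, and $p\in C^1(I;H^{s-2})$ with $\frac{d}{dt}p=-c_\pm(q)^2Aq$ in $H^{s-2}$; for the sign $-$ it is additionally required that $\langle q(t),Aq(t)\rangle<1$ for all $t\in I$. It is global if $I=\mathbb R$. An $\mathcal H^\infty$ solution is a map that is an $\mathcal H^s$ solution for every $s\ge1$. For $\kappa>0$ let $P_{\ge\kappa}=\chi_{[\kappa^2,\infty)}(A)$. A set $\Omega\subset\mathcal H^s$ that is bounded in the norm $\|\cdot\|_{\mathcal H^s}$ is equicontinuous in $\mathcal H^s$ if for every $\varepsilon>0$ there is $\kappa>0$ with $\sup_{(q,p)\in\Omega}\|(P_{\ge\kappa}q,P_{\ge\kappa}p)\|_{\mathcal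 H^s}\le\varepsilon$. *)

theory Defs
  imports "HOL-Analysis.Analysis"
begin

text \<open>
  A real Hilbert space is a type of sort \<open>{real_inner, banach}\<close>. Unbounded operators
  are represented by their graphs.
\<close>

definition linear_operator :: "('x::real_vector \<times> 'x) set \<Rightarrow> bool" where
  "linear_operator A \<longleftrightarrow> subspace A \<and> single_valued A"

definition op_app :: "('x \<times> 'x) set \<Rightarrow> 'x \<Rightarrow> 'x" where
  "op_app A x = (THE y. (x, y) \<in> A)"

definition adjoint_graph :: "('x::real_inner \<times> 'x) set \<Rightarrow> ('x \<times> 'x) set" where
  "adjoint_graph A = {(y, z). \<forall>(x, w) \<in> A. w \<bullet> y = x \<bullet> z}"

definition nonneg_self_adjoint :: "('x::real_inner \<times> 'x) set \<Rightarrow> bool" where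
  "nonneg_self_adjoint A \<longleftrightarrow>
     linear_operator A \<and> closure (Domain A) = UNIV \<and> adjoint_graph A = A \<and>
     (\<forall>(x, y) \<in> A. 0 \<le> x \<bullet> y)"


subsection \<open>Spectral functional calculus\<close>

text \<open>Only the values of \<open>E\<close> on Borel sets are constrained or used.\<close>

definition projection_valued_measure :: "(real set \<Rightarrow> 'x::real_inner \<Rightarrow> 'x) \<Rightarrow> bool" where
  "projection_valued_measure E \<longleftrightarrow>
     (\<forall>S \<in> sets borel. bounded_linear (E S) \<and> (\<forall>x. E S (E S x) = E S x) \<and>
        (\<forall>x y. E S x \<bullet> y = x \<bullet> E S y)) \<and>
     (\<forall>x. E UNIV x = x) \<and>
     (\<forall>S \<in> sets borel. \<forall>T \<in> sets borel. \<forall>x. E (S \<inter> T) x = E S (E T x)) \<and>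
     (\<forall>F :: nat \<Rightarrow> real set. range F \<subseteq> sets borel \<longrightarrow> disjoint_family F \<longrightarrow>
        (\<forall>x. (\<lambda>n. E (F n) x) sums E (\<Union>n. F n) x))"

definition spectral_mu :: "(real set \<Rightarrow> 'x::real_inner \<Rightarrow> 'x) \<Rightarrow> 'x \<Rightarrow> real measure" where
  "spectral_mu E x = measure_of UNIV (sets borel) (\<lambda>S. ennreal (x \<bullet> E S x))"

definition spectral_dom :: "(real set \<Rightarrow> 'x::real_inner \<Rightarrow> 'x) \<Rightarrow> (real \<Rightarrow> real) \<Rightarrow> 'x set" where
  "spectral_dom E f = {x. integrable (spectral_mu E x) (\<lambda>l. (f l)\<^sup>2)}"

text \<open>
  Graph of the integral of a Borel function \<open>f\<close> against \<open>E\<close>: the vector \<open>y\<close> is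
  determined by \<open>z \<bullet> y = \<integral> f d(z \<bullet> E x)\<close> for all \<open>z\<close> in the domain, which is a dense
  subspace; the integral against this signed measure is written by polarization.
\<close>

definition spectral_integral ::
    "(real set \<Rightarrow> 'x::real_inner \<Rightarrow> 'x) \<Rightarrow> (real \<Rightarrow> real) \<Rightarrow> ('x \<times> 'x) set" where
  "spectral_integral E f =
     {(x, y). x \<in> spectral_dom E f \<and>
        (\<forall>z \<in> spectral_dom E f.
           z \<bullet> y = (integral\<^sup>L (spectral_mu E (x + z)) f - integral\<^sup>L (spectral_mu E (x - z)) f) / 4)}"

definition spectral_measure_of ::
    "('x::real_inner \<times> 'x) set \<Rightarrow> (real set \<Rightarrow> 'x \<Rightarrow> 'x) \<Rightarrow> bool" where
  "spectral_measure_of A E \<longleftrightarrow>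
     projection_valued_measure E \<and> A = spectral_integral E (\<lambda>l. l)"

text \<open>
  Graph of \<open>f(A)\<close>. By the spectral theorem a self-adjoint \<open>A\<close> has a spectral measure
  \<open>E\<close>, unique on Borel sets. For \<open>A \<ge> 0\<close> it is carried by \<open>[0, \<infinity>)\<close>, so the values of
  \<open>f\<close> at negative arguments are immaterial.
\<close>

definition fun_calc ::
    "('x::real_inner \<times> 'x) set \<Rightarrow> (real \<Rightarrow> real) \<Rightarrow> ('x \<times> 'x) set" where
  "fun_calc A f = {(x, y). \<exists>E. spectral_measure_of A E \<and> (x, y) \<in> spectral_integral E f}"

definition sqrt_dom :: "('x::real_inner \<times> 'x) set \<Rightarrow> 'x set" where
  "sqrt_dom A = Domain (fun_calc A sqrt)"

definition sqrt_op :: "('x::real_inner \<times> 'x) set \<Rightarrow> 'x \<Rightarrow> 'x" where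
  "sqrt_op A = op_app (fun_calc A sqrt)"

definition proj_ge :: "('x::real_inner \<times> 'x) set \<Rightarrow> real \<Rightarrow> 'x \<Rightarrow> 'x" where
  "proj_ge A \<kappa> = op_app (fun_calc A (indicat_real {\<kappa>\<^sup>2..}))"


subsection \<open>The spaces $H^s$\<close>

text \<open>
  \<open>sob_dom A s\<close> is the domain of \<open>(1 + A)\<^bsup>s/2\<^esup>\<close>, and the form \<open>\<langle>x, (1 + A)\<^sup>s x\<rangle>\<close> on it
  means \<open>\<parallel>(1 + A)\<^bsup>s/2\<^esup> x\<parallel>\<^sup>2\<close>. For \<open>s \<ge> 0\<close> the domain is already complete in \<open>sob_norm A s\<close>,
  so a vector \<open>x\<close> of the Hilbert space belongs to \<open>H\<^sup>s\<close> iff \<open>x \<in> sob_dom A s\<close>.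
\<close>

definition sob_dom :: "('x::real_inner \<times> 'x) set \<Rightarrow> real \<Rightarrow> 'x set" where
  "sob_dom A s = Domain (fun_calc A (\<lambda>l. (1 + l) powr (s / 2)))"

definition sob_norm :: "('x::real_inner \<times> 'x) set \<Rightarrow> real \<Rightarrow> 'x \<Rightarrow> real" where
  "sob_norm A s x = norm (op_app (fun_calc A (\<lambda>l. (1 + l) powr (s / 2))) x)"

text \<open>
  For general real \<open>s\<close>, \<open>H\<^sup>s\<close> is the completion of \<open>sob_dom A s\<close>: Cauchy sequences
  modulo null sequences. The embedding of \<open>sob_dom A s\<close> is \<open>sob_embed\<close>.
\<close>

definition sob_cauchy :: "('x::real_inner \<times> 'x) set \<Rightarrow> real \<Rightarrow> (nat \<Rightarrow> 'x) set" where
  "sob_cauchy A s = {u. range u \<subseteq> sob_dom A s \<and>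
     (\<forall>e>0. \<exists>N. \<forall>m\<ge>N. \<forall>n\<ge>N. sob_norm A s (u m - u n) < e)}"

definition sob_rel :: "('x::real_inner \<times> 'x) set \<Rightarrow> real \<Rightarrow> ((nat \<Rightarrow> 'x) \<times> (nat \<Rightarrow> 'x)) set" where
  "sob_rel A s = {(u, v). u \<in> sob_cauchy A s \<and> v \<in> sob_cauchy A s \<and>
     (\<lambda>n. sob_norm A s (u n - v n)) \<longlonglongrightarrow> 0}"

definition sob_space :: "('x::real_inner \<times> 'x) set \<Rightarrow> real \<Rightarrow> (nat \<Rightarrow> 'x) set set" where
  "sob_space A s = sob_cauchy A s // sob_rel A s"

definition sob_embed :: "('x::real_inner \<times> 'x) set \<Rightarrow> real \<Rightarrow> 'x \<Rightarrow> (nat \<Rightarrow> 'x) set" where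
  "sob_embed A s x = sob_rel A s `` {\<lambda>n. x}"

definition sob_scale ::
    "('x::real_inner \<times> 'x) set \<Rightarrow> real \<Rightarrow> real \<Rightarrow> (nat \<Rightarrow> 'x) set \<Rightarrow> (nat \<Rightarrow> 'x) set" where
  "sob_scale A s r U = sob_rel A s `` ((\<lambda>u n. r *\<^sub>R u n) ` U)"

definition sob_dist ::
    "('x::real_inner \<times> 'x) set \<Rightarrow> real \<Rightarrow> (nat \<Rightarrow> 'x) set \<Rightarrow> (nat \<Rightarrow> 'x) set \<Rightarrow> real" where
  "sob_dist A s U V =
     (THE d. \<exists>u\<in>U. \<exists>v\<in>V. (\<lambda>n. sob_norm A s (u n - v n)) \<longlonglongrightarrow> d)"

definition sob_continuous_on ::
    "('x::real_inner \<times> 'x) set \<Rightarrow> real \<Rightarrow> real set \<Rightarrow> (real \<Rightarrow> (nat \<Rightarrow> 'x) set) \<Rightarrow> bool" where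
  "sob_continuous_on A s I F \<longleftrightarrow>
     (\<forall>t\<in>I. F t \<in> sob_space A s \<and>
        ((\<lambda>r. sob_dist A s (F r) (F t)) \<longlongrightarrow> 0) (at t within I))"

text \<open>
  The element \<open>A q\<close> of \<open>H\<^bsup>s-2\<^esup>\<close>, for \<open>q\<close> with \<open>A\<^bsup>1/2\<^esup> q \<in> H\<^bsup>s-1\<^esup>\<close>. In general \<open>q\<close> is not in
  the domain of \<open>A\<close> if \<open>s < 2\<close>, and \<open>A q\<close> is the limit in \<open>H\<^bsup>s-2\<^esup>\<close> of \<open>A x\<^sub>n\<close> for \<open>x\<^sub>n\<close>
  in the domain of \<open>A\<close> with \<open>A\<^bsup>1/2\<^esup> x\<^sub>n \<longlonglongrightarrow> A\<^bsup>1/2\<^esup> q\<close> in \<open>H\<^bsup>s-1\<^esup>\<close>.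
\<close>

definition sob_A :: "('x::real_inner \<times> 'x) set \<Rightarrow> real \<Rightarrow> 'x \<Rightarrow> (nat \<Rightarrow> 'x) set" where
  "sob_A A s q = {u. \<exists>x y.
     (\<forall>n::nat. (x n, y n) \<in> A \<and> sqrt_op A (x n) \<in> sob_dom A (s - 1)) \<and>
     (\<lambda>n. sob_norm A (s - 1) (sqrt_op A (x n) - sqrt_op A q)) \<longlonglongrightarrow> 0 \<and>
     (y, u) \<in> sob_rel A (s - 2)}"


subsection \<open>Phase space, equation, equicontinuity\<close>

definition phase_space :: "('x::real_inner \<times> 'x) set \<Rightarrow> real \<Rightarrow> ('x \<times> 'x) set" where
  "phase_space A s =
     {(q, p). q \<in> sqrt_dom A \<and> sqrt_op A q \<in> sob_dom A (s - 1) \<and> p \<in> sob_dom A (s - 1)}"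

definition phase_norm :: "('x::real_inner \<times> 'x) set \<Rightarrow> real \<Rightarrow> 'x \<times> 'x \<Rightarrow> real" where
  "phase_norm A s z =
     sqrt ((sob_norm A (s - 1) (sqrt_op A (fst z)))\<^sup>2 + (sob_norm A (s - 1) (snd z))\<^sup>2)"

definition phase_space_inf :: "('x::real_inner \<times> 'x) set \<Rightarrow> ('x \<times> 'x) set" where
  "phase_space_inf A = (\<Inter>s\<in>{1..}. phase_space A s)"

text \<open>\<open>A_form A q\<close> is \<open>\<langle>q, A q\<rangle>\<close>. The parameter \<open>\<sigma>\<close> below is the sign, \<open>1\<close> or \<open>-1\<close>.\<close>

definition A_form :: "('x::real_inner \<times> 'x) set \<Rightarrow> 'x \<Rightarrow> real" where
  "A_form A q = (norm (sqrt_op A q))\<^sup>2"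

definition speed :: "('x::real_inner \<times> 'x) set \<Rightarrow> real \<Rightarrow> 'x \<Rightarrow> real" where
  "speed A \<sigma> q = 1 / (1 + \<sigma> * A_form A q)"

definition hamiltonian :: "('x::real_inner \<times> 'x) set \<Rightarrow> real \<Rightarrow> 'x \<times> 'x \<Rightarrow> real" where
  "hamiltonian A \<sigma> z =
     (snd z \<bullet> snd z + A_form A (fst z) / (1 + \<sigma> * A_form A (fst z))) / 2"

definition solution ::
    "('x::real_inner \<times> 'x) set \<Rightarrow> real \<Rightarrow> real \<Rightarrow> real set \<Rightarrow> (real \<Rightarrow> 'x) \<Rightarrow> (real \<Rightarrow> 'x) \<Rightarrow> bool" where
  "solution A \<sigma> s I q p \<longleftrightarrow>
     open I \<and> is_interval I \<and>
     (\<forall>t\<in>I. (q t, p t) \<in> phase_space A s) \<and>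
     sob_continuous_on A (s - 1) I (\<lambda>t. sob_embed A (s - 1) (sqrt_op A (q t))) \<and>
     sob_continuous_on A (s - 1) I (\<lambda>t. sob_embed A (s - 1) (p t)) \<and>
     (\<forall>t\<in>I. (q has_vector_derivative p t) (at t)) \<and> continuous_on I p \<and>
     sob_continuous_on A (s - 2) I
       (\<lambda>t. sob_scale A (s - 2) (- (speed A \<sigma> (q t))\<^sup>2) (sob_A A s (q t))) \<and>
     (\<forall>t\<in>I. ((\<lambda>h. sob_dist A (s - 2)
         (sob_embed A (s - 2) ((1 / h) *\<^sub>R (p (t + h) - p t)))
         (sob_scale A (s - 2) (- (speed A \<sigma> (q t))\<^sup>2) (sob_A A s (q t)))) \<longlongrightarrow> 0) (at 0)) \<and>
     (\<sigma> = -1 \<longrightarrow> (\<forall>t\<in>I. A_form A (q t) < 1))"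

definition solution_inf ::
    "('x::real_inner \<times> 'x) set \<Rightarrow> real \<Rightarrow> real set \<Rightarrow> (real \<Rightarrow> 'x) \<Rightarrow> (real \<Rightarrow> 'x) \<Rightarrow> bool" where
  "solution_inf A \<sigma> I q p \<longleftrightarrow> (\<forall>s\<ge>1. solution A \<sigma> s I q p)"

definition phase_bounded :: "('x::real_inner \<times> 'x) set \<Rightarrow> real \<Rightarrow> ('x \<times> 'x) set \<Rightarrow> bool" where
  "phase_bounded A s \<Omega> \<longleftrightarrow> \<Omega> \<subseteq> phase_space A s \<and> (\<exists>C. \<forall>z\<in>\<Omega>. phase_norm A s z \<le> C)"

definition equicontinuous_in :: "('x::real_inner \<times> 'x) set \<Rightarrow> real \<Rightarrow> ('x \<times> 'x) set \<Rightarrow> bool" where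
  "equicontinuous_in A s \<Omega> \<longleftrightarrow>
     (\<forall>e>0. \<exists>\<kappa>>0. \<forall>(q, p)\<in>\<Omega>. phase_norm A s (proj_ge A \<kappa> q, proj_ge A \<kappa> p) \<le> e)"

end

theory Submission
  imports Defs
begin

text \<open>
  Put \<open>Q = \<langle>q, A q\<rangle>\<close>, \<open>a = 1 + \<sigma> Q\<close>, \<open>c = 1 / a\<close>. For \<open>k > 0\<close> let \<open>G = A (A + k)\<^sup>-\<^sup>1\<close>, \<open>u = \<langle>A q, G q\<rangle>\<close>,
  \<open>v = \<langle>p, G p\<rangle>\<close>. Besides the Hamiltonian every
  \<open>J = c u + a v - \<sigma> (u v + k \<langle>p, G q\<rangle>\<^sup>2)\<close> is conserved, and \<open>k \<langle>p, G q\<rangle>\<^sup>2 \<le> v (Q - u)\<close> makes \<open>J\<close>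
  comparable to \<open>u + v\<close>, with constants depending on a bound for \<open>c\<close> and \<open>1 / c\<close>. For the sign \<open>-\<close> such a
  bound comes from the Hamiltonian; for the sign \<open>+\<close> equicontinuity makes \<open>J\<close> small for large \<open>k\<close>, which
  confines the growth of \<open>Q\<close> to low frequencies.

  Now \<open>u + v\<close> is the integral of \<open>l / (l + k)\<close> against the spectral measure of \<open>(A\<^bsup>1/2\<^esup> q, p)\<close>. For \<open>s < 2\<close>
  the high frequency part of the weight \<open>(1 + l)\<^bsup>s-1\<^esup>\<close> is comparable to a superposition of these functions over
  dyadic \<open>k\<close>. For \<open>s \<ge> 2\<close> the limit \<open>k \<rightarrow> \<infinity>\<close> bounds \<open>\<parallel>A q\<parallel>\<close>, hence the derivative of \<open>a\<close>, and
  Gronwall's inequality for \<open>a \<langle>p, f(A) p\<rangle> + c \<langle>A q, f(A) q\<rangle>\<close> controls every spectral weight \<open>f \<ge> 0\<close>.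
\<close>

text \<open>The time derivative of a is 2 \<sigma> <p, A q>. For \<open>s\<close> at least 2 the
  data control the norm of A q, and every spectral weight can be followed in time. J is conserved
  because A G = A - k G lets all terms of its derivative cancel except a multiple of 1 - a c = 0.
  The functional calculus refers to an arbitrary spectral measure of A, so it is single-valued only
  once uniqueness is known; a measure to work with is taken from a point of \<Omega>. Solutions live
  in abstract completions. The equation is read off at the levels s = 1 and s = 2, where the
  relevant completion is H^0, that is X, and classes of Cauchy sequences become vectors.\<close>

section \<open>Projection valued measures\<close>

text \<open>Both sides are additive, homogeneous and continuous along increasing sequences in
  \<open>u\<close>, so indicators suffice. Pairs of measures are compared because the parallelogram
  law relates two to two and the energy of a phase point (q, p) is a sum of two.\<close>

lemma nn_integral_le_of_emeasure_le:
  fixes c :: ennreal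
  assumes s: "sets M' = sets M" "sets N = sets M" "sets N' = sets M"
    and le: "\<And>S. S \<in> sets M \<Longrightarrow> emeasure M S + emeasure M' S \<le> c * (emeasure N S + emeasure N' S)"
    and u: "u \<in> borel_measurable M"
  shows "nn_integral M u + nn_integral M' u \<le> c * (nn_integral N u + nn_integral N' u)"
  using u
proof (induction rule: borel_measurable_induct)
  case (cong f g)
  have sp: "space M' = space M" "space N = space M" "space N' = space M"
    using s by (metis sets_eq_imp_space_eq)+
  have "nn_integral M f = nn_integral M g" "nn_integral M' f = nn_integral M' g"
    "nn_integral N f = nn_integral N g" "nn_integral N' f = nn_integral N' g"
    using cong(3) sp by (auto intro!: nn_integral_cong)
  then show ?case using cong(4) by simp
next
  case (set A)
  then show ?case using le s by simp
next
  case (mult u d)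
  have m: "u \<in> borel_measurable M'" "u \<in> borel_measurable N" "u \<in> borel_measurable N'"
    using mult(2) s by (simp_all cong: measurable_cong_sets)
  have "d * (nn_integral M u + nn_integral M' u) \<le> d * (c * (nn_integral N u + nn_integral N' u))"
    by (intro mult_left_mono mult(4)) simp
  then show ?case using m mult(2) by (simp add: nn_integral_cmult distrib_left mult.left_commute)
next
  case (add u v)
  have m: "u \<in> borel_measurable M'" "u \<in> borel_measurable N" "u \<in> borel_measurable N'"
     "v \<in> borel_measurable M'" "v \<in> borel_measurable N" "v \<in> borel_measurable N'"
    using add.hyps(1,3) s by (simp_all cong: measurable_cong_sets)
  from add_mono[OF add.IH] show ?case
    using m add.hyps(1,3) by (simp add: nn_integral_add distrib_left ac_simps)
next
  case (seq U)
  have m: "U i \<in> borel_measurable M'" "U i \<in> borel_measurable N" "U i \<in> borel_measurable N'" for i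
    using seq(1) s by (simp_all cong: measurable_cong_sets)
  have ie: "incseq (\<lambda>i. nn_integral M (U i))" "incseq (\<lambda>i. nn_integral M' (U i))"
    using seq.hyps(3) by (auto simp: incseq_def le_fun_def intro!: nn_integral_mono)
  have "nn_integral K (SUP i. U i) = (SUP i. nn_integral K (U i))"
    if "\<And>i. U i \<in> borel_measurable K" for K
  proof -
    have "(SUP i. U i) = (\<lambda>x. SUP i. U i x)" by (rule ext) (simp add: image_comp)
    then show ?thesis
      using nn_integral_monotone_convergence_SUP[OF seq.hyps(3) that] by simp
  qed
  then have "nn_integral M (SUP i. U i) + nn_integral M' (SUP i. U i)
     = (SUP i. nn_integral M (U i) + nn_integral M' (U i))"
    using seq(1) m by (simp add: ennreal_SUP_add[OF ie])
  also have "\<dots> \<le> c * (nn_integral N (SUP i. U i) + nn_integral N' (SUP i. U i))"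
  proof (rule SUP_least)
    fix i
    have "nn_integral M (U i) + nn_integral M' (U i) \<le> c * (nn_integral N (U i) + nn_integral N' (U i))"
      by (rule seq.IH)
    also have "\<dots> \<le> c * (nn_integral N (SUP i. U i) + nn_integral N' (SUP i. U i))"
      by (intro mult_left_mono add_mono nn_integral_mono) (auto intro: SUP_upper)
    finally show "nn_integral M (U i) + nn_integral M' (U i) \<le> \<dots>" .
  qed
  finally show ?case .
qed

definition simple_approx :: "(real \<Rightarrow> real) \<Rightarrow> nat \<Rightarrow> real \<Rightarrow> real" where
  "simple_approx f = (SOME s. (\<forall>i. simple_function borel (s i)) \<and>
     (\<forall>l. (\<lambda>i. s i l) \<longlonglongrightarrow> f l) \<and> (\<forall>i l. \<bar>s i l\<bar> \<le> 2 * \<bar>f l\<bar>))"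

text \<open>The factor 2 is that of the library approximation around the base point 0; it makes a
  multiple of \<bar>f\<bar> the majorant in dominated convergence.\<close>

lemma simple_approx:
  assumes "f \<in> borel_measurable borel"
  shows "simple_function borel (simple_approx f i)"
    and "(\<lambda>i. simple_approx f i l) \<longlonglongrightarrow> f l"
    and "\<bar>simple_approx f i l\<bar> \<le> 2 * \<bar>f l\<bar>"
proof -
  have "\<exists>s. (\<forall>i. simple_function borel (s i)) \<and>
     (\<forall>l. (\<lambda>i. s i l) \<longlonglongrightarrow> f l) \<and> (\<forall>i l. \<bar>s i l\<bar> \<le> 2 * \<bar>f l\<bar>)"
    using borel_measurable_implies_sequence_metric[OF assms, of 0] by simp
  from someI_ex[OF this, folded simple_approx_def]
  show "simple_function borel (simple_approx f i)"
    and "(\<lambda>i. simple_approx f i l) \<longlonglongrightarrow> f l"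
    and "\<bar>simple_approx f i l\<bar> \<le> 2 * \<bar>f l\<bar>" by auto
qed

locale pvm =
  fixes E :: "real set \<Rightarrow> 'x::{real_inner,banach} \<Rightarrow> 'x"
  assumes pvm: "projection_valued_measure E"
begin

abbreviation mu :: "'x \<Rightarrow> real measure" where "mu \<equiv> spectral_mu E"
abbreviation domf :: "(real \<Rightarrow> real) \<Rightarrow> 'x set" where "domf \<equiv> spectral_dom E"

lemma bounded_linear_E: "S \<in> sets borel \<Longrightarrow> bounded_linear (E S)"
  and E_sym: "S \<in> sets borel \<Longrightarrow> E S x \<bullet> y = x \<bullet> E S y"
  and E_UNIV [simp]: "E UNIV x = x"
  and E_E: "S \<in> sets borel \<Longrightarrow> T \<in> sets borel \<Longrightarrow> E S (E T x) = E (S \<inter> T) x"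
  and E_sums: "range F \<subseteq> sets borel \<Longrightarrow> disjoint_family F \<Longrightarrow> (\<lambda>n::nat. E (F n) x) sums E (\<Union>n. F n) x"
  using pvm unfolding projection_valued_measure_def by auto

lemma E_add: "S \<in> sets borel \<Longrightarrow> E S (x + y) = E S x + E S y"
  and E_diff: "S \<in> sets borel \<Longrightarrow> E S (x - y) = E S x - E S y"
  and E_scaleR: "S \<in> sets borel \<Longrightarrow> E S (r *\<^sub>R x) = r *\<^sub>R E S x"
  and E_sum: "S \<in> sets borel \<Longrightarrow> E S (\<Sum>i\<in>I. g i) = (\<Sum>i\<in>I. E S (g i))"
  by (auto dest!: bounded_linear_E simp: linear_simps linear_sum bounded_linear.linear)

text \<open>The constant family of empty sets is disjoint, so the series with all terms
  \<open>E {} x\<close> converges and its terms tend to 0.\<close>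

lemma E_empty [simp]: "E {} x = 0"
proof -
  have "(\<lambda>n::nat. E {} x) sums E {} x"
    using E_sums[of "\<lambda>_. {}" x] by (simp add: disjoint_family_on_def)
  from summable_LIMSEQ_zero[OF sums_summable[OF this]] show ?thesis
    by (simp add: LIMSEQ_const_iff)
qed

lemma E_inner: "S \<in> sets borel \<Longrightarrow> x \<bullet> E S y = E S x \<bullet> E S y"
  using E_E[of S S y] E_sym[of S x "E S y"] by simp

lemma E_inner_self: "S \<in> sets borel \<Longrightarrow> x \<bullet> E S x = (norm (E S x))\<^sup>2"
  by (subst E_inner) (auto simp: power2_norm_eq_inner)

lemma sets_mu [simp, measurable_cong]: "sets (mu x) = sets borel"
  unfolding spectral_mu_def by (subst sets_measure_of) (auto simp: sets.sigma_sets_eq[of borel, simplified])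

lemma space_mu [simp]: "space (mu x) = UNIV"
  unfolding spectral_mu_def by (subst space_measure_of) auto

lemma emeasure_mu:
  assumes "S \<in> sets borel"
  shows "emeasure (mu x) S = ennreal ((norm (E S x))\<^sup>2)"
proof -
  have "countably_additive (sets borel) (\<lambda>S. ennreal (x \<bullet> E S x))"
  proof (rule countably_additiveI)
    fix F :: "nat \<Rightarrow> real set" assume F: "range F \<subseteq> sets borel" "disjoint_family F"
    have "(\<lambda>n. x \<bullet> E (F n) x) sums (x \<bullet> E (\<Union>n. F n) x)"
      using bounded_linear.sums[OF bounded_linear_inner_right E_sums[OF F]] .
    moreover have "0 \<le> x \<bullet> E (F n) x" for n
      using F E_inner_self[of "F n" x] by auto
    ultimately show "(\<Sum>i. ennreal (x \<bullet> E (F i) x)) = ennreal (x \<bullet> E (\<Union>i. F i) x)"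
      by (intro suminf_ennreal_eq)
  qed
  moreover have "positive (sets borel) (\<lambda>S. ennreal (x \<bullet> E S x))"
    by (simp add: positive_def)
  moreover have "sigma_algebra UNIV (sets (borel :: real measure))"
    using sets.sigma_algebra_axioms[of "borel :: real measure"] by simp
  ultimately show ?thesis
    unfolding spectral_mu_def using assms
    by (subst emeasure_measure_of_sigma) (auto simp: E_inner_self)
qed

lemma measure_mu: "S \<in> sets borel \<Longrightarrow> measure (mu x) S = (norm (E S x))\<^sup>2"
  by (simp add: measure_def emeasure_mu)

lemma finite_measure_mu: "finite_measure (mu x)"
  by (rule finite_measureI) (simp add: emeasure_mu)

lemma integrable_mu_bounded:
  assumes "f \<in> borel_measurable borel" "\<And>l. \<bar>f l\<bar> \<le> B"
  shows "integrable (mu x) (f :: real \<Rightarrow> real)"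
  by (rule finite_measure.integrable_const_bound[OF finite_measure_mu, of _ B]) (use assms in auto)

lemma in_domf_iff:
  assumes "f \<in> borel_measurable borel"
  shows "x \<in> domf f \<longleftrightarrow> (\<integral>\<^sup>+ l. ennreal ((f l)\<^sup>2) \<partial>mu x) < \<infinity>"
  unfolding spectral_dom_def using assms by (auto simp: integrable_iff_bounded)

lemma in_domf_bounded:
  assumes "f \<in> borel_measurable borel" "\<And>l. \<bar>f l\<bar> \<le> B"
  shows "x \<in> domf f"
proof -
  have "(f l)\<^sup>2 \<le> B\<^sup>2" for l
    using assms(2)[of l] by (metis abs_le_square_iff abs_of_nonneg abs_ge_zero order_trans)
  then show ?thesis
    unfolding spectral_dom_def
    using assms(1) by (auto intro!: integrable_mu_bounded[of _ "B\<^sup>2"])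
qed

text \<open>The parallelogram law for each \<open>E S\<close>, integrated. It is what closes the
  domains, which are given by a quadratic condition, under sums and differences.\<close>

lemma nn_integral_mu_parallelogram:
  assumes "u \<in> borel_measurable borel"
  shows "nn_integral (mu (x + z)) u + nn_integral (mu (x - z)) u \<le> 2 * (nn_integral (mu x) u + nn_integral (mu z) u)"
proof (rule nn_integral_le_of_emeasure_le)
  fix S assume "S \<in> sets (mu (x + z))"
  then have S: "S \<in> sets borel" by simp
  have "(norm (E S (x + z)))\<^sup>2 + (norm (E S (x - z)))\<^sup>2 = 2 * ((norm (E S x))\<^sup>2 + (norm (E S z))\<^sup>2)"
    using S by (simp add: E_add E_diff power2_norm_eq_inner inner_simps inner_commute)
  then have "ennreal ((norm (E S (x + z)))\<^sup>2 + (norm (E S (x - z)))\<^sup>2)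
      = ennreal 2 * ennreal ((norm (E S x))\<^sup>2 + (norm (E S z))\<^sup>2)"
    by (subst ennreal_mult[symmetric]) auto
  then show "emeasure (mu (x + z)) S + emeasure (mu (x - z)) S \<le> 2 * (emeasure (mu x) S + emeasure (mu z) S)"
    using S by (simp add: emeasure_mu)
qed (use assms in auto)

lemma nn_integral_mu_scaleR:
  assumes "u \<in> borel_measurable borel"
  shows "nn_integral (mu (r *\<^sub>R x)) u \<le> ennreal (r\<^sup>2) * nn_integral (mu x) u"
proof -
  \<comment> \<open>Null measures fill the second slot of a comparison that is stated for
    pairs.\<close>
  have "nn_integral (mu (r *\<^sub>R x)) u + nn_integral (null_measure (mu x)) u
    \<le> ennreal (r\<^sup>2) * (nn_integral (mu x) u + nn_integral (null_measure (mu x)) u)"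
    by (rule nn_integral_le_of_emeasure_le)
     (use assms in \<open>auto simp: emeasure_mu E_scaleR power_mult_distrib ennreal_mult'\<close>)
  then show ?thesis by (simp add: nn_integral_null_measure)
qed

lemma domf_add: "f \<in> borel_measurable borel \<Longrightarrow> x \<in> domf f \<Longrightarrow> z \<in> domf f \<Longrightarrow> x + z \<in> domf f"
  and domf_diff: "f \<in> borel_measurable borel \<Longrightarrow> x \<in> domf f \<Longrightarrow> z \<in> domf f \<Longrightarrow> x - z \<in> domf f"
proof -
  assume f: "f \<in> borel_measurable borel" "x \<in> domf f" "z \<in> domf f"
  have "(\<integral>\<^sup>+ l. ennreal ((f l)\<^sup>2) \<partial>mu (x + z)) + (\<integral>\<^sup>+ l. ennreal ((f l)\<^sup>2) \<partial>mu (x - z)) < \<infinity>"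
    by (rule le_less_trans[OF nn_integral_mu_parallelogram])
      (use f in \<open>auto simp: in_domf_iff ennreal_mult_less_top ennreal_add_eq_top\<close>)
  then show "x + z \<in> domf f" "x - z \<in> domf f"
    using f(1) by (auto simp: in_domf_iff)
qed

lemma domf_scaleR: "f \<in> borel_measurable borel \<Longrightarrow> x \<in> domf f \<Longrightarrow> r *\<^sub>R x \<in> domf f"
  using nn_integral_mu_scaleR[of "\<lambda>l. ennreal ((f l)\<^sup>2)" r x]
  by (auto simp: in_domf_iff ennreal_mult_less_top intro: le_less_trans)

lemma integrable_of_domf:
  assumes "f \<in> borel_measurable borel" "x \<in> domf f"
  shows "integrable (mu x) f"
proof (rule Bochner_Integration.integrable_bound)
  show "integrable (mu x) (\<lambda>l. 1 + (f l)\<^sup>2)"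
    using assms by (auto simp: spectral_dom_def intro!: integrable_mu_bounded[of "\<lambda>_. 1" 1]
        Bochner_Integration.integrable_add)
  have "\<bar>y\<bar> \<le> 1 + y\<^sup>2" for y :: real
  proof -
    have "0 \<le> (\<bar>y\<bar> - 1/2)\<^sup>2" by simp
    then show ?thesis by (simp add: power2_diff power_divide)
  qed
  then show "AE l in mu x. norm (f l) \<le> norm (1 + (f l)\<^sup>2)" by simp
qed (use assms in auto)

section \<open>Functional calculus\<close>

text \<open>One sequence of simple functions approximates \<open>f\<close> in \<open>L\<^sup>2(mu x)\<close> for all \<open>x\<close> in the domain at once, so
  linearity in \<open>x\<close> survives the limit in \<open>spec\<close>.\<close>

definition simple_spec :: "(real \<Rightarrow> real) \<Rightarrow> 'x \<Rightarrow> 'x" where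
  "simple_spec s x = (\<Sum>v\<in>range s. v *\<^sub>R E (s -` {v}) x)"

definition spec :: "(real \<Rightarrow> real) \<Rightarrow> 'x \<Rightarrow> 'x" where
  "spec f x = lim (\<lambda>i. simple_spec (simple_approx f i) x)"

definition form :: "(real \<Rightarrow> real) \<Rightarrow> 'x \<Rightarrow> 'x \<Rightarrow> real" where
  "form f x z = (integral\<^sup>L (mu (x + z)) f - integral\<^sup>L (mu (x - z)) f) / 4"

lemma simple_measurable: "simple_function borel s \<Longrightarrow> (s :: real \<Rightarrow> real) \<in> borel_measurable borel"
  by (rule borel_measurable_simple_function)

lemma simple_measurable_mu: "simple_function borel s \<Longrightarrow> (s :: real \<Rightarrow> real) \<in> borel_measurable (mu x)"
  by (simp only: measurable_cong_sets[OF sets_mu refl] simple_measurable)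

lemma simple_vimage: "simple_function borel s \<Longrightarrow> s -` {v} \<in> sets (borel :: real measure)"
  for s :: "real \<Rightarrow> real"
  using simple_functionD(2)[of borel s "{v}"] by simp

lemma simple_range: "simple_function borel s \<Longrightarrow> finite (range s)"
  for s :: "real \<Rightarrow> real"
  using simple_functionD(1)[of borel s] by simp

lemma simple_bounded:
  fixes s :: "real \<Rightarrow> real" assumes "simple_function borel s"
  obtains B where "\<And>l. \<bar>s l\<bar> \<le> B"
  using finite_imp_bounded[OF simple_range[OF assms]] unfolding bounded_iff by auto

lemma simple_in_domf: "simple_function borel s \<Longrightarrow> x \<in> domf s"
  by (metis simple_bounded simple_measurable in_domf_bounded)

lemma simple_integrable: "simple_function borel s \<Longrightarrow> integrable (mu x) (s :: real \<Rightarrow> real)"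
  by (metis simple_bounded simple_measurable integrable_mu_bounded)

lemma simple_integral_on:
  fixes s :: "real \<Rightarrow> real"
  assumes s: "simple_function borel s" and S: "S \<in> sets borel"
  shows "(\<integral>l. indicator S l * s l \<partial>mu x) = (\<Sum>v\<in>range s. v * (norm (E (S \<inter> s -` {v}) x))\<^sup>2)"
proof -
  have "indicator S l * s l = (\<Sum>v\<in>range s. v * indicator (S \<inter> s -` {v}) l)" for l
  proof -
    have "(\<Sum>v\<in>range s. v * indicator (S \<inter> s -` {v}) l) = (\<Sum>v\<in>range s. if v = s l then indicator S l * v else 0)"
      by (intro sum.cong) (auto simp: indicator_def)
    then show ?thesis
      using simple_range[OF s] by simp
  qed
  then have "(\<integral>l. indicator S l * s l \<partial>mu x) = (\<integral>l. (\<Sum>v\<in>range s. v * indicator (S \<inter> s -` {v}) l) \<partial>mu x)"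
    by simp
  also have "\<dots> = (\<Sum>v\<in>range s. v * measure (mu x) (S \<inter> s -` {v}))"
    using simple_vimage[OF s] S finite_measure.emeasure_finite[OF finite_measure_mu]
    by (subst Bochner_Integration.integral_sum) (auto simp: less_top)
  finally show ?thesis using simple_vimage[OF s] S by (simp add: measure_mu)
qed

lemma simple_integral:
  fixes s :: "real \<Rightarrow> real"
  assumes "simple_function borel s"
  shows "integral\<^sup>L (mu x) s = (\<Sum>v\<in>range s. v * (norm (E (s -` {v}) x))\<^sup>2)"
  using simple_integral_on[OF assms, of UNIV x] by simp

lemma E_polarization:
  assumes "S \<in> sets borel"
  shows "(norm (E S (x + z)))\<^sup>2 - (norm (E S (x - z)))\<^sup>2 = 4 * (z \<bullet> E S x)"
  using assms by (simp add: E_add E_diff E_inner[of S z] power2_norm_eq_inner inner_simps inner_commute)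

text \<open>Polarization on each level set. Testing against all \<open>z\<close> turns algebra in
  \<open>s\<close> into linearity of integrals, so the level sets of a sum or difference never have
  to be compared with those of its parts.\<close>

lemma simple_spec_inner:
  assumes s: "simple_function borel s"
  shows "z \<bullet> simple_spec s x = form s x z"
proof -
  have "(\<Sum>v\<in>range s. v * (norm (E (s -` {v}) (x + z)))\<^sup>2) - (\<Sum>v\<in>range s. v * (norm (E (s -` {v}) (x - z)))\<^sup>2)
      = (\<Sum>v\<in>range s. v * (4 * (z \<bullet> E (s -` {v}) x)))"
    using simple_vimage[OF s] by (simp only: E_polarization flip: sum_subtractf right_diff_distrib)
  also have "\<dots> = 4 * (z \<bullet> simple_spec s x)"
    unfolding simple_spec_def inner_sum_right sum_distrib_left by (simp add: mult.left_commute)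
  finally show ?thesis
    unfolding form_def simple_integral[OF s] by simp
qed

lemma simple_spec_diff:
  assumes "simple_function borel s" "simple_function borel t"
  shows "simple_spec (\<lambda>l. s l - t l) x = simple_spec s x - simple_spec t x"
proof -
  have "z \<bullet> simple_spec (\<lambda>l. s l - t l) x = z \<bullet> (simple_spec s x - simple_spec t x)" for z
    using assms simple_function_diff[OF assms]
    by (simp add: simple_spec_inner inner_diff_right form_def simple_integrable diff_divide_distrib)
  then show ?thesis using vector_eq_ldot by blast
qed

lemma simple_spec_add:
  assumes "simple_function borel s" "simple_function borel t"
  shows "simple_spec (\<lambda>l. s l + t l) x = simple_spec s x + simple_spec t x"
proof -
  have "z \<bullet> simple_spec (\<lambda>l. s l + t l) x = z \<bullet> (simple_spec s x + simple_spec t x)" for z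
    using assms simple_function_add[OF assms]
    by (simp add: simple_spec_inner inner_add_right form_def simple_integrable field_simps)
  then show ?thesis using vector_eq_ldot by blast
qed

lemma E_simple_spec:
  assumes s: "simple_function borel s" and S: "S \<in> sets borel"
  shows "E S (simple_spec s x) = (\<Sum>v\<in>range s. v *\<^sub>R E (S \<inter> s -` {v}) x)"
  using simple_vimage[OF s] S by (simp add: simple_spec_def E_sum E_scaleR E_E)

text \<open>Pythagoras: the projections on distinct level sets are orthogonal. This isometry carries
  the extension from simple functions to all of \<open>L\<^sup>2\<close>.\<close>

lemma simple_spec_norm:
  assumes s: "simple_function borel s"
  shows "(norm (simple_spec s x))\<^sup>2 = (\<integral>l. (s l)\<^sup>2 \<partial>mu x)"
proof -
  note sv = simple_vimage[OF s]
  have E1: "E (s -` {w}) (simple_spec s x) = w *\<^sub>R E (s -` {w}) x" if "w \<in> range s" for w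
  proof -
    have "E (s -` {w}) (simple_spec s x) = (\<Sum>v\<in>range s. v *\<^sub>R E (s -` {w} \<inter> s -` {v}) x)"
      by (rule E_simple_spec[OF s sv])
    also have "\<dots> = (\<Sum>v\<in>range s. if v = w then w *\<^sub>R E (s -` {w}) x else 0)"
    proof (rule sum.cong)
      fix v
      have "s -` {w} \<inter> s -` {v} = (if v = w then s -` {w} else {})" by auto
      then show "v *\<^sub>R E (s -` {w} \<inter> s -` {v}) x = (if v = w then w *\<^sub>R E (s -` {w}) x else 0)"
        by simp
    qed simp
    finally show ?thesis using simple_range[OF s] that by simp
  qed
  have "(norm (simple_spec s x))\<^sup>2 = (\<Sum>v\<in>range s. v * (x \<bullet> E (s -` {v}) (simple_spec s x)))"
    by (simp add: power2_norm_eq_inner simple_spec_def inner_sum_left E_sym[OF sv])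
  also have "\<dots> = (\<Sum>v\<in>range s. v\<^sup>2 * (norm (E (s -` {v}) x))\<^sup>2)"
    by (intro sum.cong) (simp_all add: E1 E_inner_self[OF sv] power2_eq_square)
  also have "\<dots> = (\<integral>l. (s l)\<^sup>2 \<partial>mu x)"
  proof -
    have "(\<lambda>l. (s l)\<^sup>2) = (\<lambda>l. \<Sum>v\<in>range s. v\<^sup>2 * indicator (s -` {v}) l)"
    proof
      fix l
      have "(\<Sum>v\<in>range s. v\<^sup>2 * indicator (s -` {v}) l) = (\<Sum>v\<in>range s. if v = s l then v\<^sup>2 else 0)"
        by (intro sum.cong) (auto simp: indicator_def)
      then show "(s l)\<^sup>2 = (\<Sum>v\<in>range s. v\<^sup>2 * indicator (s -` {v}) l)"
        using simple_range[OF s] by simp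
    qed
    then show ?thesis
      using sv finite_measure.emeasure_finite[OF finite_measure_mu, of x]
      by (simp add: measure_mu less_top)
  qed
  finally show ?thesis .
qed

end

section \<open>Extension of the calculus to square integrable functions\<close>

context pvm begin

lemma simple_approx_diff_tendsto:
  assumes f: "f \<in> borel_measurable borel" "x \<in> domf f"
    and s: "\<And>i. simple_function borel (s i)" "\<And>l. (\<lambda>i. s i l) \<longlonglongrightarrow> f l" "\<And>i l. \<bar>s i l\<bar> \<le> w l"
    and w: "w \<in> borel_measurable borel" "x \<in> domf w"
  shows "(\<lambda>i. \<integral>l. (s i l - f l)\<^sup>2 \<partial>mu x) \<longlonglongrightarrow> 0"
proof -
  have "(\<lambda>i. \<integral>l. (s i l - f l)\<^sup>2 \<partial>mu x) \<longlonglongrightarrow> (\<integral>l. 0 \<partial>mu x)"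
  proof (rule integral_dominated_convergence)
    show "integrable (mu x) (\<lambda>l. 2 * (w l)\<^sup>2 + 2 * (f l)\<^sup>2)"
      using f w by (auto simp: spectral_dom_def)
    show "AE l in mu x. (\<lambda>i. (s i l - f l)\<^sup>2) \<longlonglongrightarrow> 0"
      using s(2) by (auto intro!: tendsto_eq_intros AE_I2)
    show "AE l in mu x. norm ((s i l - f l)\<^sup>2) \<le> 2 * (w l)\<^sup>2 + 2 * (f l)\<^sup>2" for i
    proof (rule AE_I2)
      fix l
      have "(s i l)\<^sup>2 \<le> (w l)\<^sup>2"
        using s(3)[of i l] by (metis abs_le_square_iff abs_ge_zero abs_of_nonneg order_trans)
      moreover have "(s i l - f l)\<^sup>2 \<le> 2 * (s i l)\<^sup>2 + 2 * (f l)\<^sup>2"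
        using zero_le_power2[of "s i l + f l"] by (simp add: power2_sum power2_diff)
      ultimately show "norm ((s i l - f l)\<^sup>2) \<le> 2 * (w l)\<^sup>2 + 2 * (f l)\<^sup>2" by simp
    qed
  qed (use f simple_measurable[OF s(1)] in auto)
  then show ?thesis by simp
qed

lemma domf_mult: "f \<in> borel_measurable borel \<Longrightarrow> x \<in> domf f \<Longrightarrow> x \<in> domf (\<lambda>l. c * f l)"
  unfolding spectral_dom_def by (simp add: power_mult_distrib)

lemma domf_mono:
  assumes "f \<in> borel_measurable borel" "g \<in> borel_measurable borel" "x \<in> domf g" "\<And>l. \<bar>f l\<bar> \<le> \<bar>g l\<bar>"
  shows "x \<in> domf f"
proof -
  have "(f l)\<^sup>2 \<le> (g l)\<^sup>2" for l using assms(4) by (simp add: abs_le_square_iff)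
  then show ?thesis
    using assms(1-3) unfolding spectral_dom_def
    by (auto intro: Bochner_Integration.integrable_bound)
qed

lemma domf_fun_add:
  assumes "f \<in> borel_measurable borel" "g \<in> borel_measurable borel" "x \<in> domf f" "x \<in> domf g"
  shows "x \<in> domf (\<lambda>l. f l + g l)"
  unfolding spectral_dom_def mem_Collect_eq
proof (rule Bochner_Integration.integrable_bound)
  show "integrable (mu x) (\<lambda>l. 2 * (f l)\<^sup>2 + 2 * (g l)\<^sup>2)"
    using assms by (auto simp: spectral_dom_def)
  have "(a + b)\<^sup>2 \<le> 2 * a\<^sup>2 + 2 * b\<^sup>2" for a b :: real
    using zero_le_power2[of "a - b"] by (simp add: power2_sum power2_diff)
  then show "AE l in mu x. norm ((f l + g l)\<^sup>2) \<le> norm (2 * (f l)\<^sup>2 + 2 * (g l)\<^sup>2)" by simp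
qed (use assms in auto)

text \<open>By the isometry the left side is the squared \<open>L\<^sup>2\<close> distance of
  \<open>s\<close> and \<open>t\<close>; the detour through \<open>f\<close> costs the factors 2 and
  shows that sequences approximating \<open>f\<close> are Cauchy.\<close>

lemma simple_spec_dist:
  assumes s: "simple_function borel s" "simple_function borel t"
    and f: "f \<in> borel_measurable borel" "x \<in> domf f"
  shows "(norm (simple_spec s x - simple_spec t x))\<^sup>2
    \<le> 2 * (\<integral>l. (s l - f l)\<^sup>2 \<partial>mu x) + 2 * (\<integral>l. (t l - f l)\<^sup>2 \<partial>mu x)"
proof -
  have i: "integrable (mu x) (\<lambda>l. (u l - f l)\<^sup>2)" if "simple_function borel u" for u
    using domf_fun_add[of u "\<lambda>l. (-1) * f l" x] domf_mult[OF f, of "-1"] simple_in_domf[OF that] f that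
    by (auto simp: spectral_dom_def simple_measurable)
  have "(norm (simple_spec s x - simple_spec t x))\<^sup>2 = (\<integral>l. (s l - t l)\<^sup>2 \<partial>mu x)"
    using simple_spec_norm[OF simple_function_diff[OF s]] s by (simp add: simple_spec_diff)
  also have "\<dots> \<le> (\<integral>l. 2 * (s l - f l)\<^sup>2 + 2 * (t l - f l)\<^sup>2 \<partial>mu x)"
  proof (rule integral_mono)
    show "integrable (mu x) (\<lambda>l. (s l - t l)\<^sup>2)"
      using simple_in_domf[OF simple_function_diff[OF s], of x] by (simp add: spectral_dom_def)
    show "(s l - t l)\<^sup>2 \<le> 2 * (s l - f l)\<^sup>2 + 2 * (t l - f l)\<^sup>2" for l
      using zero_le_power2[of "(s l - f l) + (t l - f l)"] by (simp add: power2_eq_square algebra_simps)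
  qed (use i s in auto)
  also have "\<dots> = 2 * (\<integral>l. (s l - f l)\<^sup>2 \<partial>mu x) + 2 * (\<integral>l. (t l - f l)\<^sup>2 \<partial>mu x)"
    using i s by (subst Bochner_Integration.integral_add) auto
  finally show ?thesis .
qed

lemma simple_approx_tendsto:
  assumes f: "f \<in> borel_measurable borel" "x \<in> domf f"
  shows "(\<lambda>i. \<integral>l. (simple_approx f i l - f l)\<^sup>2 \<partial>mu x) \<longlonglongrightarrow> 0"
  by (rule simple_approx_diff_tendsto[where w = "\<lambda>l. 2 * \<bar>f l\<bar>"])
    (use f simple_approx[OF f(1)] domf_mult[of "\<lambda>l. \<bar>f l\<bar>" x 2] in \<open>auto simp: spectral_dom_def\<close>)

text \<open>The isometry makes the images of the approximants a Cauchy sequence; completeness of the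
  Hilbert space gives the limit.\<close>

lemma spec_tendsto_approx:
  assumes f: "f \<in> borel_measurable borel" "x \<in> domf f"
  shows "(\<lambda>i. simple_spec (simple_approx f i) x) \<longlonglongrightarrow> spec f x"
proof -
  let ?d = "\<lambda>i. \<integral>l. (simple_approx f i l - f l)\<^sup>2 \<partial>mu x"
  have "Cauchy (\<lambda>i. simple_spec (simple_approx f i) x)"
  proof (rule metric_CauchyI)
    fix e :: real assume e: "0 < e"
    then have "\<forall>\<^sub>F i in sequentially. ?d i < e\<^sup>2 / 4"
      by (intro order_tendstoD(2)[OF simple_approx_tendsto[OF f]]) simp
    then obtain N where N: "\<And>i. i \<ge> N \<Longrightarrow> ?d i < e\<^sup>2 / 4"
      by (auto simp: eventually_sequentially)
    have "dist (simple_spec (simple_approx f m) x) (simple_spec (simple_approx f n) x) < e"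
      if "m \<ge> N" "n \<ge> N" for m n
    proof -
      have "(dist (simple_spec (simple_approx f m) x) (simple_spec (simple_approx f n) x))\<^sup>2 \<le> 2 * ?d m + 2 * ?d n"
        using simple_spec_dist[OF simple_approx(1)[OF f(1)] simple_approx(1)[OF f(1)] f]
        by (simp add: dist_norm)
      also have "\<dots> < e\<^sup>2" using N[OF that(1)] N[OF that(2)] by simp
      finally show ?thesis using e by (simp add: power_less_imp_less_base)
    qed
    then show "\<exists>M. \<forall>m\<ge>M. \<forall>n\<ge>M. dist (simple_spec (simple_approx f m) x) (simple_spec (simple_approx f n) x) < e"
      by blast
  qed
  then show ?thesis
    unfolding spec_def by (simp add: Cauchy_convergent convergent_LIMSEQ_iff[symmetric])
qed

text \<open>The limit does not depend on the approximating sequence. Sums, multiples and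
  restrictions of the chosen approximants need not be the approximants chosen for the resulting
  function, hence the free sequence \<open>s\<close> with a free majorant \<open>w\<close>.\<close>

lemma spec_tendsto:
  assumes f: "f \<in> borel_measurable borel" "x \<in> domf f"
    and s: "\<And>i. simple_function borel (s i)" "\<And>l. (\<lambda>i. s i l) \<longlonglongrightarrow> f l" "\<And>i l. \<bar>s i l\<bar> \<le> w l"
    and w: "w \<in> borel_measurable borel" "x \<in> domf w"
  shows "(\<lambda>i. simple_spec (s i) x) \<longlonglongrightarrow> spec f x"
proof -
  let ?d = "\<lambda>s i. \<integral>l. (s i l - f l)\<^sup>2 \<partial>mu x"
  have "(\<lambda>i. (norm (simple_spec (s i) x - simple_spec (simple_approx f i) x))\<^sup>2) \<longlonglongrightarrow> 0"
  proof (rule tendsto_sandwich[OF _ _ tendsto_const])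
    show "(\<lambda>i. 2 * ?d s i + 2 * ?d (simple_approx f) i) \<longlonglongrightarrow> 0"
      using simple_approx_diff_tendsto[OF f s w] simple_approx_tendsto[OF f]
      by (auto intro!: tendsto_eq_intros)
  qed (auto intro!: always_eventually simple_spec_dist s f simple_approx)
  then have "(\<lambda>i. sqrt ((norm (simple_spec (s i) x - simple_spec (simple_approx f i) x))\<^sup>2)) \<longlonglongrightarrow> sqrt 0"
    by (rule tendsto_real_sqrt)
  then have "(\<lambda>i. simple_spec (s i) x - simple_spec (simple_approx f i) x) \<longlonglongrightarrow> 0"
    by (simp add: tendsto_norm_zero_iff)
  from tendsto_add[OF this spec_tendsto_approx[OF f]] show ?thesis by simp
qed

lemma spec_norm:
  assumes f: "f \<in> borel_measurable borel" "x \<in> domf f"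
  shows "(norm (spec f x))\<^sup>2 = (\<integral>l. (f l)\<^sup>2 \<partial>mu x)"
proof (rule LIMSEQ_unique)
  show "(\<lambda>i. (norm (simple_spec (simple_approx f i) x))\<^sup>2) \<longlonglongrightarrow> (norm (spec f x))\<^sup>2"
    by (intro tendsto_intros spec_tendsto_approx f)
  show "(\<lambda>i. (norm (simple_spec (simple_approx f i) x))\<^sup>2) \<longlonglongrightarrow> (\<integral>l. (f l)\<^sup>2 \<partial>mu x)"
    unfolding simple_spec_norm[OF simple_approx(1)[OF f(1)]]
  proof (rule integral_dominated_convergence)
    show "integrable (mu x) (\<lambda>l. 4 * (f l)\<^sup>2)" using f by (simp add: spectral_dom_def)
    show "AE l in mu x. (\<lambda>i. (simple_approx f i l)\<^sup>2) \<longlonglongrightarrow> (f l)\<^sup>2"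
      using simple_approx(2)[OF f(1)] by (auto intro!: tendsto_intros)
    have "(simple_approx f i l)\<^sup>2 \<le> (2 * f l)\<^sup>2" for i l
      using simple_approx(3)[OF f(1), of i l] by (intro abs_le_square_iff[THEN iffD1]) (simp add: abs_mult)
    then show "AE l in mu x. norm ((simple_approx f i l)\<^sup>2) \<le> 4 * (f l)\<^sup>2" for i
      by (simp add: power_mult_distrib)
  qed (use f simple_measurable[OF simple_approx(1)[OF f(1)]] in auto)
qed

lemma spec_inner:
  assumes f: "f \<in> borel_measurable borel" "x \<in> domf f" "z \<in> domf f"
  shows "z \<bullet> spec f x = form f x z"
proof (rule LIMSEQ_unique)
  show "(\<lambda>i. z \<bullet> simple_spec (simple_approx f i) x) \<longlonglongrightarrow> z \<bullet> spec f x"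
    by (intro tendsto_intros spec_tendsto_approx f)
  have "(\<lambda>i. integral\<^sup>L (mu y) (simple_approx f i)) \<longlonglongrightarrow> integral\<^sup>L (mu y) f" if y: "y \<in> domf f" for y
  proof (rule integral_dominated_convergence)
    show "integrable (mu y) (\<lambda>l. 2 * \<bar>f l\<bar>)" using integrable_of_domf[OF f(1) y] by simp
  qed (use f simple_approx[OF f(1)] in \<open>auto intro!: simple_measurable_mu\<close>)
  then show "(\<lambda>i. z \<bullet> simple_spec (simple_approx f i) x) \<longlonglongrightarrow> form f x z"
    unfolding simple_spec_inner[OF simple_approx(1)[OF f(1)]] form_def
    using domf_add[OF f] domf_diff[OF f] by (intro tendsto_intros) auto
qed

section \<open>Algebra of the functional calculus\<close>

lemma spec_fun_add:
  assumes "f \<in> borel_measurable borel" "g \<in> borel_measurable borel" "x \<in> domf f" "x \<in> domf g"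
  shows "spec (\<lambda>l. f l + g l) x = spec f x + spec g x"
proof (rule LIMSEQ_unique)
  let ?s = "\<lambda>i l. simple_approx f i l + simple_approx g i l"
  show "(\<lambda>i. simple_spec (?s i) x) \<longlonglongrightarrow> spec f x + spec g x"
    using assms by (simp add: simple_spec_add simple_approx tendsto_add spec_tendsto_approx)
  show "(\<lambda>i. simple_spec (?s i) x) \<longlonglongrightarrow> spec (\<lambda>l. f l + g l) x"
  proof (rule spec_tendsto)
    show "\<bar>?s i l\<bar> \<le> 2 * \<bar>f l\<bar> + 2 * \<bar>g l\<bar>" for i l
      using simple_approx(3)[OF assms(1), of i l] simple_approx(3)[OF assms(2), of i l] by linarith
    show "x \<in> domf (\<lambda>l. 2 * \<bar>f l\<bar> + 2 * \<bar>g l\<bar>)"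
      using assms by (intro domf_fun_add domf_mult) (auto simp: spectral_dom_def)
  qed (use assms simple_approx[OF assms(1)] simple_approx[OF assms(2)] in \<open>auto intro!: tendsto_intros domf_fun_add\<close>)
qed

lemma spec_simple:
  assumes "simple_function borel s"
  shows "spec s x = simple_spec s x"
proof (rule LIMSEQ_unique)
  show "(\<lambda>i. simple_spec s x) \<longlonglongrightarrow> spec s x"
    by (rule spec_tendsto[where w = "\<lambda>l. \<bar>s l\<bar>"])
      (use assms simple_in_domf[OF assms, of x] simple_measurable[OF assms] in \<open>auto simp: spectral_dom_def\<close>)
qed simp

lemma spec_indicator [simp]:
  assumes "S \<in> sets borel"
  shows "spec (indicator S) x = E S x"
proof -
  have "spec (indicator S) x = simple_spec (indicator S) x"
    using assms by (intro spec_simple) auto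
  also have "\<dots> = (\<Sum>v\<in>{0,1}. v *\<^sub>R E ((indicator S :: real \<Rightarrow> real) -` {v}) x)"
    unfolding simple_spec_def
  proof (rule sum.mono_neutral_left)
    show "\<forall>v\<in>{0, 1} - range (indicator S). v *\<^sub>R E ((indicator S :: real \<Rightarrow> real) -` {v}) x = 0"
    proof
      fix v :: real assume "v \<in> {0, 1} - range (indicator S)"
      then have "(indicator S :: real \<Rightarrow> real) -` {v} = {}" by auto
      then show "v *\<^sub>R E ((indicator S :: real \<Rightarrow> real) -` {v}) x = 0" by simp
    qed
  qed (auto simp: indicator_def)
  also have "\<dots> = E S x"
  proof -
    have "(indicator S :: real \<Rightarrow> real) -` {1} = S" by (auto simp: indicator_def)
    then show ?thesis by simp
  qed
  finally show ?thesis .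
qed

lemma spec_const [simp]: "spec (\<lambda>_. 1) x = x"
  using spec_indicator[of UNIV x] by (simp add: indicator_def)

lemma spec_fun_mult:
  assumes "f \<in> borel_measurable borel" "x \<in> domf f"
  shows "spec (\<lambda>l. c * f l) x = c *\<^sub>R spec f x"
proof (rule LIMSEQ_unique)
  let ?s = "\<lambda>i l. c * simple_approx f i l"
  have "simple_spec (?s i) x = c *\<^sub>R simple_spec (simple_approx f i) x" for i
  proof -
    have "z \<bullet> simple_spec (?s i) x = z \<bullet> (c *\<^sub>R simple_spec (simple_approx f i) x)" for z
      using assms by (simp add: simple_spec_inner simple_function_mult simple_approx form_def right_diff_distrib)
    then show ?thesis using vector_eq_ldot by blast
  qed
  then show "(\<lambda>i. simple_spec (?s i) x) \<longlonglongrightarrow> c *\<^sub>R spec f x"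
    using assms by (simp add: tendsto_scaleR spec_tendsto_approx)
  show "(\<lambda>i. simple_spec (?s i) x) \<longlonglongrightarrow> spec (\<lambda>l. c * f l) x"
  proof (rule spec_tendsto)
    show "\<bar>?s i l\<bar> \<le> \<bar>c\<bar> * (2 * \<bar>f l\<bar>)" for i l
      using simple_approx(3)[OF assms(1), of i l] by (simp add: abs_mult mult_left_mono)
    show "x \<in> domf (\<lambda>l. \<bar>c\<bar> * (2 * \<bar>f l\<bar>))"
      using assms by (intro domf_mult) (auto simp: spectral_dom_def)
  qed (use assms simple_approx[OF assms(1)] in \<open>auto intro!: tendsto_intros domf_mult simple_function_mult\<close>)
qed

lemma spec_fun_diff:
  assumes "f \<in> borel_measurable borel" "g \<in> borel_measurable borel" "x \<in> domf f" "x \<in> domf g"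
  shows "spec (\<lambda>l. f l - g l) x = spec f x - spec g x"
  using spec_fun_add[of f "\<lambda>l. (-1) * g l" x] assms domf_mult[of g x "-1"] spec_fun_mult[of g x "-1"]
  by simp

lemma domf_fun_diff:
  assumes "f \<in> borel_measurable borel" "g \<in> borel_measurable borel" "x \<in> domf f" "x \<in> domf g"
  shows "x \<in> domf (\<lambda>l. f l - g l)"
  using domf_fun_add[of f "\<lambda>l. (-1) * g l" x] assms domf_mult[of g x "-1"] by simp

lemma spec_eq_AE:
  assumes "f \<in> borel_measurable borel" "g \<in> borel_measurable borel" "x \<in> domf f" "x \<in> domf g"
    and "AE l in mu x. f l = g l"
  shows "spec f x = spec g x"
proof -
  have "(norm (spec f x - spec g x))\<^sup>2 = (\<integral>l. (f l - g l)\<^sup>2 \<partial>mu x)"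
    using assms by (simp add: spec_norm domf_fun_diff flip: spec_fun_diff)
  also have "\<dots> = (\<integral>l. 0 \<partial>mu x)"
    using assms by (intro integral_cong_AE) auto
  finally show ?thesis by simp
qed

lemma simple_spec_arg_add: "simple_function borel s \<Longrightarrow> simple_spec s (x + y) = simple_spec s x + simple_spec s y"
  unfolding simple_spec_def by (simp add: E_add simple_vimage scaleR_add_right sum.distrib)

lemma simple_spec_arg_scaleR: "simple_function borel s \<Longrightarrow> simple_spec s (r *\<^sub>R x) = r *\<^sub>R simple_spec s x"
  unfolding simple_spec_def by (simp add: E_scaleR simple_vimage scaleR_sum_right mult.commute)

lemma spec_add:
  assumes "f \<in> borel_measurable borel" "x \<in> domf f" "y \<in> domf f"
  shows "spec f (x + y) = spec f x + spec f y"
proof (rule LIMSEQ_unique[OF spec_tendsto_approx])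
  show "(\<lambda>i. simple_spec (simple_approx f i) (x + y)) \<longlonglongrightarrow> spec f x + spec f y"
    using assms by (simp add: simple_spec_arg_add simple_approx tendsto_add spec_tendsto_approx)
qed (use assms in \<open>auto intro: domf_add\<close>)

lemma spec_scaleR:
  assumes "f \<in> borel_measurable borel" "x \<in> domf f"
  shows "spec f (r *\<^sub>R x) = r *\<^sub>R spec f x"
proof (rule LIMSEQ_unique[OF spec_tendsto_approx])
  show "(\<lambda>i. simple_spec (simple_approx f i) (r *\<^sub>R x)) \<longlonglongrightarrow> r *\<^sub>R spec f x"
    using assms by (simp add: simple_spec_arg_scaleR simple_approx tendsto_scaleR spec_tendsto_approx)
qed (use assms in \<open>auto intro: domf_scaleR\<close>)

lemma spec_diff:
  assumes "f \<in> borel_measurable borel" "x \<in> domf f" "y \<in> domf f"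
  shows "spec f (x - y) = spec f x - spec f y"
  using spec_add[of f x "(-1) *\<^sub>R y"] spec_scaleR[of f y "-1"] domf_scaleR[of f y "-1"] assms by simp

lemma simple_spec_sym: "simple_function borel s \<Longrightarrow> simple_spec s x \<bullet> y = x \<bullet> simple_spec s y"
  unfolding simple_spec_def by (simp add: inner_sum_left inner_sum_right E_sym simple_vimage)

lemma spec_sym:
  assumes "f \<in> borel_measurable borel" "x \<in> domf f" "y \<in> domf f"
  shows "spec f x \<bullet> y = x \<bullet> spec f y"
proof (rule LIMSEQ_unique)
  show "(\<lambda>i. simple_spec (simple_approx f i) x \<bullet> y) \<longlonglongrightarrow> spec f x \<bullet> y"
    by (intro tendsto_intros spec_tendsto_approx assms)
  have "(\<lambda>i. x \<bullet> simple_spec (simple_approx f i) y) \<longlonglongrightarrow> x \<bullet> spec f y"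
    by (intro tendsto_intros spec_tendsto_approx assms)
  then show "(\<lambda>i. simple_spec (simple_approx f i) x \<bullet> y) \<longlonglongrightarrow> x \<bullet> spec f y"
    using assms by (simp add: simple_spec_sym simple_approx)
qed

lemma spec_inner_self:
  assumes f: "f \<in> borel_measurable borel" "x \<in> domf f"
  shows "x \<bullet> spec f x = integral\<^sup>L (mu x) f"
proof (rule LIMSEQ_unique)
  show "(\<lambda>i. x \<bullet> simple_spec (simple_approx f i) x) \<longlonglongrightarrow> x \<bullet> spec f x"
    by (intro tendsto_intros spec_tendsto_approx f)
  have "x \<bullet> simple_spec s x = integral\<^sup>L (mu x) s" if "simple_function borel s" for s
    using that by (simp add: simple_spec_def inner_sum_right simple_integral E_inner_self simple_vimage)
  moreover have "(\<lambda>i. integral\<^sup>L (mu x) (simple_approx f i)) \<longlonglongrightarrow> integral\<^sup>L (mu x) f"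
  proof (rule integral_dominated_convergence)
    show "integrable (mu x) (\<lambda>l. 2 * \<bar>f l\<bar>)" using integrable_of_domf[OF f] by simp
  qed (use f simple_approx[OF f(1)] in \<open>auto intro!: simple_measurable_mu\<close>)
  ultimately show "(\<lambda>i. x \<bullet> simple_spec (simple_approx f i) x) \<longlonglongrightarrow> integral\<^sup>L (mu x) f"
    using simple_approx(1)[OF f(1)] by simp
qed

text \<open>\<open>E S\<close> intersects every level set with \<open>S\<close>, and polarization
  turns the result into integrals restricted to \<open>S\<close>; the level sets of the product need
  no description.\<close>

lemma simple_spec_indicator:
  assumes s: "simple_function borel s" and S: "S \<in> sets borel"
  shows "E S (simple_spec s x) = simple_spec (\<lambda>l. indicator S l * s l) x"
proof -
  have t: "simple_function borel (\<lambda>l. indicator S l * s l)"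
    using s S by (intro simple_function_mult) auto
  have m: "S \<inter> s -` {v} \<in> sets borel" for v using simple_vimage[OF s] S by auto
  have "z \<bullet> E S (simple_spec s x) = z \<bullet> simple_spec (\<lambda>l. indicator S l * s l) x" for z
  proof -
    have "4 * (z \<bullet> E S (simple_spec s x)) = (\<Sum>v\<in>range s. v * (4 * (z \<bullet> E (S \<inter> s -` {v}) x)))"
      unfolding E_simple_spec[OF s S] inner_sum_right sum_distrib_left by (simp add: mult.left_commute)
    also have "\<dots> = (\<Sum>v\<in>range s. v * (norm (E (S \<inter> s -` {v}) (x + z)))\<^sup>2)
        - (\<Sum>v\<in>range s. v * (norm (E (S \<inter> s -` {v}) (x - z)))\<^sup>2)"
      using m by (simp only: right_diff_distrib sum_subtractf flip: E_polarization)
    also have "\<dots> = 4 * (z \<bullet> simple_spec (\<lambda>l. indicator S l * s l) x)"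
      unfolding simple_spec_inner[OF t] form_def simple_integral_on[OF s S] by simp
    finally show ?thesis by simp
  qed
  then show ?thesis using vector_eq_ldot by blast
qed

lemma domf_indicator:
  assumes "f \<in> borel_measurable borel" "x \<in> domf f" "S \<in> sets borel"
  shows "x \<in> domf (\<lambda>l. indicator S l * f l)"
  by (rule domf_mono[of _ f]) (use assms in \<open>auto simp: indicator_def\<close>)

lemma E_spec:
  assumes f: "f \<in> borel_measurable borel" "x \<in> domf f" and S: "S \<in> sets borel"
  shows "E S (spec f x) = spec (\<lambda>l. indicator S l * f l) x"
proof (rule LIMSEQ_unique)
  let ?s = "\<lambda>i l. indicator S l * simple_approx f i l"
  show "(\<lambda>i. simple_spec (?s i) x) \<longlonglongrightarrow> E S (spec f x)"
    unfolding simple_spec_indicator[OF simple_approx(1)[OF f(1)] S, symmetric]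
    by (intro bounded_linear.tendsto[OF bounded_linear_E] S spec_tendsto_approx f)
  show "(\<lambda>i. simple_spec (?s i) x) \<longlonglongrightarrow> spec (\<lambda>l. indicator S l * f l) x"
  proof (rule spec_tendsto)
    show "\<bar>?s i l\<bar> \<le> 2 * \<bar>f l\<bar>" for i l
      using simple_approx(3)[OF f(1), of i l] by (auto simp: indicator_def)
    show "x \<in> domf (\<lambda>l. 2 * \<bar>f l\<bar>)"
      using f by (intro domf_mult) (auto simp: spectral_dom_def)
  qed (use f S simple_approx[OF f(1)] domf_indicator[OF f S] in \<open>auto intro!: tendsto_intros simple_function_mult\<close>)
qed

text \<open>\<open>E S\<close> acts on \<open>spec f x\<close> by cutting \<open>f\<close> off to
  \<open>S\<close>, so the spectral measure of \<open>spec f x\<close> has density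
  \<open>f\<^sup>2\<close> with respect to that of \<open>x\<close>. The domains of products follow
  from this.\<close>

lemma nn_integral_mu_spec:
  assumes f: "f \<in> borel_measurable borel" "x \<in> domf f" and u: "u \<in> borel_measurable borel"
  shows "nn_integral (mu (spec f x)) u = (\<integral>\<^sup>+ l. ennreal ((f l)\<^sup>2) * u l \<partial>mu x)"
proof -
  have "mu (spec f x) = density (mu x) (\<lambda>l. ennreal ((f l)\<^sup>2))"
  proof (rule measure_eqI)
    fix S assume "S \<in> sets (mu (spec f x))"
    then have S: "S \<in> sets borel" by simp
    have "emeasure (mu (spec f x)) S = ennreal (\<integral>l. (indicator S l * f l)\<^sup>2 \<partial>mu x)"
      using S f by (simp add: emeasure_mu E_spec spec_norm domf_indicator)
    also have "\<dots> = (\<integral>\<^sup>+l. ennreal ((indicator S l * f l)\<^sup>2) \<partial>mu x)"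
      using domf_indicator[OF f S] by (intro nn_integral_eq_integral[symmetric]) (auto simp: spectral_dom_def)
    also have "\<dots> = (\<integral>\<^sup>+l. ennreal ((f l)\<^sup>2) * indicator S l \<partial>mu x)"
      by (intro nn_integral_cong) (auto simp: indicator_def)
    also have "\<dots> = emeasure (density (mu x) (\<lambda>l. ennreal ((f l)\<^sup>2))) S"
      using S f by (subst emeasure_density) auto
    finally show "emeasure (mu (spec f x)) S = emeasure (density (mu x) (\<lambda>l. ennreal ((f l)\<^sup>2))) S" .
  qed simp
  then show ?thesis using f u by (simp add: nn_integral_density)
qed

lemma in_domf_spec_iff:
  assumes "f \<in> borel_measurable borel" "x \<in> domf f" "g \<in> borel_measurable borel"
  shows "spec f x \<in> domf g \<longleftrightarrow> x \<in> domf (\<lambda>l. g l * f l)"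
  using assms by (simp add: in_domf_iff nn_integral_mu_spec power_mult_distrib ennreal_mult' mult.commute)

lemma spec_spec_simple:
  assumes f: "f \<in> borel_measurable borel" "x \<in> domf f" and s: "simple_function borel s"
  shows "simple_spec s (spec f x) = spec (\<lambda>l. s l * f l) x"
proof -
  \<comment> \<open>Induction over the finitely many values of \<open>s\<close>, carrying the domain
    condition along because additivity requires it.\<close>
  have *: "spec (\<lambda>l. \<Sum>v\<in>V. v * (indicator (s -` {v}) l * f l)) x
      = (\<Sum>v\<in>V. v *\<^sub>R spec (\<lambda>l. indicator (s -` {v}) l * f l) x) \<and>
      x \<in> domf (\<lambda>l. \<Sum>v\<in>V. v * (indicator (s -` {v}) l * f l))" if "finite V" for V
    using that
  proof induction
    case empty
    show ?case using spec_fun_mult[of "\<lambda>_. 1" x 0] in_domf_bounded[of "\<lambda>_. 1" 1 x] in_domf_bounded[of "\<lambda>_. 0" 0 x] by simp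
  next
    case (insert v V)
    have m: "(\<lambda>l. indicator (s -` {v}) l * f l) \<in> borel_measurable borel" for v
      using f simple_vimage[OF s] by measurable
    have d: "x \<in> domf (\<lambda>l. indicator (s -` {v}) l * f l)"
      by (rule domf_indicator[OF f simple_vimage[OF s]])
    show ?case
      using insert m d by (simp add: spec_fun_add domf_mult spec_fun_mult domf_fun_add)
  qed
  have "(\<lambda>l. s l * f l) = (\<lambda>l. \<Sum>v\<in>range s. v * (indicator (s -` {v}) l * f l))"
  proof
    fix l
    have "(\<Sum>v\<in>range s. v * (indicator (s -` {v}) l * f l)) = (\<Sum>v\<in>range s. if v = s l then v * f l else 0)"
      by (intro sum.cong) (auto simp: indicator_def)
    then show "s l * f l = (\<Sum>v\<in>range s. v * (indicator (s -` {v}) l * f l))"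
      using simple_range[OF s] by simp
  qed
  then show ?thesis
    using *[OF simple_range[OF s]] unfolding simple_spec_def
    by (simp add: E_spec f simple_vimage[OF s])
qed

text \<open>With \<open>f\<close> fixed, \<open>g\<close> is approximated in the
  \<open>L\<^sup>2\<close> space of the measure of \<open>spec f x\<close>. As this measure has
  density \<open>f\<^sup>2\<close>, the products then converge in the \<open>L\<^sup>2\<close> space
  of the measure of \<open>x\<close>.\<close>

lemma spec_spec:
  assumes f: "f \<in> borel_measurable borel" "x \<in> domf f"
    and g: "g \<in> borel_measurable borel" "x \<in> domf (\<lambda>l. g l * f l)"
  shows "spec g (spec f x) = spec (\<lambda>l. g l * f l) x"
proof (rule LIMSEQ_unique)
  have gd: "spec f x \<in> domf g" using f g by (simp add: in_domf_spec_iff)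
  show "(\<lambda>i. simple_spec (simple_approx g i) (spec f x)) \<longlonglongrightarrow> spec g (spec f x)"
    by (rule spec_tendsto_approx[OF g(1) gd])
  have d: "x \<in> domf (\<lambda>l. simple_approx g i l * f l)" for i
    using in_domf_spec_iff[OF f, of "simple_approx g i"] simple_approx[OF g(1)]
    by (simp add: simple_in_domf simple_measurable)
  have m: "simple_approx g i \<in> borel_measurable borel" for i
    using simple_approx[OF g(1)] by (simp add: simple_measurable)
  have "(norm (spec (\<lambda>l. simple_approx g i l * f l) x - spec (\<lambda>l. g l * f l) x))\<^sup>2
      = (\<integral>l. (simple_approx g i l - g l)\<^sup>2 \<partial>mu (spec f x))" for i
  proof -
    have "(norm (spec (\<lambda>l. simple_approx g i l * f l) x - spec (\<lambda>l. g l * f l) x))\<^sup>2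
       = (\<integral>l. (simple_approx g i l * f l - g l * f l)\<^sup>2 \<partial>mu x)"
      using f g d m by (simp add: spec_norm domf_fun_diff flip: spec_fun_diff)
    also have "\<dots> = (\<integral>l. (simple_approx g i l - g l)\<^sup>2 \<partial>mu (spec f x))"
      using f g m d by (simp add: integral_eq_nn_integral nn_integral_mu_spec)
        (intro arg_cong[of _ _ enn2real] nn_integral_cong, simp add: power2_eq_square algebra_simps flip: ennreal_mult')
    finally show ?thesis .
  qed
  then have "(\<lambda>i. (norm (spec (\<lambda>l. simple_approx g i l * f l) x - spec (\<lambda>l. g l * f l) x))\<^sup>2) \<longlonglongrightarrow> 0"
    using simple_approx_tendsto[OF g(1) gd] by simp
  then have "(\<lambda>i. sqrt ((norm (spec (\<lambda>l. simple_approx g i l * f l) x - spec (\<lambda>l. g l * f l) x))\<^sup>2)) \<longlonglongrightarrow> sqrt 0"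
    by (rule tendsto_real_sqrt)
  then have "(\<lambda>i. spec (\<lambda>l. simple_approx g i l * f l) x) \<longlonglongrightarrow> spec (\<lambda>l. g l * f l) x"
    by (simp add: tendsto_norm_zero_iff LIM_zero_iff)
  then show "(\<lambda>i. simple_spec (simple_approx g i) (spec f x)) \<longlonglongrightarrow> spec (\<lambda>l. g l * f l) x"
    using spec_spec_simple[OF f simple_approx(1)[OF g(1)]] by simp
qed

text \<open>\<open>E (F n)\<close> is an orthogonal projection, so the squared distance to
  \<open>x\<close> is the loss of squared norm, and continuity of the measure from below makes it
  vanish.\<close>

lemma E_tendsto:
  fixes F :: "nat \<Rightarrow> real set"
  assumes F: "\<And>n. F n \<in> sets borel" "incseq F" "(\<Union>n. F n) = UNIV"
  shows "(\<lambda>n. E (F n) x) \<longlonglongrightarrow> x"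
proof -
  have "(\<lambda>n. measure (mu x) (F n)) \<longlonglongrightarrow> measure (mu x) (\<Union>n. F n)"
    using F by (intro finite_measure.finite_Lim_measure_incseq[OF finite_measure_mu]) auto
  then have "(\<lambda>n. (norm x)\<^sup>2 - (norm (E (F n) x))\<^sup>2) \<longlonglongrightarrow> (norm x)\<^sup>2 - (norm x)\<^sup>2"
    using F measure_mu[of UNIV x] by (intro tendsto_diff tendsto_const) (simp add: measure_mu)
  moreover have "(norm x)\<^sup>2 - (norm (E (F n) x))\<^sup>2 = (norm (E (F n) x - x))\<^sup>2" for n
    using E_inner_self[OF F(1), of x]
    by (simp add: power2_norm_eq_inner inner_diff_left inner_diff_right inner_commute)
  ultimately have "(\<lambda>n. sqrt ((norm (E (F n) x - x))\<^sup>2)) \<longlonglongrightarrow> sqrt 0"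
    by (intro tendsto_real_sqrt) simp
  then have "(\<lambda>n. E (F n) x - x) \<longlonglongrightarrow> 0" by (simp add: tendsto_norm_zero_iff)
  then show ?thesis by (simp add: LIM_zero_iff)
qed

text \<open>The projections of \<open>y\<close> to the sets where \<bar>f\<bar> is at most
  \<open>n\<close> lie in the domain and converge to \<open>y\<close>, so \<open>y\<close> is
  orthogonal to itself.\<close>

lemma domf_dense:
  assumes f: "f \<in> borel_measurable borel" and orth: "\<And>z. z \<in> domf f \<Longrightarrow> z \<bullet> y = 0"
  shows "y = 0"
proof -
  define F where "F n = {l. \<bar>f l\<bar> \<le> real n}" for n
  have Fm: "F n \<in> sets borel" for n unfolding F_def using f by measurable
  have lim: "(\<lambda>n. E (F n) y) \<longlonglongrightarrow> y"
  proof (rule E_tendsto[OF Fm])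
    show "incseq F" by (auto simp: F_def incseq_def intro: order_trans)
    show "(\<Union>n. F n) = UNIV" by (auto simp: F_def real_arch_simple)
  qed
  have "E (F n) y \<in> domf f" for n
  proof -
    have "E (F n) y = spec (indicator (F n)) y" using Fm by simp
    moreover have "y \<in> domf (\<lambda>l. f l * indicator (F n) l)"
      by (rule in_domf_bounded[of _ "real n"]) (use f Fm in \<open>auto simp: F_def indicator_def\<close>)
    ultimately show ?thesis
      using f Fm in_domf_spec_iff[of "indicator (F n)" y f] in_domf_bounded[of "indicator (F n)" 1 y]
      by (auto simp: indicator_def)
  qed
  then have "E (F n) y \<bullet> y = 0" for n by (rule orth)
  moreover have "(\<lambda>n. E (F n) y \<bullet> y) \<longlonglongrightarrow> y \<bullet> y"
    by (intro tendsto_intros lim)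
  ultimately have "y \<bullet> y = 0" by (simp add: LIMSEQ_const_iff)
  then show ?thesis by simp
qed

text \<open>\<open>spec f x\<close> solves the defining relation by \<open>spec_inner\<close>;
  density of the domain excludes a second solution.\<close>

lemma spectral_integral_eq:
  assumes f: "f \<in> borel_measurable borel"
  shows "spectral_integral E f = {(x, spec f x) | x. x \<in> domf f}"
proof -
  have "(x, y) \<in> spectral_integral E f \<longleftrightarrow> x \<in> domf f \<and> y = spec f x" for x y
  proof (cases "x \<in> domf f")
    case True
    have "(\<forall>z\<in>domf f. z \<bullet> y = form f x z) \<longleftrightarrow> (\<forall>z\<in>domf f. z \<bullet> (y - spec f x) = 0)"
      using spec_inner[OF f True] by (auto simp: inner_diff_right)
    also have "\<dots> \<longleftrightarrow> y = spec f x"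
      using domf_dense[OF f, of "y - spec f x"] by auto
    finally show ?thesis using True by (simp add: spectral_integral_def form_def)
  qed (simp add: spectral_integral_def)
  then show ?thesis by auto
qed

end

section \<open>Uniqueness of the spectral measure\<close>

lemma spectral_mu_cong:
  assumes "\<And>S. S \<in> sets borel \<Longrightarrow> E S x = F S x"
  shows "spectral_mu E x = spectral_mu F x"
  unfolding spectral_mu_def
  by (rule measure_of_eq) (use assms in \<open>auto simp: sets.sigma_sets_eq[of borel, simplified]\<close>)

lemma spectral_integral_cong:
  assumes "\<And>S x. S \<in> sets borel \<Longrightarrow> E S x = F S x"
  shows "spectral_integral E f = spectral_integral F f"
  using spectral_mu_cong[of E _ F] assms unfolding spectral_integral_def spectral_dom_def by simp

text \<open>Weierstrass approximation on [0, 1], which contains the range of \<open>r\<close>: equal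
  moments give equal integrals of polynomials in \<open>r\<close>, and these are uniformly close to
  \<phi> composed with \<open>r\<close>.\<close>

lemma finite_measure_eq_moments:
  fixes M N :: "real measure" and r \<phi> :: "real \<Rightarrow> real"
  assumes fin: "finite_measure M" "finite_measure N"
    and r: "r \<in> borel_measurable M" "r \<in> borel_measurable N" "\<And>l. r l \<in> {0..1}"
    and mom: "\<And>n. (\<integral>l. r l ^ n \<partial>M) = (\<integral>l. r l ^ n \<partial>N)"
    and c: "continuous_on {0..1} \<phi>"
  shows "(\<integral>l. \<phi> (r l) \<partial>M) = (\<integral>l. \<phi> (r l) \<partial>N)"
proof (rule ccontr)
  assume ne: "(\<integral>l. \<phi> (r l) \<partial>M) \<noteq> (\<integral>l. \<phi> (r l) \<partial>N)"
  define d where "d = \<bar>(\<integral>l. \<phi> (r l) \<partial>M) - (\<integral>l. \<phi> (r l) \<partial>N)\<bar>"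
  \<comment> \<open>The summand 1 makes \<open>m\<close> positive and leaves the factor
    \<open>(m - 1) / m < 1\<close> that yields the contradiction.\<close>
  define m where "m = measure M (space M) + measure N (space N) + 1"
  have d: "d > 0" and m: "m > 0"
    using ne by (auto simp: d_def m_def add_nonneg_pos)
  obtain g where g: "real_polynomial_function g" "\<And>x. x \<in> {0..1} \<Longrightarrow> \<bar>\<phi> x - g x\<bar> < d / m"
    using Stone_Weierstrass_real_polynomial_function[OF compact_Icc c, of "d / m"] d m by auto
  obtain a n where ga: "g = (\<lambda>x. \<Sum>i\<le>n. a i * x ^ i)"
    using g(1) by (auto simp: real_polynomial_function_iff_sum)
  have gc: "continuous_on {0..1} g" unfolding ga by (intro continuous_intros)
  have int: "integrable K (\<lambda>l. f (r l))" if K: "finite_measure K" "r \<in> borel_measurable K" and f: "continuous_on {0..1} f" for K and f :: "real \<Rightarrow> real"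
  proof -
    obtain B where B: "\<And>x. x \<in> {0..1} \<Longrightarrow> \<bar>f x\<bar> \<le> B"
      using compact_imp_bounded[OF compact_continuous_image[OF f compact_Icc]]
      unfolding bounded_iff real_norm_def by blast
    have "(\<lambda>x. indicator {0..1} x *\<^sub>R f x) \<in> borel_measurable borel"
      by (intro borel_measurable_continuous_on_indicator f) auto
    from measurable_compose[OF K(2) this] have "(\<lambda>l. f (r l)) \<in> borel_measurable K"
      using r(3) by (simp add: indicator_def)
    then show ?thesis
      using K(1) B r(3) by (intro finite_measure.integrable_const_bound[of K _ B]) auto
  qed
  have close: "\<bar>(\<integral>l. \<phi> (r l) \<partial>K) - (\<integral>l. g (r l) \<partial>K)\<bar> \<le> d / m * measure K (space K)"
    if K: "finite_measure K" "r \<in> borel_measurable K" for K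
  proof -
    have "\<bar>(\<integral>l. \<phi> (r l) \<partial>K) - (\<integral>l. g (r l) \<partial>K)\<bar> = \<bar>\<integral>l. \<phi> (r l) - g (r l) \<partial>K\<bar>"
      using int[OF K c] int[OF K gc] by simp
    also have "\<dots> \<le> (\<integral>l. \<bar>\<phi> (r l) - g (r l)\<bar> \<partial>K)" by (rule integral_abs_bound)
    also have "\<dots> \<le> (\<integral>l. d / m \<partial>K)"
      using int[OF K c] int[OF K gc] g(2) r(3) finite_measure.integrable_const[OF K(1)]
      by (intro integral_mono) (auto intro: less_imp_le)
    finally show ?thesis by (simp add: mult.commute)
  qed
  have "(\<integral>l. g (r l) \<partial>K) = (\<Sum>i\<le>n. a i * (\<integral>l. r l ^ i \<partial>K))"
    if K: "finite_measure K" "r \<in> borel_measurable K" for K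
  proof -
    have "integrable K (\<lambda>l. r l ^ i)" for i by (rule int[OF K]) (intro continuous_intros)
    then show ?thesis unfolding ga by (subst Bochner_Integration.integral_sum) auto
  qed
  then have "(\<integral>l. g (r l) \<partial>M) = (\<integral>l. g (r l) \<partial>N)"
    using fin r mom by simp
  then have "d \<le> d / m * measure M (space M) + d / m * measure N (space N)"
    using close[OF fin(1) r(1)] close[OF fin(2) r(2)] by (simp add: d_def)
  also have "\<dots> = d * ((m - 1) / m)" by (simp add: m_def add_divide_distrib distrib_left)
  also have "\<dots> < d * 1" using d m by (intro mult_strict_left_mono) auto
  finally show False by simp
qed

lemma measure_eq_resolvent_moments:
  fixes M N :: "real measure"
  assumes fin: "finite_measure M" "finite_measure N" and s: "sets M = sets borel" "sets N = sets borel"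
    and neg: "emeasure M {..<0} = 0" "emeasure N {..<0} = 0"
    and mom: "\<And>n. (\<integral>l. (1 / (1 + max 0 l)) ^ n \<partial>M) = (\<integral>l. (1 / (1 + max 0 l)) ^ n \<partial>N)"
  shows "M = N"
proof -
  define r where "r l = 1 / (1 + max 0 l)" for l :: real
  have rm: "r \<in> borel_measurable borel" unfolding r_def by measurable
  then have rM: "r \<in> borel_measurable M" "r \<in> borel_measurable N"
    using s by (simp_all cong: measurable_cong_sets)
  have r01: "r l \<in> {0..1}" for l by (auto simp: r_def)
  \<comment> \<open>A continuous ramp that vanishes for \<open>y \<ge> r x\<close> and tends to 1
    for \<open>y < r x\<close>. Since \<open>r\<close> decreases on the half-line, its composition
    with \<open>r\<close> approximates the indicator of \<open>{x<..}\<close>.\<close>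
  define \<phi> where "\<phi> x k y = min 1 (max 0 (real k * (r x - y)))" for x :: real and k :: nat and y :: real
  have lim: "(\<lambda>k. \<phi> x k (r l)) \<longlonglongrightarrow> indicator {x<..} l" if x: "x \<ge> 0" for x l
  proof (cases "l > x")
    case True
    then have "r x - r l > 0" using x by (simp add: r_def divide_strict_left_mono)
    then obtain n :: nat where n: "real n * (r x - r l) > 1" using reals_Archimedean3 by blast
    have "\<phi> x k (r l) = 1" if "k \<ge> n" for k
    proof -
      have "real n * (r x - r l) \<le> real k * (r x - r l)"
        using that \<open>r x - r l > 0\<close> by (intro mult_right_mono) auto
      then show ?thesis using n by (simp add: \<phi>_def)
    qed
    then show ?thesis using True
      by (intro tendsto_eventually) (auto simp: eventually_sequentially)
  next
    case False
    then have "r x - r l \<le> 0" using x by (auto simp: r_def intro!: divide_left_mono)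
    then have "\<phi> x k (r l) = 0" for k by (simp add: \<phi>_def mult_nonneg_nonpos)
    then show ?thesis using False by simp
  qed
  have lims: "(\<lambda>k. \<integral>l. \<phi> x k (r l) \<partial>K) \<longlonglongrightarrow> measure K {x<..}"
    if K: "finite_measure K" "sets K = sets borel" and x: "x \<ge> 0" for K x
  proof -
    have m: "(\<lambda>l. \<phi> x k (r l)) \<in> borel_measurable K" for k
      using K(2) rm unfolding \<phi>_def by (simp cong: measurable_cong_sets)
    have "(\<lambda>k. \<integral>l. \<phi> x k (r l) \<partial>K) \<longlonglongrightarrow> (\<integral>l. indicator {x<..} l \<partial>K)"
    proof (rule integral_dominated_convergence)
      show "integrable K (\<lambda>_. 1 :: real)" using K(1) by (rule finite_measure.integrable_const)
      show "AE l in K. (\<lambda>k. \<phi> x k (r l)) \<longlonglongrightarrow> indicator {x<..} l" using lim[OF x] by (intro AE_I2)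
      show "AE l in K. norm (\<phi> x k (r l)) \<le> 1" for k by (intro AE_I2) (simp add: \<phi>_def)
      show "indicator {x<..} \<in> borel_measurable K" using K(2) by (intro borel_measurable_indicator) simp
    qed (rule m)
    then show ?thesis using K(2) by (simp add: sets_eq_imp_space_eq[OF K(2)])
  qed
  have eq: "emeasure M {x<..} = emeasure N {x<..}" if x: "x \<ge> 0" for x
  proof -
    have "(\<integral>l. \<phi> x k (r l) \<partial>M) = (\<integral>l. \<phi> x k (r l) \<partial>N)" for k
    proof (rule finite_measure_eq_moments[OF fin rM r01])
      show "(\<integral>l. r l ^ n \<partial>M) = (\<integral>l. r l ^ n \<partial>N)" for n unfolding r_def by (rule mom)
      show "continuous_on {0..1} (\<phi> x k)" unfolding \<phi>_def by (intro continuous_intros)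
    qed
    then have "measure M {x<..} = measure N {x<..}"
      using lims[OF fin(1) s(1) x] lims[OF fin(2) s(2) x] by (simp add: LIMSEQ_unique)
    then show ?thesis using fin by (simp add: finite_measure.emeasure_eq_measure)
  qed
  have tot: "emeasure M UNIV = emeasure N UNIV"
    using mom[of 0] fin s by (simp add: finite_measure.emeasure_eq_measure sets_eq_imp_space_eq[OF s(1)] sets_eq_imp_space_eq[OF s(2)])
  have eq': "emeasure K {x<..} = emeasure K UNIV" if K: "sets K = sets borel" "emeasure K {..<0} = 0" and x: "x < 0" for K and x :: real
  proof (rule emeasure_eq_AE)
    have "{..<0} \<in> null_sets K" using K by (auto intro: null_setsI)
    then have "AE l in K. l \<notin> {..<0}" by (rule AE_not_in)
    then show "AE l in K. (l \<in> {x<..}) = (l \<in> UNIV)" by (rule eventually_mono) (use x in auto)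
  qed (use K in auto)
  show "M = N"
  proof (rule measure_eqI_lessThan[OF s])
    show "emeasure M {x<..} < \<infinity>" for x
      using finite_measure.emeasure_finite[OF fin(1)] by (simp add: less_top)
    show "emeasure M {x<..} = emeasure N {x<..}" for x
      using eq[of x] eq'[OF s(1) neg(1), of x] eq'[OF s(2) neg(2), of x] tot by (cases "x \<ge> 0") auto
  qed
qed

section \<open>Support of the spectral measures and the resolvent\<close>

locale nonneg_spectral = pvm E for E :: "real set \<Rightarrow> 'x::{real_inner,banach} \<Rightarrow> 'x" +
  fixes A :: "('x \<times> 'x) set"
  assumes A_eq: "A = spectral_integral E (\<lambda>l. l)"
    and A_nonneg: "\<And>x y. (x, y) \<in> A \<Longrightarrow> 0 \<le> x \<bullet> y"
begin

lemma A_iff: "(x, y) \<in> A \<longleftrightarrow> x \<in> domf (\<lambda>l. l) \<and> y = spec (\<lambda>l. l) x"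
  unfolding A_eq by (subst spectral_integral_eq) auto

text \<open>A vector in the range of \<open>E S\<close>, with \<open>S\<close> bounded and strictly
  left of 0, would have a negative quadratic form unless it vanishes. Such sets exhaust the negative
  axis.\<close>

lemma emeasure_mu_neg: "emeasure (mu x) {..<0} = 0"
proof -
  \<comment> \<open>The left end puts the range of \<open>E (F n)\<close> into the domain of A; the
    right end gives the form the negative upper bound \<open>- 1 / real (Suc n)\<close> times the
    squared norm.\<close>
  define F where "F n = {- real n .. - 1 / real (Suc n)}" for n :: nat
  have Fm: "F n \<in> sets borel" for n by (simp add: F_def)
  have "E (F n) x = 0" for n
  proof -
    have z: "E (F n) x = spec (indicator (F n)) x" using Fm by simp
    have d: "x \<in> domf (\<lambda>l. l * indicator (F n) l)"
    proof (rule in_domf_bounded[of _ "real n"])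
      have "- 1 / real (Suc n) \<le> real n" by (rule order_trans[of _ 0]) auto
      then show "\<bar>l * indicator (F n) l\<bar> \<le> real n" for l by (auto simp: F_def indicator_def)
    qed (use Fm in auto)
    have i: "x \<in> domf (indicator (F n))" by (rule in_domf_bounded[of _ 1]) (use Fm in auto)
    have Ed: "E (F n) x \<in> domf (\<lambda>l. l)"
      unfolding z using Fm i d by (subst in_domf_spec_iff) auto
    have "0 \<le> E (F n) x \<bullet> spec (\<lambda>l. l) (E (F n) x)"
      by (rule A_nonneg) (simp add: A_iff Ed)
    also have "E (F n) x \<bullet> spec (\<lambda>l. l) (E (F n) x) = (\<integral>l. l \<partial>mu (E (F n) x))"
      using Ed by (intro spec_inner_self) auto
    also have "\<dots> \<le> (\<integral>l. - 1 / real (Suc n) \<partial>mu (E (F n) x))"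
    proof (rule integral_mono_AE)
      show "integrable (mu (E (F n) x)) (\<lambda>l. l)" using Ed by (intro integrable_of_domf) auto
      have "emeasure (mu (E (F n) x)) (- F n) = 0"
        using Fm by (simp add: emeasure_mu E_E)
      then have "- F n \<in> null_sets (mu (E (F n) x))" using Fm by auto
      then have "AE l in mu (E (F n) x). l \<notin> - F n" by (rule AE_not_in)
      then show "AE l in mu (E (F n) x). l \<le> - 1 / real (Suc n)"
        by (rule eventually_mono) (auto simp: F_def)
    qed (auto intro!: integrable_mu_bounded)
    also have "\<dots> = - (norm (E (F n) x))\<^sup>2 / real (Suc n)"
      using measure_mu[of UNIV "E (F n) x"] by simp
    finally have "(norm (E (F n) x))\<^sup>2 \<le> 0" by (simp add: divide_le_0_iff)
    then show ?thesis by simp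
  qed
  then have "emeasure (mu x) (F n) = 0" for n using Fm by (simp add: emeasure_mu)
  then have "emeasure (mu x) (\<Union>n. F n) = 0"
    using Fm by (intro emeasure_UN_eq_0) auto
  also have "(\<Union>n. F n) = {..<0}"
  proof (rule antisym)
    show "(\<Union>n. F n) \<subseteq> {..<0}"
    proof
      fix l assume "l \<in> (\<Union>n. F n)"
      then obtain n where "l \<le> - 1 / real (Suc n)" by (auto simp: F_def)
      also have "\<dots> < 0" by simp
      finally show "l \<in> {..<0}" by simp
    qed
    show "{..<0} \<subseteq> (\<Union>n. F n)"
    proof
      fix l :: real assume "l \<in> {..<0}"
      then have l: "l < 0" by simp
      obtain a where a: "- l \<le> real a" using real_arch_simple by blast
      obtain b where b: "inverse (real (Suc b)) < - l" using l reals_Archimedean[of "- l"] by auto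
      have "inverse (real (Suc (max a b))) \<le> inverse (real (Suc b))" by (intro le_imp_inverse_le) auto
      then have "l \<le> - inverse (real (Suc (max a b)))" using b by linarith
      then have "l \<in> F (max a b)" using a by (simp add: F_def divide_inverse)
      then show "l \<in> (\<Union>n. F n)" by blast
    qed
  qed
  finally show ?thesis .
qed

lemma AE_mu_nonneg: "AE l in mu x. 0 \<le> l"
proof -
  have "{..<0} \<in> null_sets (mu x)" using emeasure_mu_neg by (auto intro: null_setsI)
  then have "AE l in mu x. l \<notin> {..<0}" by (rule AE_not_in)
  then show ?thesis by (rule eventually_mono) auto
qed

text \<open>From l r(l) = 1 - r(l) for l \<ge> 0 it follows that (1 + A) R w = w. Membership in the
  graph states this about A itself, so that the resolvents built from two spectral measures can be
  compared.\<close>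

lemma resolvent_in_A:
  "(spec (\<lambda>l. 1 / (1 + max 0 l)) w, w - spec (\<lambda>l. 1 / (1 + max 0 l)) w) \<in> A"
proof -
  let ?r = "\<lambda>l::real. 1 / (1 + max 0 l)"
  have rb: "w \<in> domf ?r" by (rule in_domf_bounded[of _ 1]) auto
  \<comment> \<open>\<open>l * ?r l\<close> equals l on the negative axis and is unbounded there;
    \<open>h\<close> is a bounded function that agrees with it almost everywhere.\<close>
  define h where "h l = (if l \<ge> 0 then l / (1 + l) else 0)" for l :: real
  have hm: "h \<in> borel_measurable borel" unfolding h_def by measurable
  then have hb: "w \<in> domf h" by (rule in_domf_bounded[of _ 1]) (auto simp: h_def)
  have ae: "AE l in mu w. l * ?r l = h l"
    using AE_mu_nonneg by (rule eventually_mono) (auto simp: h_def max_def)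
  have d: "w \<in> domf (\<lambda>l. l * ?r l)"
  proof -
    have "(\<integral>\<^sup>+ l. ennreal ((l * ?r l)\<^sup>2) \<partial>mu w) = (\<integral>\<^sup>+ l. ennreal ((h l)\<^sup>2) \<partial>mu w)"
      by (rule nn_integral_cong_AE) (use ae in \<open>rule eventually_mono, simp\<close>)
    then show ?thesis using hb hm by (simp add: in_domf_iff)
  qed
  have e: "spec ?r w \<in> domf (\<lambda>l. l)" using d rb by (subst in_domf_spec_iff) auto
  have "spec (\<lambda>l. l) (spec ?r w) = spec (\<lambda>l. l * ?r l) w"
    using rb d by (intro spec_spec) auto
  also have "\<dots> = spec (\<lambda>l. 1 - ?r l) w"
  proof (rule spec_eq_AE)
    show "w \<in> domf (\<lambda>l. 1 - ?r l)" using rb by (intro domf_fun_diff in_domf_bounded[of "\<lambda>_. 1" 1]) auto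
    show "AE l in mu w. l * ?r l = 1 - ?r l"
      using AE_mu_nonneg by (rule eventually_mono) (auto simp: max_def field_simps)
  qed (use d in auto)
  also have "\<dots> = w - spec ?r w"
    using rb by (subst spec_fun_diff) (auto intro: in_domf_bounded[of "\<lambda>_. 1" 1])
  finally show ?thesis using e by (simp add: A_iff)
qed

lemma spec_resolvent_power:
  "((\<lambda>y. spec (\<lambda>l. 1 / (1 + max 0 l)) y) ^^ n) x = spec (\<lambda>l. (1 / (1 + max 0 l)) ^ n) x"
proof (induction n)
  case (Suc n)
  have b: "x \<in> domf (\<lambda>l. (1 / (1 + max 0 l)) ^ n)" for n
    by (rule in_domf_bounded[of _ 1]) (auto simp: power_le_one)
  show ?case using Suc b[of n] b[of "Suc n"] by (simp add: spec_spec)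
qed simp

end

text \<open>\<open>A\<close> determines its resolvent \<open>R = (1 + A)\<^sup>-\<^sup>1\<close>, and \<open>\<langle>x, R\<^sup>n x\<rangle>\<close> are the moments of the image of the
  measure of \<open>x\<close> under \<open>l \<mapsto> 1 / (1 + l)\<close>.\<close>

lemma spectral_measure_unique:
  assumes "nonneg_spectral E A" "nonneg_spectral F A" and S: "S \<in> sets borel"
  shows "E S x = F S x"
proof -
  interpret E: nonneg_spectral E A by fact
  interpret F: nonneg_spectral F A by fact
  let ?r = "\<lambda>l::real. 1 / (1 + max 0 l)"
  have R: "E.spec ?r w = F.spec ?r w" for w
  proof -
    let ?x = "E.spec ?r w" and ?y = "F.spec ?r w"
    have "?x \<in> E.domf (\<lambda>l. l)" "?y \<in> E.domf (\<lambda>l. l)" 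
      and "E.spec (\<lambda>l. l) ?x = w - ?x" "E.spec (\<lambda>l. l) ?y = w - ?y"
      using E.resolvent_in_A[of w] F.resolvent_in_A[of w] by (auto simp: E.A_iff)
    \<comment> \<open>Both vectors solve x + A x = w, so their difference d satisfies A d = -d, and
      nonnegativity of A forces d = 0.\<close>
    then have "(?x - ?y, (w - ?x) - (w - ?y)) \<in> A"
      by (simp add: E.A_iff E.domf_diff E.spec_diff)
    from E.A_nonneg[OF this] have "0 \<le> - ((?x - ?y) \<bullet> (?x - ?y))"
      by (simp add: inner_diff_left inner_diff_right inner_commute)
    then have "(?x - ?y) \<bullet> (?x - ?y) = 0" using inner_ge_zero[of "?x - ?y"] by linarith
    then show ?thesis by simp
  qed
  have mu: "spectral_mu E x = spectral_mu F x" for x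
  proof (rule measure_eq_resolvent_moments)
    fix n
    have "E.spec (\<lambda>l. ?r l ^ n) x = F.spec (\<lambda>l. ?r l ^ n) x"
      using R by (simp flip: E.spec_resolvent_power F.spec_resolvent_power)
    moreover have "x \<in> E.domf (\<lambda>l. ?r l ^ n)" "x \<in> F.domf (\<lambda>l. ?r l ^ n)"
      by (rule E.in_domf_bounded[of _ 1] F.in_domf_bounded[of _ 1]; auto simp: power_le_one)+
    ultimately show "(\<integral>l. ?r l ^ n \<partial>spectral_mu E x) = (\<integral>l. ?r l ^ n \<partial>spectral_mu F x)"
      using E.spec_inner_self[of "\<lambda>l. ?r l ^ n" x] F.spec_inner_self[of "\<lambda>l. ?r l ^ n" x] by simp
  qed (auto simp: E.finite_measure_mu F.finite_measure_mu E.emeasure_mu_neg F.emeasure_mu_neg)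
  have q: "(norm (E S y))\<^sup>2 = (norm (F S y))\<^sup>2" for y
    using E.measure_mu[OF S, of y] F.measure_mu[OF S, of y] mu[of y] by simp
  have "z \<bullet> E S x = z \<bullet> F S x" for z
    using E.E_polarization[OF S, of x z] F.E_polarization[OF S, of x z] q by simp
  then show ?thesis using vector_eq_ldot by blast
qed

text \<open>\<open>fun_calc\<close> ranges over all spectral measures of A; by uniqueness they agree
  on Borel sets, so the union over them collapses to the integral against \<open>E\<close>.\<close>

lemma fun_calc_eq:
  assumes "nonneg_spectral E A"
  shows "fun_calc A f = spectral_integral E f"
proof -
  interpret nonneg_spectral E A by fact
  have eq: "spectral_integral F f = spectral_integral E f" if "spectral_measure_of A F" for F
  proof -
    have "nonneg_spectral F A"
      using that A_nonneg by unfold_locales (auto simp: spectral_measure_of_def)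
    from spectral_measure_unique[OF this assms] show ?thesis
      by (intro spectral_integral_cong)
  qed
  have sm: "spectral_measure_of A E"
    using pvm A_eq by (simp add: spectral_measure_of_def)
  have "(x, y) \<in> fun_calc A f \<longleftrightarrow> (x, y) \<in> spectral_integral E f" for x y
  proof -
    have "(\<exists>F. spectral_measure_of A F \<and> (x, y) \<in> spectral_integral F f) \<longleftrightarrow> (x, y) \<in> spectral_integral E f"
      using eq sm by metis
    then show ?thesis unfolding fun_calc_def by simp
  qed
  then show ?thesis by auto
qed

section \<open>Sobolev spaces and solutions\<close>

text \<open>X is complete, so an element of the completion \<open>H\<^sup>0\<close>, a class of
  Cauchy sequences, is the set of all sequences with a given limit. These sets replace the abstract
  classes below.\<close>

definition limit_class :: "'x::real_normed_vector \<Rightarrow> (nat \<Rightarrow> 'x) set" where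
  "limit_class x = {u. u \<longlonglongrightarrow> x}"

context nonneg_spectral begin

lemma Domain_fun_calc: "f \<in> borel_measurable borel \<Longrightarrow> Domain (fun_calc A f) = domf f"
  by (auto simp: fun_calc_eq[OF nonneg_spectral_axioms] spectral_integral_eq)

lemma op_app_fun_calc:
  assumes "f \<in> borel_measurable borel" "x \<in> domf f"
  shows "op_app (fun_calc A f) x = spec f x"
  unfolding op_app_def using assms
  by (intro the_equality) (auto simp: fun_calc_eq[OF nonneg_spectral_axioms] spectral_integral_eq)

lemma sqrt_dom_eq: "sqrt_dom A = domf sqrt"
  unfolding sqrt_dom_def by (rule Domain_fun_calc) simp

lemma sqrt_op_eq: "x \<in> domf sqrt \<Longrightarrow> sqrt_op A x = spec sqrt x"
  unfolding sqrt_op_def by (rule op_app_fun_calc) simp_all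

lemma proj_ge_eq: "proj_ge A \<kappa> x = E {\<kappa>\<^sup>2..} x"
  unfolding proj_ge_def
  by (subst op_app_fun_calc) (auto intro: in_domf_bounded[of _ 1])

lemma sob_dom_eq: "sob_dom A s = domf (\<lambda>l. (1 + l) powr (s / 2))"
  unfolding sob_dom_def by (rule Domain_fun_calc) simp

lemma sob_norm_eq: "x \<in> sob_dom A s \<Longrightarrow> sob_norm A s x = norm (spec (\<lambda>l. (1 + l) powr (s / 2)) x)"
  unfolding sob_norm_def sob_dom_eq by (subst op_app_fun_calc) simp_all

lemma powr_half_power2: "((x::real) powr (s / 2))\<^sup>2 = x powr s"
  by (simp add: power2_eq_square flip: powr_add)

lemma nn_integral_domf:
  assumes "f \<in> borel_measurable borel" "x \<in> domf f"
  shows "(\<integral>\<^sup>+ l. ennreal ((f l)\<^sup>2) \<partial>mu x) = ennreal ((norm (spec f x))\<^sup>2)"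
  using assms by (subst nn_integral_eq_integral) (auto simp: spec_norm spectral_dom_def)

lemma sob_norm_sq:
  assumes "x \<in> sob_dom A s"
  shows "ennreal ((sob_norm A s x)\<^sup>2) = (\<integral>\<^sup>+ l. ennreal ((1 + l) powr s) \<partial>mu x)"
  using nn_integral_domf[of "\<lambda>l. (1 + l) powr (s / 2)" x] assms
  by (simp add: sob_norm_eq powr_half_power2 sob_dom_eq)

lemma E_in_domf:
  assumes f: "f \<in> borel_measurable borel" "x \<in> domf f" and S: "S \<in> sets borel"
  shows "E S x \<in> domf f" and "spec f (E S x) = E S (spec f x)"
proof -
  have i: "indicator S \<in> borel_measurable borel" "x \<in> domf (indicator S)"
    using S by (auto intro: in_domf_bounded[of _ 1])
  have d: "x \<in> domf (\<lambda>l. f l * indicator S l)"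
    using domf_indicator[OF f S] by (simp add: mult.commute)
  show "E S x \<in> domf f"
    using in_domf_spec_iff[OF i f(1)] d S by simp
  show "spec f (E S x) = E S (spec f x)"
    using spec_spec[OF i f(1) d] S by (simp add: E_spec[OF f S] mult.commute)
qed

lemma nn_integral_mu_E:
  assumes "S \<in> sets borel" "u \<in> borel_measurable borel"
  shows "nn_integral (mu (E S x)) u = (\<integral>\<^sup>+ l. indicator S l * u l \<partial>mu x)"
proof -
  have "nn_integral (mu (spec (indicator S) x)) u = (\<integral>\<^sup>+ l. ennreal ((indicator S l)\<^sup>2) * u l \<partial>mu x)"
    using assms by (intro nn_integral_mu_spec) (auto intro: in_domf_bounded[of _ 1])
  also have "\<dots> = (\<integral>\<^sup>+ l. indicator S l * u l \<partial>mu x)"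
    by (intro nn_integral_cong) (auto simp: indicator_def)
  finally show ?thesis using assms by simp
qed

definition energy :: "'x \<times> 'x \<Rightarrow> (real \<Rightarrow> ennreal) \<Rightarrow> ennreal" where
  "energy z u = nn_integral (mu (spec sqrt (fst z))) u + nn_integral (mu (snd z)) u"

lemma phase_space_iff:
  "(q, p) \<in> phase_space A s \<longleftrightarrow> q \<in> domf sqrt \<and> spec sqrt q \<in> sob_dom A (s - 1) \<and> p \<in> sob_dom A (s - 1)"
  unfolding phase_space_def by (auto simp: sqrt_dom_eq sqrt_op_eq)

lemma phase_norm_sq:
  assumes "z \<in> phase_space A s"
  shows "ennreal ((phase_norm A s z)\<^sup>2) = energy z (\<lambda>l. ennreal ((1 + l) powr (s - 1)))"
proof -
  obtain q p where z: "z = (q, p)" by force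
  with assms show ?thesis
    by (simp add: phase_space_iff phase_norm_def energy_def sqrt_op_eq flip: sob_norm_sq)
qed

lemma phase_space_proj:
  assumes "(q, p) \<in> phase_space A s"
  shows "(proj_ge A \<kappa> q, proj_ge A \<kappa> p) \<in> phase_space A s"
  using assms E_in_domf by (simp add: phase_space_iff proj_ge_eq sob_dom_eq)

lemma phase_norm_proj_sq:
  assumes "(q, p) \<in> phase_space A s"
  shows "ennreal ((phase_norm A s (proj_ge A \<kappa> q, proj_ge A \<kappa> p))\<^sup>2)
    = energy (q, p) (\<lambda>l. indicator {\<kappa>\<^sup>2..} l * ennreal ((1 + l) powr (s - 1)))"
  unfolding phase_norm_sq[OF phase_space_proj[OF assms]] energy_def
  using assms by (simp add: phase_space_iff proj_ge_eq E_in_domf nn_integral_mu_E)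

text \<open>\<open>(1 + l) powr 0\<close> is \<open>0\<close> at \<open>l = -1\<close>, but this point is null for every spectral measure of \<open>A\<close>.\<close>

lemma sob_dom_0 [simp]: "sob_dom A 0 = UNIV"
  unfolding sob_dom_eq by (auto intro!: in_domf_bounded[of _ 1])

lemma sob_norm_0 [simp]: "sob_norm A 0 x = norm x"
proof -
  have "spec (\<lambda>l. (1 + l) powr (0 / 2)) x = spec (\<lambda>_. 1) x"
  proof (rule spec_eq_AE)
    show "AE l in mu x. (1 + l) powr (0 / 2) = 1"
      using AE_mu_nonneg by (rule eventually_mono) auto
  qed (auto intro!: in_domf_bounded[of _ 1])
  then show ?thesis by (simp only: sob_norm_eq sob_dom_0 UNIV_I spec_const)
qed

lemma sob_rel_0: "(u, v) \<in> sob_rel A 0 \<longleftrightarrow> (\<exists>l. u \<longlonglongrightarrow> l \<and> v \<longlonglongrightarrow> l)"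
proof -
  have c: "w \<in> sob_cauchy A 0 \<longleftrightarrow> convergent w" for w
    by (simp add: sob_cauchy_def Cauchy_convergent_iff[symmetric] Cauchy_iff)
  have "(\<lambda>n. norm (u n - v n)) \<longlonglongrightarrow> 0 \<longleftrightarrow> k = l" if "u \<longlonglongrightarrow> k" "v \<longlonglongrightarrow> l" for k l
  proof -
    have "(\<lambda>n. norm (u n - v n)) \<longlonglongrightarrow> norm (k - l)"
      by (intro tendsto_intros that)
    then show ?thesis using LIMSEQ_unique by fastforce
  qed
  then show ?thesis
    unfolding sob_rel_def by (auto simp: c convergent_def)
qed

lemma sob_embed_0: "sob_embed A 0 x = limit_class x"
  unfolding sob_embed_def limit_class_def
  by (auto simp: sob_rel_0 LIMSEQ_const_iff)

lemma sob_scale_0: "sob_scale A 0 r (limit_class x) = limit_class (r *\<^sub>R x)"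
proof -
  have "w \<longlonglongrightarrow> r *\<^sub>R x" if "u \<longlonglongrightarrow> x" "(\<lambda>n. r *\<^sub>R u n) \<longlonglongrightarrow> l" "w \<longlonglongrightarrow> l" for u w l
    using LIMSEQ_unique[OF that(2) tendsto_scaleR[OF tendsto_const that(1)]] that(3) by simp
  then have "sob_scale A 0 r (limit_class x) \<subseteq> limit_class (r *\<^sub>R x)"
    unfolding sob_scale_def limit_class_def by (auto simp: sob_rel_0)
  moreover have "w \<in> sob_scale A 0 r (limit_class x)" if w: "w \<longlonglongrightarrow> r *\<^sub>R x" for w
  proof -
    have "((\<lambda>n. r *\<^sub>R x), w) \<in> sob_rel A 0" using w by (auto simp: sob_rel_0)
    moreover have "(\<lambda>n. r *\<^sub>R x) \<in> (\<lambda>u n. r *\<^sub>R u n) ` limit_class x"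
      by (rule image_eqI[of _ _ "\<lambda>_. x"]) (auto simp: limit_class_def)
    ultimately show ?thesis unfolding sob_scale_def by blast
  qed
  ultimately show ?thesis by (auto simp: limit_class_def)
qed

lemma sob_dist_0: "sob_dist A 0 (limit_class x) (limit_class y) = norm (x - y)"
  unfolding sob_dist_def limit_class_def sob_norm_0
proof (rule the_equality)
  show "\<exists>u\<in>{u. u \<longlonglongrightarrow> x}. \<exists>v\<in>{u. u \<longlonglongrightarrow> y}. (\<lambda>n. norm (u n - v n)) \<longlonglongrightarrow> norm (x - y)"
    by (intro bexI[of _ "\<lambda>_. x"] bexI[of _ "\<lambda>_. y"]) auto
  fix d assume "\<exists>u\<in>{u. u \<longlonglongrightarrow> x}. \<exists>v\<in>{u. u \<longlonglongrightarrow> y}. (\<lambda>n. norm (u n - v n)) \<longlonglongrightarrow> d"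
  then obtain u v where "u \<longlonglongrightarrow> x" "v \<longlonglongrightarrow> y" "(\<lambda>n. norm (u n - v n)) \<longlonglongrightarrow> d" by auto
  then show "d = norm (x - y)"
    using LIMSEQ_unique[OF _ tendsto_norm[OF tendsto_diff]] by blast
qed

lemma domf_mono_AE:
  assumes "f \<in> borel_measurable borel" "g \<in> borel_measurable borel" "x \<in> domf g" "AE l in mu x. \<bar>f l\<bar> \<le> \<bar>g l\<bar>"
  shows "x \<in> domf f"
proof -
  have "(\<integral>\<^sup>+ l. ennreal ((f l)\<^sup>2) \<partial>mu x) \<le> (\<integral>\<^sup>+ l. ennreal ((g l)\<^sup>2) \<partial>mu x)"
    by (rule nn_integral_mono_AE)
      (use assms(4) in \<open>rule eventually_mono, auto intro!: ennreal_leI simp: abs_le_square_iff\<close>)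
  then show ?thesis using assms(1-3) by (auto simp: in_domf_iff)
qed

lemma domf_id_sqrt: "x \<in> domf (\<lambda>l. l) \<Longrightarrow> x \<in> domf sqrt"
proof -
  assume x: "x \<in> domf (\<lambda>l. l)"
  show ?thesis
  proof (rule domf_mono_AE)
    show "x \<in> domf (\<lambda>l. 1 + l)"
      using x by (intro domf_fun_add in_domf_bounded[of "\<lambda>_. 1" 1]) auto
    have "sqrt l \<le> 1 + l" if "0 \<le> l" for l
    proof (rule real_le_lsqrt)
      show "l \<le> (1 + l)\<^sup>2" using that by (simp add: power2_sum)
    qed (use that in auto)
    note * = this
      show "AE l in mu x. \<bar>sqrt l\<bar> \<le> \<bar>1 + l\<bar>"
      by (rule eventually_mono[OF AE_mu_nonneg]) (use * in \<open>auto simp: abs_mult\<close>)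
  qed auto
qed

text \<open>On l \<ge> 0 the symbol sqrt (1 + l) sqrt l lies between l and 1 + l. Hence at level s =
  2 the first component of a phase point lies in the domain of A.\<close>

lemma sqrt_sob_dom_1:
  assumes "x \<in> domf sqrt"
  shows "spec sqrt x \<in> sob_dom A 1 \<longleftrightarrow> x \<in> domf (\<lambda>l. l)"
proof -
  have "spec sqrt x \<in> sob_dom A 1 \<longleftrightarrow> x \<in> domf (\<lambda>l. (1 + l) powr (1 / 2) * sqrt l)"
    unfolding sob_dom_eq using assms by (intro in_domf_spec_iff) auto
  also have "\<dots> \<longleftrightarrow> x \<in> domf (\<lambda>l. l)"
  proof
    assume "x \<in> domf (\<lambda>l. (1 + l) powr (1 / 2) * sqrt l)"
    then show "x \<in> domf (\<lambda>l. l)"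
    proof (rule domf_mono_AE[rotated 2])
      have "l \<le> (1 + l) powr (1 / 2) * sqrt l" if "0 \<le> l" for l :: real
      proof -
        have "l = sqrt l * sqrt l" using that by simp
        also have "\<dots> \<le> sqrt (1 + l) * sqrt l" using that by (intro mult_right_mono) auto
        finally show ?thesis using that by (simp add: powr_half_sqrt)
      qed
      note * = this
      show "AE l in mu x. \<bar>l\<bar> \<le> \<bar>(1 + l) powr (1 / 2) * sqrt l\<bar>"
        by (rule eventually_mono[OF AE_mu_nonneg]) (use * in \<open>auto simp: abs_mult\<close>)
    qed auto
  next
    assume x: "x \<in> domf (\<lambda>l. l)"
    show "x \<in> domf (\<lambda>l. (1 + l) powr (1 / 2) * sqrt l)"
    proof (rule domf_mono_AE)
      show "x \<in> domf (\<lambda>l. 1 + l)"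
        using x by (intro domf_fun_add in_domf_bounded[of "\<lambda>_. 1" 1]) auto
      have "(1 + l) powr (1 / 2) * sqrt l \<le> 1 + l" if "0 \<le> l" for l :: real
      proof -
        have "sqrt (1 + l) * sqrt l \<le> sqrt (1 + l) * sqrt (1 + l)" using that by (intro mult_left_mono) auto
        then show ?thesis using that by (simp add: powr_half_sqrt)
      qed
      note * = this
      show "AE l in mu x. \<bar>(1 + l) powr (1 / 2) * sqrt l\<bar> \<le> \<bar>1 + l\<bar>"
        by (rule eventually_mono[OF AE_mu_nonneg]) (use * in \<open>auto simp: abs_mult\<close>)
    qed auto
  qed
  finally show ?thesis .
qed

text \<open>From l^2 \<le> l (1 + l). Convergence of the square roots at exponent 1, as in
  \<open>sob_A\<close>, thus forces convergence of A x in X.\<close>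

lemma norm_A_le_sob_norm:
  assumes "x \<in> domf (\<lambda>l. l)"
  shows "norm (spec (\<lambda>l. l) x) \<le> sob_norm A 1 (spec sqrt x)"
proof -
  have s: "x \<in> domf sqrt" by (rule domf_id_sqrt[OF assms])
  have d: "spec sqrt x \<in> sob_dom A 1" using sqrt_sob_dom_1[OF s] assms by simp
  have "ennreal ((norm (spec (\<lambda>l. l) x))\<^sup>2) = (\<integral>\<^sup>+ l. ennreal (l\<^sup>2) \<partial>mu x)"
    using assms by (simp add: nn_integral_domf)
  also have "\<dots> \<le> (\<integral>\<^sup>+ l. ennreal ((sqrt l)\<^sup>2) * ennreal ((1 + l) powr 1) \<partial>mu x)"
  proof (rule nn_integral_mono_AE, use AE_mu_nonneg in \<open>rule eventually_mono\<close>)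
    fix l :: real assume "0 \<le> l"
    then show "ennreal (l\<^sup>2) \<le> ennreal ((sqrt l)\<^sup>2) * ennreal ((1 + l) powr 1)"
      by (simp add: power2_eq_square distrib_left flip: ennreal_mult)
  qed
  also have "\<dots> = (\<integral>\<^sup>+ l. ennreal ((1 + l) powr 1) \<partial>mu (spec sqrt x))"
    using s by (intro nn_integral_mu_spec[symmetric]) auto
  also have "\<dots> = ennreal ((sob_norm A 1 (spec sqrt x))\<^sup>2)"
    by (rule sob_norm_sq[OF d, symmetric])
  finally have "(norm (spec (\<lambda>l. l) x))\<^sup>2 \<le> (sob_norm A 1 (spec sqrt x))\<^sup>2" by simp
  then show ?thesis
    by (rule power2_le_imp_le) (simp add: sob_norm_def)
qed

text \<open>Every admissible sequence in the definition of \<open>sob_A\<close> converges to A q by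
  \<open>norm_A_le_sob_norm\<close>; conversely the constant sequence \<open>q\<close> is
  admissible.\<close>

lemma sob_A_2:
  assumes q: "q \<in> domf (\<lambda>l. l)"
  shows "sob_A A 2 q = limit_class (spec (\<lambda>l. l) q)"
proof -
  have qs: "q \<in> domf sqrt" by (rule domf_id_sqrt[OF q])
  have lim: "y \<longlonglongrightarrow> spec (\<lambda>l. l) q"
    if xy: "\<forall>n. (x n, y n) \<in> A \<and> sqrt_op A (x n) \<in> sob_dom A 1"
      and l: "(\<lambda>n. sob_norm A 1 (sqrt_op A (x n) - sqrt_op A q)) \<longlonglongrightarrow> 0" for x y
  proof -
    have x: "x n \<in> domf (\<lambda>l. l)" and y: "y n = spec (\<lambda>l. l) (x n)" for n
      using xy by (auto simp: A_iff)
    have "norm (y n - spec (\<lambda>l. l) q) \<le> sob_norm A 1 (sqrt_op A (x n) - sqrt_op A q)" for n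
      using norm_A_le_sob_norm[OF domf_diff[OF _ x q], of n] x q qs
      by (simp add: y spec_diff sqrt_op_eq domf_id_sqrt)
    then have "(\<lambda>n. y n - spec (\<lambda>l. l) q) \<longlonglongrightarrow> 0"
      by (intro Lim_null_comparison[OF _ l] always_eventually) simp
    then show ?thesis by (simp add: LIM_zero_iff)
  qed
  have "u \<in> sob_A A 2 q \<longleftrightarrow> u \<longlonglongrightarrow> spec (\<lambda>l. l) q" for u
  proof
    assume "u \<in> sob_A A 2 q"
    then obtain x y where xy: "\<forall>n. (x n, y n) \<in> A \<and> sqrt_op A (x n) \<in> sob_dom A 1"
      and l: "(\<lambda>n. sob_norm A 1 (sqrt_op A (x n) - sqrt_op A q)) \<longlonglongrightarrow> 0" and u: "(y, u) \<in> sob_rel A 0"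
      by (auto simp: sob_A_def)
    from u obtain k where "y \<longlonglongrightarrow> k" "u \<longlonglongrightarrow> k" by (auto simp: sob_rel_0)
    with lim[OF xy l] show "u \<longlonglongrightarrow> spec (\<lambda>l. l) q" using LIMSEQ_unique by blast
  next
    assume u: "u \<longlonglongrightarrow> spec (\<lambda>l. l) q"
    have z: "(0::'x) \<in> sob_dom A 1" unfolding sob_dom_eq
      using domf_scaleR[of "\<lambda>l. (1 + l) powr (1 / 2)" "spec sqrt q" 0] sqrt_sob_dom_1[OF qs] q by (simp add: sob_dom_eq)
    have "sob_norm A 1 (0::'x) = 0"
      using spec_scaleR[of "\<lambda>l. (1 + l) powr (1 / 2)" 0 0] z by (simp add: sob_norm_eq sob_dom_eq)
    moreover have "((\<lambda>_. spec (\<lambda>l. l) q), u) \<in> sob_rel A 0" using u by (auto simp: sob_rel_0)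
    ultimately have "(\<forall>n::nat. (q, spec (\<lambda>l. l) q) \<in> A \<and> sqrt_op A q \<in> sob_dom A (2 - 1)) \<and>
     (\<lambda>n. sob_norm A (2 - 1) (sqrt_op A q - sqrt_op A q)) \<longlonglongrightarrow> 0 \<and>
     ((\<lambda>_. spec (\<lambda>l. l) q), u) \<in> sob_rel A (2 - 2)"
      using q sqrt_sob_dom_1[OF qs] qs by (simp add: A_iff sqrt_op_eq)
    then show "u \<in> sob_A A 2 q"
      unfolding sob_A_def by (intro CollectI exI[of _ "\<lambda>_. q"] exI[of _ "\<lambda>_. spec (\<lambda>l. l) q"])
  qed
  then show ?thesis by (auto simp: limit_class_def)
qed

lemma sob_continuous_on_0:
  assumes "sob_continuous_on A 0 UNIV (\<lambda>t. limit_class (f t))"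
  shows "continuous_on UNIV f"
  unfolding continuous_on_def
proof
  fix t
  have "((\<lambda>r. norm (f r - f t)) \<longlongrightarrow> 0) (at t)"
    using assms by (simp add: sob_continuous_on_def sob_dist_0)
  then show "(f \<longlongrightarrow> f t) (at t within UNIV)"
    by (simp add: tendsto_norm_zero_iff LIM_zero_iff)
qed

lemma A_form_eq: "q \<in> domf sqrt \<Longrightarrow> A_form A q = (norm (spec sqrt q))\<^sup>2"
  unfolding A_form_def by (simp add: sqrt_op_eq)

text \<open>Level s = 1 gives q' = p, the sign condition and continuity of <q, A q>; level s = 2
  gives the second equation, because its right side lives in exponent s - 2 = 0 and is a vector of
  X.\<close>

lemma solution_infD:
  assumes sol: "solution_inf A \<sigma> UNIV q p" and sg: "\<sigma> = 1 \<or> \<sigma> = -1"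
  shows "q t \<in> domf (\<lambda>l. l)"
    and "0 < 1 + \<sigma> * A_form A (q t)"
    and "(q has_vector_derivative p t) (at t)"
    and "(p has_vector_derivative (- (speed A \<sigma> (q t))\<^sup>2) *\<^sub>R spec (\<lambda>l. l) (q t)) (at t)"
    and "continuous_on UNIV (\<lambda>t. spec (\<lambda>l. l) (q t))"
    and "s \<ge> 1 \<Longrightarrow> (q t, p t) \<in> phase_space A s"
proof -
  have s1: "solution A \<sigma> 1 UNIV q p" and s2: "solution A \<sigma> 2 UNIV q p"
    using sol by (auto simp: solution_inf_def)
  show "s \<ge> 1 \<Longrightarrow> (q t, p t) \<in> phase_space A s" for t
    using sol by (auto simp: solution_inf_def solution_def)
  have "(q t, p t) \<in> phase_space A 2" for t using s2 by (simp add: solution_def)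
  then have "q t \<in> domf sqrt \<and> spec sqrt (q t) \<in> sob_dom A 1" for t
    by (simp add: phase_space_iff)
  then have dom: "q t \<in> domf (\<lambda>l. l)" for t
    using sqrt_sob_dom_1 by blast
  then show "q t \<in> domf (\<lambda>l. l)" .
  have doms: "q t \<in> domf sqrt" for t by (rule domf_id_sqrt[OF dom])
  show pos: "0 < 1 + \<sigma> * A_form A (q t)" for t
    using sg s1 by (auto simp: solution_def A_form_def add_pos_nonneg)
  show "(q has_vector_derivative p t) (at t)" using s1 by (simp add: solution_def)
  let ?F = "\<lambda>t. (- (speed A \<sigma> (q t))\<^sup>2) *\<^sub>R spec (\<lambda>l. l) (q t)"
  have A2: "sob_scale A 0 (- (speed A \<sigma> (q t))\<^sup>2) (sob_A A 2 (q t)) = limit_class (?F t)" for t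
    by (simp only: sob_A_2[OF dom] sob_scale_0)
  have "\<forall>t. ((\<lambda>h. sob_dist A 0 (sob_embed A 0 ((1 / h) *\<^sub>R (p (t + h) - p t)))
         (sob_scale A 0 (- (speed A \<sigma> (q t))\<^sup>2) (sob_A A 2 (q t)))) \<longlongrightarrow> 0) (at 0)"
    using s2 unfolding solution_def by simp
  then have "((\<lambda>h. norm ((1 / h) *\<^sub>R (p (t + h) - p t) - ?F t)) \<longlongrightarrow> 0) (at 0)"
    unfolding A2 sob_embed_0 sob_dist_0 by blast
  moreover have "\<forall>\<^sub>F h in at 0. norm ((1 / h) *\<^sub>R (p (t + h) - p t) - ?F t) = norm (p (t + h) - p t - h *\<^sub>R ?F t) / norm h"
  proof (rule eventually_at_filter[THEN iffD2, OF always_eventually], intro allI impI)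
    fix h :: real assume "h \<noteq> 0"
    then have "(1 / h) *\<^sub>R (p (t + h) - p t) - ?F t = (1 / h) *\<^sub>R (p (t + h) - p t - h *\<^sub>R ?F t)"
      by (simp add: scaleR_diff_right scaleR_add_right)
    then show "norm ((1 / h) *\<^sub>R (p (t + h) - p t) - ?F t) = norm (p (t + h) - p t - h *\<^sub>R ?F t) / norm h"
      by (simp only: norm_scaleR) simp
  qed
  ultimately have "((\<lambda>h. norm (p (t + h) - p t - h *\<^sub>R ?F t) / norm h) \<longlongrightarrow> 0) (at 0)"
    by (rule Lim_transform_eventually)
  moreover have "bounded_linear (\<lambda>h. h *\<^sub>R ?F t)" by (rule bounded_linear_scaleR_left)
  ultimately show "(p has_vector_derivative ?F t) (at t)"
    unfolding has_vector_derivative_def has_derivative_at by blast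
  have "sob_continuous_on A 0 UNIV (\<lambda>t. limit_class (sqrt_op A (q t)))"
    using s1 by (simp add: solution_def sob_embed_0)
  then have "continuous_on UNIV (\<lambda>t. sqrt_op A (q t))" by (rule sob_continuous_on_0)
  then have c1: "continuous_on UNIV (\<lambda>t. A_form A (q t))"
    unfolding A_form_def by (intro continuous_intros)
  have "sob_continuous_on A 0 UNIV (\<lambda>t. limit_class (?F t))"
    using s2 unfolding solution_def A2[symmetric] by simp
  then have c2: "continuous_on UNIV ?F" by (rule sob_continuous_on_0)
  \<comment> \<open>Continuity is known for -c^2 A q; multiplying by the continuous factor -a^2
    recovers A q.\<close>
  have "continuous_on UNIV (\<lambda>t. (- (1 + \<sigma> * A_form A (q t))\<^sup>2) *\<^sub>R ?F t)"
    by (rule continuous_on_scaleR[OF _ c2]) (intro continuous_intros c1)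
  moreover have "(- (1 + \<sigma> * A_form A (q t))\<^sup>2) *\<^sub>R ?F t = spec (\<lambda>l. l) (q t)" for t
    using pos[of t] by (simp add: speed_def power_divide)
  ultimately show "continuous_on UNIV (\<lambda>t. spec (\<lambda>l. l) (q t))" by simp
qed

end

section \<open>Conserved quantities\<close>

text \<open>The two-sided bound on the derivative serves both directions of time: one exponential
  factor makes the product decrease forward, the opposite one makes it increase towards 0 from the
  past.\<close>

lemma gronwall_abs:
  fixes f f' :: "real \<Rightarrow> real"
  assumes der: "\<And>x. \<bar>x\<bar> \<le> T \<Longrightarrow> (f has_real_derivative f' x) (at x)"
    and bound: "\<And>x. \<bar>x\<bar> \<le> T \<Longrightarrow> \<bar>f' x\<bar> \<le> M * f x"
    and t: "\<bar>t\<bar> \<le> T"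
  shows "f t \<le> exp (M * \<bar>t\<bar>) * f 0"
proof (cases "0 \<le> t")
  case True
  have "f t * exp (- M * t) \<le> f 0 * exp (- M * 0)"
  proof (rule DERIV_nonpos_imp_nonincreasing[OF True])
    fix x assume x: "0 \<le> x" "x \<le> t"
    then have xT: "\<bar>x\<bar> \<le> T" using t by simp
    have "((\<lambda>x. f x * exp (- M * x)) has_real_derivative (f' x - M * f x) * exp (- M * x)) (at x)"
      by (auto intro!: derivative_eq_intros der[OF xT] simp: algebra_simps)
    moreover have "(f' x - M * f x) * exp (- M * x) \<le> 0"
      using bound[OF xT] by (intro mult_nonpos_nonneg) auto
    ultimately show "\<exists>y. ((\<lambda>x. f x * exp (- M * x)) has_real_derivative y) (at x) \<and> y \<le> 0" by blast
  qed
  then have "f t * exp (- M * t) * exp (M * t) \<le> f 0 * exp (- M * 0) * exp (M * t)"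
    by (rule mult_right_mono) simp
  moreover have "f t * exp (- M * t) * exp (M * t) = f t"
    by (simp add: exp_minus)
  ultimately have "f t \<le> f 0 * exp (- M * 0) * exp (M * t)" by linarith
  then show ?thesis using True by (simp add: mult.commute)
next
  case False
  then have t0: "t \<le> 0" by simp
  have "f t * exp (M * t) \<le> f 0 * exp (M * 0)"
  proof (rule DERIV_nonneg_imp_nondecreasing[OF t0])
    fix x assume x: "t \<le> x" "x \<le> 0"
    then have xT: "\<bar>x\<bar> \<le> T" using t by simp
    have "((\<lambda>x. f x * exp (M * x)) has_real_derivative (f' x + M * f x) * exp (M * x)) (at x)"
      by (auto intro!: derivative_eq_intros der[OF xT] simp: algebra_simps)
    moreover have "0 \<le> (f' x + M * f x) * exp (M * x)"
      using bound[OF xT] by (intro mult_nonneg_nonneg) auto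
    ultimately show "\<exists>y. ((\<lambda>x. f x * exp (M * x)) has_real_derivative y) (at x) \<and> 0 \<le> y" by blast
  qed
  then have "f t * exp (M * t) * exp (- (M * t)) \<le> f 0 * exp (M * 0) * exp (- (M * t))"
    by (rule mult_right_mono) simp
  moreover have "f t * exp (M * t) * exp (- (M * t)) = f t"
    by (simp add: exp_minus)
  ultimately have "f t \<le> f 0 * exp (M * 0) * exp (- (M * t))" by linarith
  then show ?thesis using False by (simp add: mult.commute)
qed

lemma has_real_derivative_inner_operator:
  fixes f g :: "real \<Rightarrow> 'x::real_inner"
  assumes "bounded_linear G" "(f has_vector_derivative f') (at t)" "(g has_vector_derivative g') (at t)"
  shows "((\<lambda>t. f t \<bullet> G (g t)) has_real_derivative (f t \<bullet> G g' + f' \<bullet> G (g t))) (at t)"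
  using bounded_bilinear.has_vector_derivative[OF bounded_bilinear_inner assms(2) bounded_linear.has_vector_derivative[OF assms(1,3)]]
  by (simp add: has_real_derivative_iff_has_vector_derivative)

text \<open>For r = A q only continuity of \<open>r\<close> is known, so the product rule does not
  apply. Symmetry turns the increment of the form into
  \<open>(q (t + h) - q t) \<bullet> (r (t + h) + r t)\<close>, where only \<open>q\<close> has to
  be differentiated.\<close>

lemma has_real_derivative_quadratic_form:
  fixes q r :: "real \<Rightarrow> 'x::real_inner" and p :: 'x
  assumes q: "(q has_vector_derivative p) (at t)" and r: "continuous_on UNIV r"
    and sym: "\<And>s t. q s \<bullet> r t = r s \<bullet> q t"
  shows "((\<lambda>t. q t \<bullet> r t) has_real_derivative 2 * (p \<bullet> r t)) (at t)"
proof -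
  have "((\<lambda>h. norm (q (t + h) - q t - h *\<^sub>R p) / norm h) \<longlongrightarrow> 0) (at 0)"
    using q by (simp add: has_vector_derivative_def has_derivative_at)
  moreover have "\<forall>\<^sub>F h in at 0. norm (q (t + h) - q t - h *\<^sub>R p) / norm h = norm ((1 / h) *\<^sub>R (q (t + h) - q t) - p)"
  proof (rule eventually_at_filter[THEN iffD2, OF always_eventually], intro allI impI)
    fix h :: real assume "h \<noteq> 0"
    then have "(1 / h) *\<^sub>R (q (t + h) - q t) - p = (1 / h) *\<^sub>R (q (t + h) - q t - h *\<^sub>R p)"
      by (simp add: scaleR_diff_right)
    then show "norm (q (t + h) - q t - h *\<^sub>R p) / norm h = norm ((1 / h) *\<^sub>R (q (t + h) - q t) - p)"
      by (simp only: norm_scaleR) simp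
  qed
  ultimately have "((\<lambda>h. norm ((1 / h) *\<^sub>R (q (t + h) - q t) - p)) \<longlongrightarrow> 0) (at 0)"
    by (rule Lim_transform_eventually)
  then have l: "((\<lambda>h. (1 / h) *\<^sub>R (q (t + h) - q t)) \<longlongrightarrow> p) (at 0)"
    by (simp add: tendsto_norm_zero_iff LIM_zero_iff)
  have "(r \<longlongrightarrow> r t) (at t)" using r by (auto simp: continuous_on_def)
  then have rl: "((\<lambda>h. r (t + h)) \<longlongrightarrow> r t) (at 0)" by (simp add: LIM_offset_zero_iff)
  have "((\<lambda>h. (1 / h) *\<^sub>R (q (t + h) - q t) \<bullet> (r (t + h) + r t)) \<longlongrightarrow> p \<bullet> (r t + r t)) (at 0)"
    by (intro tendsto_intros l rl)
  moreover have "(1 / h) *\<^sub>R (q (t + h) - q t) \<bullet> (r (t + h) + r t) = (q (t + h) \<bullet> r (t + h) - q t \<bullet> r t) / h" for h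
  proof -
    have "(q (t + h) - q t) \<bullet> (r (t + h) + r t) = q (t + h) \<bullet> r (t + h) - q t \<bullet> r t"
      using sym[of "t + h" t] by (simp add: inner_simps inner_commute)
    then show ?thesis by simp
  qed
  ultimately show ?thesis by (simp add: DERIV_def inner_add_right)
qed

text \<open>Here \<open>r\<close> stands for A q and \<open>Q\<close> for <q, A q>. The unbounded
  operator enters only as the curve \<open>r\<close>, so the conservation laws reduce to calculus
  with bounded symmetric operators.\<close>

locale kirchhoff_flow =
  fixes q p r :: "real \<Rightarrow> 'x::real_inner" and Q :: "real \<Rightarrow> real" and \<sigma> :: real
  assumes q_deriv: "(q has_vector_derivative p t) (at t)"
    and p_deriv: "(p has_vector_derivative (- (1 / (1 + \<sigma> * Q t))\<^sup>2) *\<^sub>R r t) (at t)"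
    and Q_deriv: "(Q has_real_derivative 2 * (p t \<bullet> r t)) (at t)"
    and Q_eq: "Q t = q t \<bullet> r t"
    and Q_pos: "0 < 1 + \<sigma> * Q t"
begin

abbreviation a :: "real \<Rightarrow> real" where "a t \<equiv> 1 + \<sigma> * Q t"
definition c :: "real \<Rightarrow> real" where "c t = 1 / a t"

lemma ac: "a t * c t = 1"
  using Q_pos[of t] by (simp add: c_def)

lemma c_pos: "0 < c t" using Q_pos[of t] by (simp add: c_def)

lemma p_deriv': "(p has_vector_derivative (- (c t)\<^sup>2) *\<^sub>R r t) (at t)"
  using p_deriv by (simp add: c_def)

lemma a_deriv: "(a has_real_derivative 2 * \<sigma> * (p t \<bullet> r t)) (at t)"
  by (auto intro!: derivative_eq_intros Q_deriv)

lemma c_deriv: "(c has_real_derivative - 2 * \<sigma> * (p t \<bullet> r t) * (c t)\<^sup>2) (at t)"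
  unfolding c_def using Q_pos[of t]
  by (auto intro!: derivative_eq_intros Q_deriv simp: power2_eq_square)

lemma energy_conserved: "p t \<bullet> p t + Q t * c t = p 0 \<bullet> p 0 + Q 0 * c 0"
proof -
  have "((\<lambda>t. p t \<bullet> p t + Q t * c t) has_real_derivative 0) (at t)" for t
  proof -
    have "((\<lambda>t. p t \<bullet> p t) has_real_derivative - 2 * (c t)\<^sup>2 * (p t \<bullet> r t)) (at t)"
      by (rule DERIV_cong[OF has_real_derivative_inner_operator[OF bounded_linear_ident p_deriv' p_deriv']])
        (simp add: inner_commute)
    \<comment> \<open>The three terms of the derivative share the factor 2 <p, A q> c; the remaining
      bracket is 1 - c - \<sigma> Q c = 1 - a c.\<close>
    from DERIV_add[OF this DERIV_mult[OF Q_deriv c_deriv]]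
    have "((\<lambda>t. p t \<bullet> p t + Q t * c t) has_real_derivative
        2 * (p t \<bullet> r t) * c t * (1 - a t * c t)) (at t)"
      by (rule DERIV_cong) (simp add: power2_eq_square algebra_simps)
    then show ?thesis by (simp add: ac)
  qed
  then show ?thesis
    using DERIV_isconst_all[of "\<lambda>t. p t \<bullet> p t + Q t * c t" t 0] by simp
qed

text \<open>The assumption on \<open>G (r t)\<close> is the one algebraic fact used about \<open>G = A (A + k)\<^sup>-\<^sup>1\<close>; it closes the system of
  equations for \<open>u\<close>, \<open>v\<close>, \<open>y\<close>.\<close>

lemma invariant_conserved:
  assumes G: "bounded_linear G" "\<And>x y. G x \<bullet> y = x \<bullet> G y"
    and Gr: "\<And>t. G (r t) = r t - k *\<^sub>R G (q t)"
  defines "u \<equiv> \<lambda>t. Q t - k * (q t \<bullet> G (q t))" and "v \<equiv> \<lambda>t. p t \<bullet> G (p t)" and "y \<equiv> \<lambda>t. p t \<bullet> G (q t)"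
  defines "J \<equiv> \<lambda>t. c t * u t + a t * v t - \<sigma> * (u t * v t + k * (y t)\<^sup>2)"
  shows "J t = J 0"
proof -
  have "(J has_real_derivative 0) (at t)" for t
  proof -
    let ?g = "p t \<bullet> r t"
    \<comment> \<open>Moving \<open>G\<close> to \<open>r\<close> makes <p, A q> appear in the
      derivatives of u and v only through \<open>?g - k * y t\<close>.\<close>
    have rGp: "r t \<bullet> G (p t) = ?g - k * y t"
      unfolding G(2)[of "r t" "p t", symmetric] Gr by (simp add: y_def inner_diff_left inner_diff_right inner_commute)
    have rGq: "r t \<bullet> G (q t) = u t"
      unfolding G(2)[of "r t" "q t", symmetric] Gr by (simp add: u_def Q_eq inner_diff_left inner_diff_right inner_commute)
    have xd: "((\<lambda>t. q t \<bullet> G (q t)) has_real_derivative 2 * y t) (at t)"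
      using has_real_derivative_inner_operator[OF G(1) q_deriv q_deriv, of t] G(2)[of "q t" "p t"]
      by (simp add: y_def inner_commute)
    have ud: "(u has_real_derivative 2 * (?g - k * y t)) (at t)"
      unfolding u_def by (rule DERIV_cong[OF DERIV_diff[OF Q_deriv DERIV_cmult[OF xd]]]) (simp add: algebra_simps)
    have vd: "(v has_real_derivative - 2 * (c t)\<^sup>2 * (?g - k * y t)) (at t)"
    proof -
      have "G ((- (c t)\<^sup>2) *\<^sub>R r t) = (- (c t)\<^sup>2) *\<^sub>R G (r t)"
        by (rule linear_cmul[OF bounded_linear.linear[OF G(1)]])
      then show ?thesis unfolding v_def
        using rGp G(2)[of "r t" "p t"]
        by (intro DERIV_cong[OF has_real_derivative_inner_operator[OF G(1) p_deriv' p_deriv']])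
          (simp add: inner_commute)
    qed
    have yd: "(y has_real_derivative v t - (c t)\<^sup>2 * u t) (at t)"
      using has_real_derivative_inner_operator[OF G(1) p_deriv' q_deriv, of t] rGq
      by (simp add: y_def v_def)
    \<comment> \<open>The contributions of a' and c', proportional to v and u, cancel against the
      derivative of the bracket with factor \<sigma>. What survives is a multiple of 1 - a
      c.\<close>
    have "(J has_real_derivative
       2 * (?g - k * y t) * c t * (1 - a t * c t)) (at t)"
      unfolding J_def
      by (rule DERIV_cong[OF DERIV_diff[OF DERIV_add[OF DERIV_mult[OF c_deriv ud] DERIV_mult[OF a_deriv vd]]
          DERIV_cmult[OF DERIV_add[OF DERIV_mult[OF ud vd] DERIV_cmult[OF DERIV_power[OF yd]]]]]])
        (simp add: power2_eq_square algebra_simps)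
    then show ?thesis by (simp add: ac)
  qed
  then show ?thesis using DERIV_isconst_all by blast
qed

text \<open>The factors a and c are chosen so that the terms with <p, L q> cancel by a c = 1. Only
  the derivatives of a and c remain, and \<open>M\<close> bounds \<bar>a'\<bar> / a. The intended
  operators are F = f(A) and L = A f(A).\<close>

lemma weighted_energy_growth:
  assumes F: "bounded_linear F" "\<And>x y. F x \<bullet> y = x \<bullet> F y" "\<And>x. 0 \<le> x \<bullet> F x"
    and L: "bounded_linear L" "\<And>x y. L x \<bullet> y = x \<bullet> L y" "\<And>x. 0 \<le> x \<bullet> L x"
    and FL: "\<And>t. F (r t) = L (q t)"
    and M: "\<And>t. \<bar>t\<bar> \<le> T \<Longrightarrow> 2 * \<bar>\<sigma>\<bar> * \<bar>p t \<bullet> r t\<bar> * c t \<le> M" and t: "\<bar>t\<bar> \<le> T"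
  defines "W \<equiv> \<lambda>t. a t * (p t \<bullet> F (p t)) + c t * (q t \<bullet> L (q t))"
  shows "W t \<le> exp (M * \<bar>t\<bar>) * W 0"
proof (rule gronwall_abs[OF _ _ t])
  fix t
  let ?g = "p t \<bullet> r t"
  let ?d = "2 * \<sigma> * ?g * (p t \<bullet> F (p t) - (c t)\<^sup>2 * (q t \<bullet> L (q t)))"
  have fd: "((\<lambda>t. p t \<bullet> F (p t)) has_real_derivative - 2 * (c t)\<^sup>2 * (p t \<bullet> L (q t))) (at t)"
  proof -
    have "F ((- (c t)\<^sup>2) *\<^sub>R r t) = (- (c t)\<^sup>2) *\<^sub>R F (r t)"
      by (rule linear_cmul[OF bounded_linear.linear[OF F(1)]])
    then show ?thesis
      using F(2)[of "r t" "p t"] FL[of t]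
      by (intro DERIV_cong[OF has_real_derivative_inner_operator[OF F(1) p_deriv' p_deriv']])
        (simp add: inner_commute)
  qed
  have ld: "((\<lambda>t. q t \<bullet> L (q t)) has_real_derivative 2 * (p t \<bullet> L (q t))) (at t)"
    using has_real_derivative_inner_operator[OF L(1) q_deriv q_deriv, of t] L(2)[of "q t" "p t"]
    by (simp add: inner_commute)
  have "(W has_real_derivative ?d + 2 * c t * (p t \<bullet> L (q t)) * (1 - a t * c t)) (at t)"
    unfolding W_def
    by (rule DERIV_cong[OF DERIV_add[OF DERIV_mult[OF a_deriv fd] DERIV_mult[OF c_deriv ld]]])
      (simp add: power2_eq_square algebra_simps)
  then show "(W has_real_derivative ?d) (at t)" by (simp add: ac)
  assume tT: "\<bar>t\<bar> \<le> T"
  have cW: "c t * W t = p t \<bullet> F (p t) + (c t)\<^sup>2 * (q t \<bullet> L (q t))"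
  proof -
    have "c t * W t = (a t * c t) * (p t \<bullet> F (p t)) + (c t)\<^sup>2 * (q t \<bullet> L (q t))"
      by (simp add: W_def power2_eq_square algebra_simps)
    then show ?thesis by (simp add: ac)
  qed
  have nn: "0 \<le> p t \<bullet> F (p t)" "0 \<le> (c t)\<^sup>2 * (q t \<bullet> L (q t))"
    using F(3) L(3) by auto
  then have "0 \<le> c t * W t" unfolding cW by (rule add_nonneg_nonneg)
  then have W0: "0 \<le> W t" using c_pos[of t] by (simp add: zero_le_mult_iff)
  \<comment> \<open>\<open>?d\<close> contains the difference of the two nonnegative terms whose sum
    is \<open>c t * W t\<close>.\<close>
  have "\<bar>?d\<bar> \<le> 2 * \<bar>\<sigma>\<bar> * \<bar>?g\<bar> * (c t * W t)"
    unfolding abs_mult cW using nn by (intro mult_mono) auto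
  also have "\<dots> \<le> M * W t"
    using mult_right_mono[OF M[OF tT] W0] by (simp add: mult.assoc)
  finally show "\<bar>?d\<bar> \<le> M * W t" .
qed

end

section \<open>Estimates along an orbit\<close>

text \<open>The symbol of \<open>A (A + k)\<^sup>-\<^sup>1\<close>. The value 0 on the negative
  axis, a null set for A, removes the pole at -k and keeps the function in [0, 1] for k > 0.\<close>

definition cutoff :: "real \<Rightarrow> real \<Rightarrow> real" where
  "cutoff k l = (if 0 \<le> l then l / (l + k) else 0)"

lemma cutoff_measurable [measurable]: "cutoff k \<in> borel_measurable borel"
  unfolding cutoff_def by measurable

lemma cutoff_bounds: "0 < k \<Longrightarrow> 0 \<le> cutoff k l" "0 < k \<Longrightarrow> cutoff k l \<le> 1"
  by (auto simp: cutoff_def)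

lemma cutoff_eq: "0 < k \<Longrightarrow> 0 \<le> l \<Longrightarrow> l * cutoff k l = l - k * cutoff k l"
  by (simp add: cutoff_def field_simps)

text \<open>With a = 1 + \<sigma> Q the invariant equals c u + v + \<sigma> (v (Q - u) - k y^2), and
  the bracket is nonnegative by \<open>y\<close>. The bounds with a v come from the sign of u v + k
  y^2.\<close>

lemma invariant_bounds:
  fixes Q u v y k \<sigma> a c :: real
  assumes \<sigma>: "\<sigma> = 1 \<or> \<sigma> = -1" and k: "0 \<le> k" and u: "0 \<le> u" and v: "0 \<le> v"
    and y: "k * y\<^sup>2 \<le> v * (Q - u)" and a: "a = 1 + \<sigma> * Q"
  defines "J \<equiv> c * u + a * v - \<sigma> * (u * v + k * y\<^sup>2)"
  shows "\<sigma> = 1 \<Longrightarrow> c * u + v \<le> J" and "\<sigma> = 1 \<Longrightarrow> J \<le> c * u + a * v"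
    and "\<sigma> = -1 \<Longrightarrow> c * u + a * v \<le> J" and "\<sigma> = -1 \<Longrightarrow> J \<le> c * u + v"
proof -
  have n: "0 \<le> u * v" "0 \<le> k * y\<^sup>2" using assms by auto
  show "\<sigma> = 1 \<Longrightarrow> c * u + v \<le> J" "\<sigma> = 1 \<Longrightarrow> J \<le> c * u + a * v"
    "\<sigma> = -1 \<Longrightarrow> c * u + a * v \<le> J" "\<sigma> = -1 \<Longrightarrow> J \<le> c * u + v"
    using n y by (auto simp: J_def a algebra_simps)
qed

context nonneg_spectral begin

lemma bounded_linear_spec:
  assumes f: "f \<in> borel_measurable borel" "\<And>l. \<bar>f l\<bar> \<le> B"
  shows "bounded_linear (spec f)"
proof (rule bounded_linear_intro)
  have d: "x \<in> domf f" for x by (rule in_domf_bounded[OF f])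
  show "spec f (x + y) = spec f x + spec f y" for x y by (rule spec_add[OF f(1) d d])
  show "spec f (r *\<^sub>R x) = r *\<^sub>R spec f x" for r x by (rule spec_scaleR[OF f(1) d])
  have B: "0 \<le> B" using f(2)[of 0] by simp
  show "norm (spec f x) \<le> norm x * B" for x
  proof (rule power2_le_imp_le)
    have "(norm (spec f x))\<^sup>2 = (\<integral>l. (f l)\<^sup>2 \<partial>mu x)" by (rule spec_norm[OF f(1) d])
    also have "\<dots> \<le> (\<integral>l. B\<^sup>2 \<partial>mu x)"
    proof (rule integral_mono)
      show "integrable (mu x) (\<lambda>l. (f l)\<^sup>2)" using d by (simp add: spectral_dom_def)
      show "(f l)\<^sup>2 \<le> B\<^sup>2" for l
        using f(2)[of l] B by (simp add: abs_le_square_iff[symmetric])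
    qed (rule integrable_mu_bounded[of _ "B\<^sup>2"], auto)
    also have "\<dots> = (norm x * B)\<^sup>2"
      using measure_mu[of UNIV x] by (simp add: power_mult_distrib)
    finally show "(norm (spec f x))\<^sup>2 \<le> (norm x * B)\<^sup>2" .
  qed (use B in simp)
qed

lemma spec_sym_bounded:
  assumes "f \<in> borel_measurable borel" "\<And>l. \<bar>f l\<bar> \<le> B"
  shows "spec f x \<bullet> y = x \<bullet> spec f y"
  using assms by (intro spec_sym in_domf_bounded) auto

lemma spec_nonneg:
  assumes "f \<in> borel_measurable borel" "x \<in> domf f" "\<And>l. 0 \<le> l \<Longrightarrow> 0 \<le> f l"
  shows "0 \<le> x \<bullet> spec f x"
  unfolding spec_inner_self[OF assms(1,2)]
  by (rule integral_nonneg_AE) (use assms(3) in \<open>auto intro: eventually_mono[OF AE_mu_nonneg]\<close>)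

lemma nn_integral_spec_inner:
  assumes "f \<in> borel_measurable borel" "x \<in> domf f" "\<And>l. 0 \<le> l \<Longrightarrow> 0 \<le> f l"
  shows "(\<integral>\<^sup>+ l. ennreal (f l) \<partial>mu x) = ennreal (x \<bullet> spec f x)"
  unfolding spec_inner_self[OF assms(1,2)]
  by (rule nn_integral_eq_integral[OF integrable_of_domf[OF assms(1,2)]])
    (use assms(3) in \<open>auto intro: eventually_mono[OF AE_mu_nonneg]\<close>)

lemma nn_integral_mu_sqrt:
  assumes "x \<in> domf sqrt" "u \<in> borel_measurable borel"
  shows "nn_integral (mu (spec sqrt x)) u = (\<integral>\<^sup>+ l. ennreal l * u l \<partial>mu x)"
proof -
  have "nn_integral (mu (spec sqrt x)) u = (\<integral>\<^sup>+ l. ennreal ((sqrt l)\<^sup>2) * u l \<partial>mu x)"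
    using assms by (intro nn_integral_mu_spec) auto
  also have "\<dots> = (\<integral>\<^sup>+ l. ennreal l * u l \<partial>mu x)"
    by (rule nn_integral_cong_AE) (rule eventually_mono[OF AE_mu_nonneg], simp)
  finally show ?thesis .
qed

lemma nn_integral_mu_1: "(\<integral>\<^sup>+ l. 1 \<partial>mu x) = ennreal ((norm x)\<^sup>2)"
  using emeasure_mu[of UNIV x] by simp

lemma A_form_inner:
  assumes "q \<in> domf (\<lambda>l. l)"
  shows "A_form A q = q \<bullet> spec (\<lambda>l. l) q"
proof -
  have "ennreal (A_form A q) = (\<integral>\<^sup>+ l. 1 \<partial>mu (spec sqrt q))"
    by (simp add: nn_integral_mu_1 A_form_eq domf_id_sqrt[OF assms] del: nn_integral_const)
  also have "\<dots> = (\<integral>\<^sup>+ l. ennreal l \<partial>mu q)"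
    using nn_integral_mu_sqrt[OF domf_id_sqrt[OF assms], of "\<lambda>_. 1"] by simp
  also have "\<dots> = ennreal (q \<bullet> spec (\<lambda>l. l) q)"
    using assms by (intro nn_integral_spec_inner) auto
  finally show ?thesis
    using assms spec_nonneg[of "\<lambda>l. l" q] by (simp add: A_form_def)
qed

lemma cutoff_bounded: "0 < k \<Longrightarrow> \<bar>cutoff k l\<bar> \<le> 1"
  using cutoff_bounds[of k l] by simp

lemma cutoff_in_domf: "0 < k \<Longrightarrow> x \<in> domf (cutoff k)"
  by (rule in_domf_bounded[OF cutoff_measurable cutoff_bounded])

lemma spec_id_minus_cutoff:
  assumes k: "0 < k" and q: "q \<in> domf (\<lambda>l. l)"
  shows "q \<in> domf (\<lambda>l. l - k * cutoff k l)"
    and "spec (\<lambda>l. l - k * cutoff k l) q = spec (\<lambda>l. l) q - k *\<^sub>R spec (cutoff k) q"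
  using q by (auto intro!: domf_fun_diff domf_mult cutoff_in_domf[OF k]
      simp: spec_fun_diff spec_fun_mult cutoff_in_domf[OF k] domf_mult)

text \<open>The symbol identity l^2 / (l + k) = l - k l / (l + k). It supplies the assumption on
  \<open>G (r t)\<close> in \<open>invariant_conserved\<close>.\<close>

lemma spec_cutoff_A:
  assumes k: "0 < k" and q: "q \<in> domf (\<lambda>l. l)"
  shows "spec (cutoff k) (spec (\<lambda>l. l) q) = spec (\<lambda>l. l) q - k *\<^sub>R spec (cutoff k) q"
proof -
  have d: "q \<in> domf (\<lambda>l. cutoff k l * l)"
    by (rule domf_mono[OF _ _ q]) (use cutoff_bounded[OF k] in \<open>auto simp: abs_mult intro: mult_left_le_one_le\<close>)
  have "spec (cutoff k) (spec (\<lambda>l. l) q) = spec (\<lambda>l. cutoff k l * l) q"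
    using q d by (intro spec_spec) auto
  also have "\<dots> = spec (\<lambda>l. l - k * cutoff k l) q"
  proof (rule spec_eq_AE[OF _ _ d spec_id_minus_cutoff(1)[OF k q]])
    show "AE l in mu q. cutoff k l * l = l - k * cutoff k l"
      using AE_mu_nonneg by (rule eventually_mono) (use cutoff_eq[OF k] in \<open>simp add: mult.commute\<close>)
  qed auto
  finally show ?thesis using spec_id_minus_cutoff(2)[OF k q] by simp
qed

lemma nn_integral_cutoff_sqrt:
  assumes k: "0 < k" and q: "q \<in> domf (\<lambda>l. l)"
  shows "(\<integral>\<^sup>+ l. ennreal (cutoff k l) \<partial>mu (spec sqrt q)) = ennreal (A_form A q - k * (q \<bullet> spec (cutoff k) q))"
    and "0 \<le> A_form A q - k * (q \<bullet> spec (cutoff k) q)"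
proof -
  have nn: "0 \<le> l - k * cutoff k l" if "0 \<le> l" for l
    using that k cutoff_bounds[OF k, of l] by (simp flip: cutoff_eq)
  have e: "q \<bullet> spec (\<lambda>l. l - k * cutoff k l) q = A_form A q - k * (q \<bullet> spec (cutoff k) q)"
    using spec_id_minus_cutoff(2)[OF k q] by (simp add: inner_diff_right A_form_inner[OF q])
  have "(\<integral>\<^sup>+ l. ennreal (cutoff k l) \<partial>mu (spec sqrt q)) = (\<integral>\<^sup>+ l. ennreal l * ennreal (cutoff k l) \<partial>mu q)"
    by (rule nn_integral_mu_sqrt[OF domf_id_sqrt[OF q]]) measurable
  also have "\<dots> = (\<integral>\<^sup>+ l. ennreal (l - k * cutoff k l) \<partial>mu q)"
    by (rule nn_integral_cong_AE, rule eventually_mono[OF AE_mu_nonneg])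
      (use k in \<open>simp add: cutoff_bounds flip: cutoff_eq ennreal_mult\<close>)
  also have "\<dots> = ennreal (A_form A q - k * (q \<bullet> spec (cutoff k) q))"
    using nn spec_id_minus_cutoff(1)[OF k q] by (subst nn_integral_spec_inner) (auto simp: e)
  finally show "(\<integral>\<^sup>+ l. ennreal (cutoff k l) \<partial>mu (spec sqrt q)) = ennreal (A_form A q - k * (q \<bullet> spec (cutoff k) q))" .
  show "0 \<le> A_form A q - k * (q \<bullet> spec (cutoff k) q)"
    unfolding e[symmetric] using nn spec_id_minus_cutoff(1)[OF k q] by (intro spec_nonneg) auto
qed

lemma spec_cutoff_nonneg: "0 < k \<Longrightarrow> 0 \<le> x \<bullet> spec (cutoff k) x"
  by (intro spec_nonneg cutoff_in_domf) (auto simp: cutoff_bounds)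

text \<open>The square root of the symbol turns the form into an inner product of two
  vectors.\<close>

lemma spec_cutoff_Cauchy_Schwarz:
  assumes k: "0 < k"
  shows "(p \<bullet> spec (cutoff k) q)\<^sup>2 \<le> (p \<bullet> spec (cutoff k) p) * (q \<bullet> spec (cutoff k) q)"
proof -
  define h where "h l = sqrt (cutoff k l)" for l
  have hm: "h \<in> borel_measurable borel" unfolding h_def by measurable
  have hb: "\<bar>h l\<bar> \<le> 1" for l using cutoff_bounds[OF k, of l] by (simp add: h_def)
  have hh: "(\<lambda>l. h l * h l) = cutoff k" using cutoff_bounds[OF k] by (simp add: h_def fun_eq_iff)
  have "x \<bullet> spec (cutoff k) y = spec h x \<bullet> spec h y" for x y
  proof -
    have "spec h (spec h y) = spec (\<lambda>l. h l * h l) y"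
      by (rule spec_spec) (use hm hb cutoff_in_domf[OF k] in \<open>auto simp: hh intro: in_domf_bounded\<close>)
    then show ?thesis using spec_sym_bounded[OF hm hb, of x "spec h y"] by (simp add: hh)
  qed
  then show ?thesis using Cauchy_Schwarz_ineq[of "spec h p" "spec h q"] by simp
qed

lemma energy_cutoff:
  assumes k: "0 < k" and q: "q \<in> domf (\<lambda>l. l)"
  shows "energy (q, p) (\<lambda>l. ennreal (cutoff k l))
    = ennreal (A_form A q - k * (q \<bullet> spec (cutoff k) q) + p \<bullet> spec (cutoff k) p)"
proof -
  have "(\<integral>\<^sup>+ l. ennreal (cutoff k l) \<partial>mu p) = ennreal (p \<bullet> spec (cutoff k) p)"
    by (rule nn_integral_spec_inner) (auto simp: k cutoff_in_domf cutoff_bounds)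
  then show ?thesis
    unfolding energy_def using nn_integral_cutoff_sqrt[OF k q] spec_cutoff_nonneg[OF k]
    by (simp add: ennreal_plus)
qed

lemma energy_mono:
  assumes "\<And>l. 0 \<le> l \<Longrightarrow> u l \<le> w l"
  shows "energy z u \<le> energy z w"
  unfolding energy_def
  by (intro add_mono nn_integral_mono_AE eventually_mono[OF AE_mu_nonneg] assms)

lemma energy_add:
  assumes "u \<in> borel_measurable borel" "w \<in> borel_measurable borel"
  shows "energy z (\<lambda>l. u l + w l) = energy z u + energy z w"
  unfolding energy_def using assms by (simp add: nn_integral_add ac_simps)

lemma energy_cmult:
  assumes "u \<in> borel_measurable borel"
  shows "energy z (\<lambda>l. b * u l) = b * energy z u"
  unfolding energy_def using assms by (simp add: nn_integral_cmult distrib_left)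

lemma energy_1: "q \<in> domf sqrt \<Longrightarrow> energy (q, p) (\<lambda>_. 1) = ennreal (A_form A q + p \<bullet> p)"
  unfolding energy_def nn_integral_mu_1 by (simp add: A_form_eq power2_norm_eq_inner)

lemma energy_limit:
  assumes U: "\<And>n::nat. U n \<in> borel_measurable borel" "\<And>l. incseq (\<lambda>n. U n l)" "\<And>l. (\<lambda>n. U n l) \<longlonglongrightarrow> u l"
    and le: "\<And>n. energy z (U n) \<le> b"
  shows "energy z u \<le> b"
proof -
  have m: "u \<in> borel_measurable borel"
    by (rule borel_measurable_LIMSEQ_order[OF U(3) U(1)])
  have "(\<lambda>n. nn_integral (mu x) (U n)) \<longlonglongrightarrow> nn_integral (mu x) u" for x
  proof (rule nn_integral_LIMSEQ)
    show "incseq U" using U(2) by (auto simp: incseq_def le_fun_def)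
  qed (use U in auto)
  then have "(\<lambda>n. energy z (U n)) \<longlonglongrightarrow> energy z u"
    unfolding energy_def by (intro tendsto_add) auto
  then show ?thesis by (rule LIMSEQ_le_const2) (use le in auto)
qed

end

section \<open>Invariants and growth along a single orbit\<close>

locale orbit = nonneg_spectral E A
  for E :: "real set \<Rightarrow> 'x::{real_inner,banach} \<Rightarrow> 'x" and A +
  fixes \<sigma> :: real and q p :: "real \<Rightarrow> 'x"
  assumes sol: "solution_inf A \<sigma> UNIV q p" and sign: "\<sigma> = 1 \<or> \<sigma> = -1"
begin

lemmas solD = solution_infD[OF sol sign]

abbreviation Q where "Q t \<equiv> A_form A (q t)"

lemma flow: "kirchhoff_flow q p (\<lambda>t. spec (\<lambda>l. l) (q t)) Q \<sigma>"
proof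
  fix t
  show "(q has_vector_derivative p t) (at t)" by (rule solD)
  show "(p has_vector_derivative - (1 / (1 + \<sigma> * Q t))\<^sup>2 *\<^sub>R spec (\<lambda>l. l) (q t)) (at t)"
    using solD(4)[of t] by (simp add: speed_def)
  show "Q t = q t \<bullet> spec (\<lambda>l. l) (q t)" for t by (rule A_form_inner[OF solD(1)])
  then show "(Q has_real_derivative 2 * (p t \<bullet> spec (\<lambda>l. l) (q t))) (at t)"
    using has_real_derivative_quadratic_form[OF solD(3) solD(5), of t] spec_sym[of "\<lambda>l. l"] solD(1) by simp
  show "0 < 1 + \<sigma> * Q t" by (rule solD)
qed

sublocale kirchhoff_flow q p "\<lambda>t. spec (\<lambda>l. l) (q t)" Q \<sigma>
  by (rule flow)

text \<open>This is <A q, G q>, rewritten by A G = A - k G so that only the bounded operator acts on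
  q.\<close>

definition u where "u k t = Q t - k * (q t \<bullet> spec (cutoff k) (q t))"
definition v where "v k t = p t \<bullet> spec (cutoff k) (p t)"
definition J where "J k t = c t * u k t + a t * v k t - \<sigma> * (u k t * v k t + k * (p t \<bullet> spec (cutoff k) (q t))\<^sup>2)"

lemma J_const: "0 < k \<Longrightarrow> J k t = J k 0"
  unfolding J_def u_def v_def
  by (rule invariant_conserved)
    (auto intro!: bounded_linear_spec[OF cutoff_measurable cutoff_bounded]
      spec_sym_bounded[OF cutoff_measurable cutoff_bounded] spec_cutoff_A solD(1))

lemma u_nonneg: "0 < k \<Longrightarrow> 0 \<le> u k t"
  unfolding u_def by (rule nn_integral_cutoff_sqrt(2)[OF _ solD(1)])

lemma v_nonneg: "0 < k \<Longrightarrow> 0 \<le> v k t"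
  unfolding v_def by (rule spec_cutoff_nonneg)

text \<open>Cauchy-Schwarz for the form of \<open>G\<close>, with k <q, G q> = Q - u.\<close>

lemma y_bound: "0 < k \<Longrightarrow> k * (p t \<bullet> spec (cutoff k) (q t))\<^sup>2 \<le> v k t * (Q t - u k t)"
  using mult_left_mono[OF spec_cutoff_Cauchy_Schwarz[of k "p t" "q t"], of k]
  by (simp add: u_def v_def algebra_simps)

lemma J_bounds:
  assumes "0 < k"
  shows "\<sigma> = 1 \<Longrightarrow> c t * u k t + v k t \<le> J k t" and "\<sigma> = 1 \<Longrightarrow> J k t \<le> c t * u k t + a t * v k t"
    and "\<sigma> = -1 \<Longrightarrow> c t * u k t + a t * v k t \<le> J k t" and "\<sigma> = -1 \<Longrightarrow> J k t \<le> c t * u k t + v k t"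
  unfolding J_def
  using invariant_bounds[OF sign less_imp_le[OF assms] u_nonneg[OF assms] v_nonneg[OF assms] y_bound[OF assms] refl]
  by blast+

lemma energy_cutoff_eq: "0 < k \<Longrightarrow> energy (q t, p t) (\<lambda>l. ennreal (cutoff k l)) = ennreal (u k t + v k t)"
  unfolding u_def v_def by (rule energy_cutoff[OF _ solD(1)])

lemma Q_nonneg: "0 \<le> Q t" by (simp add: A_form_def)

lemma a_bounds:
  assumes "1 \<le> B" "1 / B \<le> c t" "c t \<le> B"
  shows "1 / B \<le> a t" and "a t \<le> B"
proof -
  have a: "a t = 1 / c t" by (simp add: c_def)
  show "1 / B \<le> a t"
    unfolding a using assms c_pos[of t] by (intro divide_left_mono) auto
  have "1 / c t \<le> 1 / (1 / B)"
    using assms c_pos[of t] by (intro divide_left_mono) auto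
  then show "a t \<le> B" unfolding a by simp
qed

text \<open>\<open>J\<close> is at least (u + v) / B at time \<open>t\<close> and at most B (u + v)
  at time 0. Conservation joins the two bounds, one factor \<open>B\<close> for each.\<close>

lemma cutoff_energy_comparison:
  assumes B: "1 \<le> B" "1 / B \<le> c t" "c t \<le> B" "1 / B \<le> c 0" "c 0 \<le> B" and k: "0 < k"
  shows "u k t + v k t \<le> B\<^sup>2 * (u k 0 + v k 0)"
proof -
  note nn = u_nonneg[OF k] v_nonneg[OF k]
  have Bi: "1 / B \<le> 1" using B by simp
  have "1 / B * (u k t + v k t) \<le> J k t"
  proof (cases "\<sigma> = 1")
    case True
    have "1 / B * u k t \<le> c t * u k t" "1 / B * v k t \<le> 1 * v k t"
      by (rule mult_right_mono[OF B(2) nn(1)], rule mult_right_mono[OF Bi nn(2)])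
    then show ?thesis using J_bounds(1)[OF k True, of t] by (simp add: distrib_left)
  next
    case False
    then have s: "\<sigma> = -1" using sign by simp
    have "1 / B * u k t \<le> c t * u k t" "1 / B * v k t \<le> a t * v k t"
      by (rule mult_right_mono[OF B(2) nn(1)], rule mult_right_mono[OF a_bounds(1)[OF B(1-3)] nn(2)])
    then show ?thesis using J_bounds(3)[OF k s, of t] by (simp add: distrib_left)
  qed
  also have "J k t = J k 0" by (rule J_const[OF k])
  also have "J k 0 \<le> B * (u k 0 + v k 0)"
  proof (cases "\<sigma> = 1")
    case True
    have "c 0 * u k 0 \<le> B * u k 0" "a 0 * v k 0 \<le> B * v k 0"
      using nn[of 0] B a_bounds(2)[OF B(1,4,5)] by (auto intro!: mult_right_mono)
    then show ?thesis using J_bounds(2)[OF k True, of 0] by (simp add: distrib_left)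
  next
    case False
    then have s: "\<sigma> = -1" using sign by simp
    have "c 0 * u k 0 \<le> B * u k 0" "1 * v k 0 \<le> B * v k 0"
      by (rule mult_right_mono[OF B(5) nn(1)], rule mult_right_mono[OF B(1) nn(2)])
    then show ?thesis using J_bounds(4)[OF k s, of 0] by (simp add: distrib_left)
  qed
  finally have "B * (1 / B * (u k t + v k t)) \<le> B * (B * (u k 0 + v k 0))"
    using B(1) by (intro mult_left_mono) auto
  then show ?thesis using B(1) by (simp add: power2_eq_square mult.assoc)
qed

lemma energy_cutoff_comparison:
  assumes B: "1 \<le> B" "1 / B \<le> c t" "c t \<le> B" "1 / B \<le> c 0" "c 0 \<le> B" and k: "0 < k"
  shows "energy (q t, p t) (\<lambda>l. ennreal (cutoff k l)) \<le> ennreal (B\<^sup>2) * energy (q 0, p 0) (\<lambda>l. ennreal (cutoff k l))"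
  unfolding energy_cutoff_eq[OF k]
  using cutoff_energy_comparison[OF assms] by (subst ennreal_mult[symmetric])
    (auto intro!: ennreal_leI add_nonneg_nonneg u_nonneg v_nonneg k)

lemma H_conserved: "p t \<bullet> p t + Q t * c t = 2 * hamiltonian A \<sigma> (q 0, p 0)"
  using energy_conserved[of t] by (simp add: hamiltonian_def c_def)

lemma H_bounds:
  assumes "hamiltonian A \<sigma> (q 0, p 0) \<le> K"
  shows "p t \<bullet> p t \<le> 2 * K" and "Q t * c t \<le> 2 * K"
  using H_conserved[of t] assms mult_nonneg_nonneg[OF Q_nonneg less_imp_le[OF c_pos], of t t] inner_ge_zero[of "p t"]
  by linarith+

text \<open>For this sign c = 1 + Q c, and Q c is at most twice the Hamiltonian.\<close>

lemma c_bounds_neg: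
  assumes "hamiltonian A \<sigma> (q 0, p 0) \<le> K" "\<sigma> = -1"
  shows "1 \<le> c t" and "c t \<le> 1 + 2 * K" and "Q t \<le> 1"
proof -
  have "c t = 1 + Q t * c t" using ac[of t] assms(2) by (simp add: algebra_simps)
  then show "1 \<le> c t" "c t \<le> 1 + 2 * K"
    using H_bounds(2)[OF assms(1), of t] mult_nonneg_nonneg[OF Q_nonneg less_imp_le[OF c_pos], of t t] by linarith+
  show "Q t \<le> 1" using Q_pos[of t] assms(2) by simp
qed

text \<open>For the sign \<open>+\<close> the Hamiltonian does not control \<open>\<langle>q, A q\<rangle>\<close>. Smallness of the invariant bounds
  the high frequency part of \<open>\<langle>q, A q\<rangle>\<close> by the low frequency part, which grows at most exponentially.\<close>

lemma Q_bound_pos: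
  assumes s: "\<sigma> = 1" and k: "0 < k" and J0: "J k 0 \<le> 1 / 2"
  shows "Q t \<le> 1 + 2 * (exp (sqrt k * \<bar>t\<bar>) * (1 + Q 0))"
proof -
  \<comment> \<open>The low frequency part of Q, complementary to u.\<close>
  define X where "X t = k * (q t \<bullet> spec (cutoff k) (q t))" for t
  have X0: "0 \<le> X t" for t using spec_cutoff_nonneg[OF k] k by (simp add: X_def)
  have QX: "Q t = u k t + X t" for t by (simp add: u_def X_def)
  have uv: "c t * u k t + v k t \<le> 1 / 2" for t
    using J_bounds(1)[OF k s, of t] J_const[OF k, of t] J0 by simp
  have cu: "0 \<le> c t * u k t" for t using u_nonneg[OF k] c_pos by (simp add: less_imp_le)
  \<comment> \<open>The derivative of \<open>X\<close> is of the order of the square root of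
    \<open>X\<close>; adding 1 makes it at most linear, since
    \<open>2 * X \<le> (1 + X)\<^sup>2\<close>.\<close>
  have "1 + X t \<le> exp (sqrt k * \<bar>t\<bar>) * (1 + X 0)"
  proof (rule gronwall_abs[OF _ _ order_refl])
    fix x
    let ?y = "p x \<bullet> spec (cutoff k) (q x)"
    have "((\<lambda>t. q t \<bullet> spec (cutoff k) (q t)) has_real_derivative 2 * ?y) (at x)"
      using has_real_derivative_inner_operator[OF bounded_linear_spec[OF cutoff_measurable cutoff_bounded[OF k]] q_deriv q_deriv, of x]
        spec_sym_bounded[OF cutoff_measurable cutoff_bounded[OF k], of "q x" "p x"] by (simp add: inner_commute)
    then show "((\<lambda>t. 1 + X t) has_real_derivative k * (2 * ?y)) (at x)"
      unfolding X_def by (auto intro!: derivative_eq_intros)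
    have "k * ?y\<^sup>2 \<le> v k x * X x" using y_bound[OF k, of x] QX[of x] by simp
    also have "\<dots> \<le> (1 / 2) * X x"
      using uv[of x] cu[of x] X0[of x] by (intro mult_right_mono) auto
    finally have y2: "k * ?y\<^sup>2 \<le> X x / 2" by simp
    have "(k * (2 * ?y))\<^sup>2 = 4 * k * (k * ?y\<^sup>2)" by (simp add: power2_eq_square)
    also have "\<dots> \<le> 4 * k * (X x / 2)" using y2 k by (intro mult_left_mono) auto
    also have "\<dots> \<le> k * (1 + X x)\<^sup>2"
      using k by (simp add: power2_eq_square algebra_simps add_nonneg_nonneg)
    also have "\<dots> = (sqrt k * (1 + X x))\<^sup>2" using k by (simp add: power_mult_distrib)
    finally show "\<bar>k * (2 * ?y)\<bar> \<le> sqrt k * (1 + X x)"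
      using k X0[of x] by (simp add: abs_le_square_iff[symmetric])
  qed
  moreover have "exp (sqrt k * \<bar>t\<bar>) * (1 + X 0) \<le> exp (sqrt k * \<bar>t\<bar>) * (1 + Q 0)"
    using QX[of 0] u_nonneg[OF k, of 0] by (intro mult_left_mono) auto
  moreover have "Q t \<le> 1 + 2 * X t"
  proof -
    \<comment> \<open>From c u \<le> 1/2 one gets u \<le> (1 + Q) / 2, and half of Q is absorbed in
      Q = u + X. This is where the value 1/2 of the bound on the invariant is used.\<close>
    have "u k t \<le> a t * (1 / 2)"
    proof -
      have "a t * (c t * u k t) \<le> a t * (1 / 2)"
        using uv[of t] v_nonneg[OF k, of t] Q_pos[of t] by (intro mult_left_mono) auto
      then show ?thesis by (simp add: ac mult.assoc[symmetric])
    qed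
    then show ?thesis using QX[of t] s by simp
  qed
  ultimately show ?thesis by linarith
qed

lemma norm_A_sq: "ennreal ((norm (spec (\<lambda>l. l) (q t)))\<^sup>2) \<le> energy (q t, p t) ennreal"
proof -
  have "ennreal ((norm (spec (\<lambda>l. l) (q t)))\<^sup>2) = (\<integral>\<^sup>+ l. ennreal (l\<^sup>2) \<partial>mu (q t))"
    using nn_integral_domf[OF _ solD(1)] by simp
  also have "\<dots> = (\<integral>\<^sup>+ l. ennreal l * ennreal l \<partial>mu (q t))"
    by (rule nn_integral_cong_AE, rule eventually_mono[OF AE_mu_nonneg]) (simp add: power2_eq_square ennreal_mult)
  also have "\<dots> = nn_integral (mu (spec sqrt (q t))) ennreal"
    by (rule nn_integral_mu_sqrt[symmetric, OF domf_id_sqrt[OF solD(1)]]) measurable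
  finally show ?thesis by (simp add: energy_def)
qed

text \<open>The functions k l / (l + k) increase to l as k grows, and the constant
  \<open>B\<^sup>2\<close> of the comparison does not depend on k.\<close>

lemma energy_ennreal_comparison:
  assumes "1 \<le> B" "1 / B \<le> c t" "c t \<le> B" "1 / B \<le> c 0" "c 0 \<le> B"
  shows "energy (q t, p t) ennreal \<le> ennreal (B\<^sup>2) * energy (q 0, p 0) ennreal"
proof (rule energy_limit)
  define r where "r n = real (Suc n)" for n
  have r: "0 < r n" for n by (simp add: r_def)
  let ?U = "\<lambda>n l. ennreal (r n * cutoff (r n) l)"
  have mono: "r m * cutoff (r m) l \<le> r n * cutoff (r n) l" if "m \<le> n" for m n l
  proof (cases "0 \<le> l")
    case True
    have "r m \<le> r n" using that by (simp add: r_def)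
    then have "r m * l * l \<le> r n * l * l" using True by (intro mult_right_mono) auto
    then show ?thesis using True r[of m] r[of n] by (simp add: cutoff_def field_simps)
  qed (simp add: cutoff_def)
  then show "incseq (\<lambda>n. ?U n l)" for l by (auto simp: incseq_def intro!: ennreal_leI)
  show "(\<lambda>n. ?U n l) \<longlonglongrightarrow> ennreal l" for l
  proof (cases "0 \<le> l")
    case True
    have "(\<lambda>n. l / (l * inverse (r n) + 1)) \<longlonglongrightarrow> l / (l * 0 + 1)"
      unfolding r_def by (intro tendsto_intros LIMSEQ_inverse_real_of_nat) simp
    moreover have "l / (l * inverse (r n) + 1) = r n * cutoff (r n) l" for n
      using True r[of n] by (simp add: cutoff_def field_simps)
    ultimately show ?thesis by (intro tendsto_ennrealI) simp
  qed (simp add: cutoff_def ennreal_neg)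
  show "energy (q t, p t) (?U n) \<le> ennreal (B\<^sup>2) * energy (q 0, p 0) ennreal" for n
  proof -
    have U: "energy z (?U n) = ennreal (r n) * energy z (\<lambda>l. ennreal (cutoff (r n) l))" for z
      using r[of n] by (subst energy_cmult[symmetric]) (auto simp: ennreal_mult cutoff_bounds)
    have "energy (q t, p t) (?U n) \<le> ennreal (r n) * (ennreal (B\<^sup>2) * energy (q 0, p 0) (\<lambda>l. ennreal (cutoff (r n) l)))"
      unfolding U by (intro mult_left_mono energy_cutoff_comparison assms r) auto
    also have "\<dots> = ennreal (B\<^sup>2) * energy (q 0, p 0) (?U n)"
      unfolding U by (simp add: mult.left_commute)
    also have "\<dots> \<le> ennreal (B\<^sup>2) * energy (q 0, p 0) ennreal"
    proof (intro mult_left_mono energy_mono ennreal_leI)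
      fix l :: real assume l: "0 \<le> l"
      then show "r n * cutoff (r n) l \<le> l"
        using r[of n] by (simp add: cutoff_def field_simps)
    qed simp
    finally show ?thesis .
  qed
qed measurable

text \<open>\<open>weighted_energy_growth\<close> with F = \<open>E S\<close>. Boundedness of
  \<open>S\<close> makes L = A \<open>E S\<close> a bounded operator; passing from \<open>W\<close>
  to the energy costs one factor \<open>B\<close> at each end.\<close>

lemma measure_comparison_bounded:
  assumes B: "1 \<le> B" "\<And>x. \<bar>x\<bar> \<le> T \<Longrightarrow> 1 / B \<le> c x" "\<And>x. \<bar>x\<bar> \<le> T \<Longrightarrow> c x \<le> B"
    and M: "\<And>x. \<bar>x\<bar> \<le> T \<Longrightarrow> 2 * \<bar>p x \<bullet> spec (\<lambda>l. l) (q x)\<bar> * c x \<le> M"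
    and t: "\<bar>t\<bar> \<le> T" and S: "S \<in> sets borel" "S \<subseteq> {0..N}"
  shows "energy (q t, p t) (indicator S) \<le> ennreal (B\<^sup>2 * exp (M * \<bar>t\<bar>)) * energy (q 0, p 0) (indicator S)"
proof -
  define L where "L l = indicator S l * l" for l :: real
  have Lm: "L \<in> borel_measurable borel" unfolding L_def using S by measurable
  have Lb: "\<bar>L l\<bar> \<le> \<bar>N\<bar>" for l using S by (auto simp: L_def indicator_def)
  have Ld: "x \<in> domf L" for x by (rule in_domf_bounded[OF Lm Lb])
  have Ln: "0 \<le> L l" for l using S by (auto simp: L_def indicator_def)
  define W where "W t = a t * (p t \<bullet> E S (p t)) + c t * (q t \<bullet> spec L (q t))" for t
  have en: "energy (q t, p t) (indicator S) = ennreal (q t \<bullet> spec L (q t) + p t \<bullet> E S (p t))" for t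
  proof -
    have "nn_integral (mu (spec sqrt (q t))) (indicator S) = (\<integral>\<^sup>+ l. ennreal l * indicator S l \<partial>mu (q t))"
      using S by (intro nn_integral_mu_sqrt domf_id_sqrt solD) auto
    also have "\<dots> = (\<integral>\<^sup>+ l. ennreal (L l) \<partial>mu (q t))"
      by (intro nn_integral_cong) (auto simp: L_def indicator_def)
    also have "\<dots> = ennreal (q t \<bullet> spec L (q t))"
      by (rule nn_integral_spec_inner[OF Lm Ld Ln])
    finally show ?thesis
      using S spec_nonneg[OF Lm Ld Ln] by (simp add: energy_def emeasure_mu E_inner_self)
  qed
  have nn: "0 \<le> p t \<bullet> E S (p t)" "0 \<le> q t \<bullet> spec L (q t)" for t
    using S spec_nonneg[OF Lm Ld Ln] by (auto simp: E_inner_self)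
  have aB: "1 / B \<le> a x \<and> a x \<le> B" if "\<bar>x\<bar> \<le> T" for x
    using a_bounds[OF B(1) B(2,3)[OF that]] by simp
  have "W t \<le> exp (M * \<bar>t\<bar>) * W 0"
    unfolding W_def
  proof (rule weighted_energy_growth[OF _ _ _ _ _ _ _ _ t])
    show "E S (spec (\<lambda>l. l) (q t)) = spec L (q t)" for t
      unfolding L_def by (rule E_spec[OF _ solD(1) S(1)]) simp
    show "2 * \<bar>\<sigma>\<bar> * \<bar>p x \<bullet> spec (\<lambda>l. l) (q x)\<bar> * c x \<le> M" if "\<bar>x\<bar> \<le> T" for x
      using M[OF that] sign by auto
    show "0 \<le> x \<bullet> spec L x" for x by (rule spec_nonneg[OF Lm Ld Ln])
    show "spec L x \<bullet> y = x \<bullet> spec L y" for x y by (rule spec_sym_bounded[OF Lm Lb])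
  qed (use S in \<open>auto simp: E_inner_self E_sym bounded_linear_E intro!: bounded_linear_spec[OF Lm Lb]\<close>)
  moreover have "1 / B * (q t \<bullet> spec L (q t) + p t \<bullet> E S (p t)) \<le> W t"
    unfolding W_def distrib_left using nn aB[OF t] B(2)[OF t]
    by (subst add.commute) (intro add_mono mult_right_mono; simp)
  moreover have "W 0 \<le> B * (q 0 \<bullet> spec L (q 0) + p 0 \<bullet> E S (p 0))"
    unfolding W_def distrib_left using nn aB[of 0] B(3)[of 0] t
    by (subst add.commute) (intro add_mono mult_right_mono; simp)
  ultimately have "1 / B * (q t \<bullet> spec L (q t) + p t \<bullet> E S (p t))
      \<le> exp (M * \<bar>t\<bar>) * (B * (q 0 \<bullet> spec L (q 0) + p 0 \<bullet> E S (p 0)))"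
    by (meson order_trans mult_left_mono exp_ge_zero)
  then have "B * (1 / B * (q t \<bullet> spec L (q t) + p t \<bullet> E S (p t)))
      \<le> B * (exp (M * \<bar>t\<bar>) * (B * (q 0 \<bullet> spec L (q 0) + p 0 \<bullet> E S (p 0))))"
    using B(1) by (intro mult_left_mono) auto
  then have "q t \<bullet> spec L (q t) + p t \<bullet> E S (p t)
      \<le> B\<^sup>2 * exp (M * \<bar>t\<bar>) * (q 0 \<bullet> spec L (q 0) + p 0 \<bullet> E S (p 0))"
    using B(1) by (simp add: power2_eq_square mult_ac)
  then show ?thesis
    unfolding en using nn
    by (subst ennreal_mult[symmetric]) (auto intro!: ennreal_leI add_nonneg_nonneg simp del: ennreal_plus)
qed

text \<open>Bounded sets exhaust the half-line, the negative axis is null, and a comparison on all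
  Borel sets extends to all weights with the same constant.\<close>

lemma energy_comparison:
  assumes B: "1 \<le> B" "\<And>x. \<bar>x\<bar> \<le> T \<Longrightarrow> 1 / B \<le> c x" "\<And>x. \<bar>x\<bar> \<le> T \<Longrightarrow> c x \<le> B"
    and M: "\<And>x. \<bar>x\<bar> \<le> T \<Longrightarrow> 2 * \<bar>p x \<bullet> spec (\<lambda>l. l) (q x)\<bar> * c x \<le> M"
    and t: "\<bar>t\<bar> \<le> T" and w: "w \<in> borel_measurable borel"
  shows "energy (q t, p t) w \<le> ennreal (B\<^sup>2 * exp (M * \<bar>t\<bar>)) * energy (q 0, p 0) w"
  unfolding energy_def fst_conv snd_conv
proof (rule nn_integral_le_of_emeasure_le)
  fix S assume "S \<in> sets (mu (spec sqrt (q t)))"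
  then have S: "S \<in> sets borel" by simp
  let ?C = "ennreal (B\<^sup>2 * exp (M * \<bar>t\<bar>))"
  have "energy (q t, p t) (indicator S) \<le> energy (q t, p t) (indicator (S \<inter> {0..}))"
    by (rule energy_mono) (auto simp: indicator_def)
  also have "\<dots> \<le> ?C * energy (q 0, p 0) (indicator S)"
  proof (rule energy_limit)
    show "(\<lambda>n. indicator (S \<inter> {0..real n}) l :: ennreal) \<longlonglongrightarrow> indicator (S \<inter> {0..}) l" for l
    proof -
      have "(\<lambda>n. indicator (S \<inter> {0..real n}) l :: ennreal) \<longlonglongrightarrow> indicator (\<Union>n. S \<inter> {0..real n}) l"
        by (rule LIMSEQ_indicator_incseq) (auto simp: incseq_def)
      also have "(\<Union>n. S \<inter> {0..real n}) = S \<inter> {0..}" by (auto intro: real_arch_simple)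
      finally show ?thesis .
    qed
    show "energy (q t, p t) (indicator (S \<inter> {0..real n})) \<le> ?C * energy (q 0, p 0) (indicator S)" for n
    proof -
      have "energy (q t, p t) (indicator (S \<inter> {0..real n})) \<le> ?C * energy (q 0, p 0) (indicator (S \<inter> {0..real n}))"
        by (rule measure_comparison_bounded[OF B M t, where N = "real n"]) (use S in auto)
      also have "\<dots> \<le> ?C * energy (q 0, p 0) (indicator S)"
        by (intro mult_left_mono energy_mono) (auto simp: indicator_def)
      finally show ?thesis .
    qed
  qed (use S in \<open>auto simp: incseq_def indicator_def\<close>)
  finally show "emeasure (mu (spec sqrt (q t))) S + emeasure (mu (p t)) S
      \<le> ?C * (emeasure (mu (spec sqrt (q 0))) S + emeasure (mu (p 0)) S)"
    using S by (simp add: energy_def)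
qed (use w in auto)

end

section \<open>Superposition of cutoffs\<close>

lemma cutoff_scale: "0 < h \<Longrightarrow> cutoff (h * k) (h * l) = cutoff k l"
  by (auto simp: cutoff_def zero_le_mult_iff simp flip: distrib_left)

lemma cutoff_le: "0 < k \<Longrightarrow> 0 \<le> l \<Longrightarrow> cutoff k l \<le> l / k"
  by (simp add: cutoff_def frac_le)

text \<open>Terms with 4^n below \<theta> are of size b^n, terms beyond it are at most \<theta> (b /
  4)^n. As 1 < b < 4, both ranges are geometric and the sum is dominated by 4^n near \<theta>, where
  b^n is comparable to \<theta>^\<alpha>.\<close>

lemma dyadic_cutoff_sum:
  fixes \<alpha> b :: real
  assumes \<alpha>: "0 < \<alpha>" "\<alpha> < 1"
  defines "b \<equiv> 4 powr \<alpha>" and "F \<equiv> \<lambda>\<theta>. \<Sum>n. (4 powr \<alpha>) ^ n * cutoff (4 ^ n) \<theta>"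
  shows "0 \<le> \<theta> \<Longrightarrow> summable (\<lambda>n. b ^ n * cutoff (4 ^ n) \<theta>)"
    and "0 \<le> \<theta> \<Longrightarrow> F \<theta> \<le> \<theta> / (1 - b / 4)"
    and "1 \<le> \<theta> \<Longrightarrow> F \<theta> \<le> (1 / (1 - b / 4) + 1 / (b - 1)) * b * \<theta> powr \<alpha>"
    and "1 \<le> \<theta> \<Longrightarrow> \<theta> powr \<alpha> \<le> 2 * b * F \<theta>"
proof -
  have "4 powr 0 < b" unfolding b_def using \<alpha> by (intro powr_less_mono) auto
  then have b1: "1 < b" by simp
  have "b < 4 powr 1" unfolding b_def using \<alpha> by (intro powr_less_mono) auto
  then have b4: "b < 4" by simp
  define g where "g \<theta> n = b ^ n * cutoff (4 ^ n) \<theta>" for \<theta> :: real and n :: nat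
  have F: "F \<theta> = suminf (g \<theta>)" for \<theta> by (simp add: F_def g_def[abs_def] b_def)
  have g0: "0 \<le> g \<theta> n" for \<theta> n using b1 by (simp add: g_def cutoff_bounds)
  have gle: "g \<theta> n \<le> \<theta> * (b / 4) ^ n" if "0 \<le> \<theta>" for \<theta> n
  proof -
    have "g \<theta> n \<le> b ^ n * (\<theta> / 4 ^ n)"
      unfolding g_def using b1 that by (intro mult_left_mono cutoff_le) auto
    then show ?thesis by (simp add: power_divide mult.commute)
  qed
  have geo: "(\<lambda>n. \<theta> * (b / 4) ^ n) sums (\<theta> * (1 / (1 - b / 4)))" for \<theta>
    using b1 b4 by (intro sums_mult geometric_sums) auto
  have sm: "summable (g \<theta>)" if "0 \<le> \<theta>" for \<theta>
    by (rule summable_comparison_test'[OF sums_summable[OF geo[of \<theta>]], of 0]) (use g0 gle[OF that] in auto)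
  then show "0 \<le> \<theta> \<Longrightarrow> summable (\<lambda>n. b ^ n * cutoff (4 ^ n) \<theta>)" by (simp add: g_def[abs_def])
  have lin: "F \<theta> \<le> \<theta> / (1 - b / 4)" if "0 \<le> \<theta>" for \<theta>
    using suminf_le[OF gle[OF that] sm[OF that] sums_summable[OF geo]] sums_unique[OF geo[of \<theta>]] by (simp add: F)
  then show "0 \<le> \<theta> \<Longrightarrow> F \<theta> \<le> \<theta> / (1 - b / 4)" .
  let ?C = "1 / (1 - b / 4) + 1 / (b - 1)"
  have C0: "0 \<le> ?C" using b1 b4 by simp
  \<comment> \<open>from \<open>F (4 \<theta>) \<le> 1 + b F \<theta>\<close>; the shift \<open>1 / (b - 1)\<close> absorbs the constant \<open>1\<close>\<close>
  have iter: "F \<theta> + 1 / (b - 1) \<le> ?C * b ^ m" if "0 \<le> \<theta>" "\<theta> \<le> 4 ^ m" for m \<theta>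
    using that
  proof (induction m arbitrary: \<theta>)
    case 0
    then have "\<theta> / (1 - b / 4) \<le> 1 / (1 - b / 4)" using b4 by (intro divide_right_mono) auto
    then show ?case using lin[OF 0(1)] by simp
  next
    case (Suc m)
    have t: "0 \<le> \<theta> / 4" "\<theta> / 4 \<le> 4 ^ m" using Suc.prems by auto
    have "g \<theta> (Suc n) = b * g (\<theta> / 4) n" for n
      using cutoff_scale[of 4 "4 ^ n" "\<theta> / 4"] by (simp add: g_def)
    then have "F \<theta> = g \<theta> 0 + b * F (\<theta> / 4)"
      using suminf_split_head[OF sm[OF Suc.prems(1)]] suminf_mult[OF sm[OF t(1)], of b] by (simp add: F)
    also have "g \<theta> 0 \<le> 1" by (simp add: g_def cutoff_bounds)
    finally have "F \<theta> + 1 / (b - 1) \<le> 1 + 1 / (b - 1) + b * F (\<theta> / 4)" by simp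
    also have "1 + 1 / (b - 1) = b * (1 / (b - 1))" using b1 by (simp add: field_simps)
    finally have "F \<theta> + 1 / (b - 1) \<le> b * (F (\<theta> / 4) + 1 / (b - 1))" by (simp add: distrib_left)
    also have "\<dots> \<le> b * (?C * b ^ m)" using b1 by (intro mult_left_mono Suc.IH t) auto
    finally show ?case by (simp add: mult_ac)
  qed
  show "F \<theta> \<le> ?C * b * \<theta> powr \<alpha>" "\<theta> powr \<alpha> \<le> 2 * b * F \<theta>" if \<theta>: "1 \<le> \<theta>"
  proof -
    \<comment> \<open>The dyadic scale of \<theta>: 4^m \<le> \<theta> < 4^(m + 1).\<close>
    define m where "m = nat \<lfloor>log 4 \<theta>\<rfloor>"
    have m: "real m \<le> log 4 \<theta>" "log 4 \<theta> < real m + 1"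
      using \<theta> by (auto simp: m_def zero_le_log_cancel_iff) 
    have pm: "4 powr real k = 4 ^ k" "(4 powr real k) powr \<alpha> = b ^ k" for k
      by (simp_all add: b_def powr_powr powr_realpow[symmetric] mult.commute)
    have "4 powr real m \<le> 4 powr log 4 \<theta>" "4 powr log 4 \<theta> < 4 powr real (Suc m)"
      using m by (auto intro!: powr_mono)
    then have le: "4 powr real m \<le> \<theta>" "\<theta> \<le> 4 powr real (Suc m)"
      using \<theta> by (auto simp: powr_log_cancel)
    have al: "b ^ m \<le> \<theta> powr \<alpha>" "\<theta> powr \<alpha> \<le> b ^ Suc m"
      using powr_mono2[OF _ _ le(1), of \<alpha>] powr_mono2[OF _ _ le(2), of \<alpha>] \<alpha> \<theta> unfolding pm(2) by simp_all
    have "F \<theta> \<le> ?C * b ^ Suc m"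
      using iter[of \<theta> "Suc m"] le(2) \<theta> b1 unfolding pm by (simp add: add_increasing2 order_trans[rotated])
    also have "\<dots> = ?C * b * b ^ m" by simp
    also have "\<dots> \<le> ?C * b * \<theta> powr \<alpha>" using al(1) C0 b1 by (intro mult_left_mono) auto
    finally show "F \<theta> \<le> ?C * b * \<theta> powr \<alpha>" .
    \<comment> \<open>The lower bound needs only the term of index m, which is at least b^m / 2; the
      remaining factor b comes from \<theta>^\<alpha> \<le> b^(m + 1).\<close>
    have "0 < \<theta> + 4 ^ m" using \<theta> by (intro add_pos_pos) auto
    then have "1 / 2 \<le> cutoff (4 ^ m) \<theta>"
      using le(1) \<theta> unfolding pm by (simp add: cutoff_def pos_le_divide_eq)
    then have "b ^ m * (1 / 2) \<le> g \<theta> m" unfolding g_def using b1 by (intro mult_left_mono) auto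
    also have "g \<theta> m \<le> F \<theta>"
      unfolding F using sum_le_suminf[OF sm, of \<theta> "{m}"] g0 \<theta> by simp
    finally have "b ^ m \<le> 2 * F \<theta>" by simp
    then have "b * b ^ m \<le> b * (2 * F \<theta>)" using b1 by (intro mult_left_mono) auto
    then show "\<theta> powr \<alpha> \<le> 2 * b * F \<theta>" using al(2) by simp
  qed
qed

text \<open>Above 1 the sum is comparable to the power. Near 0 its linear bound is of higher order
  than the power because \<alpha> < 1; this will make frequencies far below the scale of the weight
  negligible.\<close>

lemma exists_cutoff_superposition:
  fixes \<alpha> :: real
  assumes "0 \<le> \<alpha>" "\<alpha> < 1"
  shows "\<exists>(\<beta> :: nat \<Rightarrow> real) F D. 0 < D \<and> (\<forall>n. 0 \<le> \<beta> n) \<and>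
    (\<forall>\<theta>\<ge>0. (\<lambda>n. \<beta> n * cutoff (4 ^ n) \<theta>) sums F \<theta> \<and> F \<theta> \<le> D * \<theta>) \<and>
    (\<forall>\<theta>\<ge>1. F \<theta> \<le> D * \<theta> powr \<alpha> \<and> \<theta> powr \<alpha> \<le> D * F \<theta>)"
proof (cases "\<alpha> = 0")
  case True
  \<comment> \<open>For \<alpha> = 0 the ratio b would be 1 and the dyadic sum would grow like a
    logarithm, so a single cutoff is taken.\<close>
  have "(\<lambda>n. (if n = 0 then 1 else 0) * cutoff (4 ^ n) \<theta>) sums cutoff 1 \<theta>" for \<theta>
    using sums_finite[of "{0::nat}" "\<lambda>n. (if n = 0 then 1 else 0) * cutoff (4 ^ n) \<theta>"] by simp
  moreover have "cutoff 1 \<theta> \<le> 2 * \<theta>" if "0 \<le> \<theta>" for \<theta>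
    using cutoff_le[of 1 \<theta>] that by simp
  moreover have "cutoff 1 \<theta> \<le> 2 * \<theta> powr \<alpha> \<and> \<theta> powr \<alpha> \<le> 2 * cutoff 1 \<theta>" if "1 \<le> \<theta>" for \<theta>
    using that True by (auto simp: cutoff_def field_simps)
  ultimately show ?thesis
    by (intro exI[of _ "\<lambda>n. if n = 0 then 1 else 0"] exI[of _ "cutoff 1"] exI[of _ 2]) auto
next
  case False
  then have \<alpha>: "0 < \<alpha>" using assms by simp
  define b where "b = 4 powr \<alpha>"
  define F where "F \<theta> = (\<Sum>n. b ^ n * cutoff (4 ^ n) \<theta>)" for \<theta>
  define C where "C = 1 / (1 - b / 4) + 1 / (b - 1)"
  note D = dyadic_cutoff_sum[OF \<alpha> assms(2), folded b_def, folded F_def, folded C_def]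
  have "4 powr 0 < b" unfolding b_def using \<alpha> by (intro powr_less_mono) auto
  then have b1: "1 < b" by simp
  have "b < 4 powr 1" unfolding b_def using assms by (intro powr_less_mono) auto
  then have b4: "b < 4" by simp
  have C: "0 < 1 / (1 - b / 4)" "1 / (1 - b / 4) \<le> C" using b1 b4 by (auto simp: C_def)
  \<comment> \<open>One constant for all estimates: C b covers the two upper bounds, 2 b the lower
    one.\<close>
  define D where "D = C * b + 2 * b"
  have C0: "0 < C" using C by linarith
  then have "C * 1 \<le> C * b" "0 < C * b" using b1 by (intro mult_left_mono mult_pos_pos; simp)+
  then have CD: "C \<le> D" "C * b \<le> D" "2 * b \<le> D" "0 < D"
    using C0 b1 unfolding D_def by linarith+
  have F0: "0 \<le> F \<theta>" if "0 \<le> \<theta>" for \<theta>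
    unfolding F_def using b1 by (intro suminf_nonneg D(1)[OF that]) (auto simp: cutoff_bounds)
  have "F \<theta> \<le> D * \<theta>" if "0 \<le> \<theta>" for \<theta>
  proof -
    have "F \<theta> \<le> 1 / (1 - b / 4) * \<theta>" using D(2)[OF that] by simp
    also have "\<dots> \<le> D * \<theta>" using C(2) CD(1) that by (intro mult_right_mono) auto
    finally show ?thesis .
  qed
  moreover have "F \<theta> \<le> D * \<theta> powr \<alpha> \<and> \<theta> powr \<alpha> \<le> D * F \<theta>" if "1 \<le> \<theta>" for \<theta>
  proof
    show "F \<theta> \<le> D * \<theta> powr \<alpha>"
      using D(3)[OF that] mult_right_mono[OF CD(2), of "\<theta> powr \<alpha>"] by simp
    show "\<theta> powr \<alpha> \<le> D * F \<theta>"
      using D(4)[OF that] mult_right_mono[OF CD(3), of "F \<theta>"] F0[of \<theta>] that by simp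
  qed
  moreover have "(\<lambda>n. b ^ n * cutoff (4 ^ n) \<theta>) sums F \<theta>" if "0 \<le> \<theta>" for \<theta>
    unfolding F_def by (rule summable_sums[OF D(1)[OF that]])
  ultimately show ?thesis
    using CD(4) b1 by (intro exI[of _ "\<lambda>n. b ^ n"] exI[of _ F] exI[of _ D]) auto
qed

section \<open>Transport of boundedness and equicontinuity along orbits\<close>

context nonneg_spectral begin

lemma energy_suminf:
  assumes "\<And>n. U n \<in> borel_measurable borel"
  shows "energy z (\<lambda>l. \<Sum>n. U n l) = (\<Sum>n. energy z (U n))"
  unfolding energy_def using assms by (simp add: nn_integral_suminf suminf_add)

lemma energy_lincomb:
  assumes "u \<in> borel_measurable borel" "w \<in> borel_measurable borel"
  shows "energy z (\<lambda>l. b * u l + d * w l) = b * energy z u + d * energy z w"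
  using assms by (subst energy_add) (auto simp: energy_cmult)

lemma energy_1_le_phase_norm:
  assumes z: "z \<in> phase_space A s" and s: "1 \<le> s"
  shows "energy z (\<lambda>_. 1) \<le> ennreal ((phase_norm A s z)\<^sup>2)"
  unfolding phase_norm_sq[OF z] using s by (intro energy_mono) (auto simp: ge_one_powr_ge_zero)

text \<open>Comparing the evolved and the initial energy for weights \<open>f K\<close> that dominate the \<open>H\<^sup>s\<close> weight above
  frequency \<open>K\<close> and are negligible far below it transports boundedness and equicontinuity.\<close>

lemma bounded_equicontinuous_transport:
  fixes f :: "real \<Rightarrow> real \<Rightarrow> ennreal" and s C0 C1 B0 :: real
  defines "w \<equiv> \<lambda>l. ennreal ((1 + l) powr (s - 1))"
  assumes s: "1 \<le> s" and \<Omega>: "phase_bounded A s \<Omega>" "equicontinuous_in A s \<Omega>"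
    and sub: "\<Omega>' \<subseteq> phase_space A s"
    and fm: "\<And>K. f K \<in> borel_measurable borel"
    and ev: "\<And>z'. z' \<in> \<Omega>' \<Longrightarrow> \<exists>z\<in>\<Omega>. \<forall>K\<ge>1. energy z' (f K) \<le> ennreal C0 * energy z (f K)"
    and low: "\<And>z'. z' \<in> \<Omega>' \<Longrightarrow> energy z' (\<lambda>_. 1) \<le> ennreal B0"
    and pos: "0 \<le> C0" "0 \<le> C1" "0 \<le> B0"
    and ge: "\<And>K l. 1 \<le> K \<Longrightarrow> K\<^sup>2 \<le> l \<Longrightarrow> w l \<le> ennreal C1 * f K l"
    and le: "\<And>K l. 1 \<le> K \<Longrightarrow> 0 \<le> l \<Longrightarrow> f K l \<le> ennreal C1 * w l"
    and small: "\<And>\<epsilon>. 0 < \<epsilon> \<Longrightarrow> \<exists>\<eta>>0. \<forall>K\<ge>1. \<forall>l. 0 \<le> l \<longrightarrow> l < \<eta> * K\<^sup>2 \<longrightarrow> f K l \<le> ennreal \<epsilon> * w l"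
  shows "phase_bounded A s \<Omega>' \<and> equicontinuous_in A s \<Omega>'"
proof
  have wm: "w \<in> borel_measurable borel" unfolding w_def by measurable
  obtain C where C: "\<And>z. z \<in> \<Omega> \<Longrightarrow> phase_norm A s z \<le> C" and sub0: "\<Omega> \<subseteq> phase_space A s"
    using \<Omega>(1) unfolding phase_bounded_def by blast
  have pn0: "0 \<le> phase_norm A s z" for z by (simp add: phase_norm_def)
  have Ew: "energy z w \<le> ennreal (C\<^sup>2)" if "z \<in> \<Omega>" for z
    unfolding w_def phase_norm_sq[OF subsetD[OF sub0 that], symmetric]
    by (intro ennreal_leI power_mono C that pn0)
  show "phase_bounded A s \<Omega>'"
    unfolding phase_bounded_def
  proof (intro conjI sub exI ballI)
    fix z' assume z': "z' \<in> \<Omega>'"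
    then obtain z where z: "z \<in> \<Omega>" and e: "\<And>K. 1 \<le> K \<Longrightarrow> energy z' (f K) \<le> ennreal C0 * energy z (f K)"
      using ev by blast
    have "ennreal ((phase_norm A s z')\<^sup>2) = energy z' w"
      using phase_norm_sq[OF subsetD[OF sub z']] by (simp add: w_def)
    also have "\<dots> \<le> energy z' (\<lambda>l. ennreal (2 powr (s - 1)) * 1 + ennreal C1 * f 1 l)"
    proof (rule energy_mono)
      fix l :: real assume l: "0 \<le> l"
      \<comment> \<open>Above l = 1 the hypothesis \<open>ge\<close> with K = 1 applies; below, the
        weight is at most 2^(s - 1), and \<open>low\<close> controls that part.\<close>
      show "w l \<le> ennreal (2 powr (s - 1)) * 1 + ennreal C1 * f 1 l"
      proof (cases "1 \<le> l")
        case True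
        then show ?thesis using ge[of 1 l] by (simp add: add_increasing)
      next
        case False
        then have "w l \<le> ennreal (2 powr (s - 1))"
          unfolding w_def using l s by (intro ennreal_leI powr_mono2) auto
        then show ?thesis by (simp add: add_increasing2)
      qed
    qed
    also have "\<dots> = ennreal (2 powr (s - 1)) * energy z' (\<lambda>_. 1) + ennreal C1 * energy z' (f 1)"
      by (rule energy_lincomb) (use fm in auto)
    also have "\<dots> \<le> ennreal (2 powr (s - 1)) * ennreal B0 + ennreal C1 * (ennreal C0 * (ennreal C1 * ennreal (C\<^sup>2)))"
    proof (intro add_mono mult_left_mono low z')
      have "energy z (f 1) \<le> ennreal C1 * energy z w"
        unfolding energy_cmult[OF wm, symmetric] by (intro energy_mono le) auto
      also have "\<dots> \<le> ennreal C1 * ennreal (C\<^sup>2)" by (intro mult_left_mono Ew z) simp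
      finally show "energy z' (f 1) \<le> ennreal C0 * (ennreal C1 * ennreal (C\<^sup>2))"
        using e[of 1] by (meson order_refl order_trans mult_left_mono zero_le)
    qed auto
    also have "\<dots> = ennreal (2 powr (s - 1) * B0 + C1 * (C0 * (C1 * C\<^sup>2)))"
      using pos by (simp add: ennreal_plus ennreal_mult)
    finally have "(phase_norm A s z')\<^sup>2 \<le> 2 powr (s - 1) * B0 + C1 * (C0 * (C1 * C\<^sup>2))"
      using pos by (subst (asm) ennreal_le_iff) auto
    then show "phase_norm A s z' \<le> sqrt (2 powr (s - 1) * B0 + C1 * (C0 * (C1 * C\<^sup>2)))"
      by (rule real_le_rsqrt)
  qed
  show "equicontinuous_in A s \<Omega>'"
    unfolding equicontinuous_in_def
  proof (intro allI impI)
    fix e :: real assume e: "0 < e"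
    \<comment> \<open>The final estimate of the squared norm is \<open>(D - 1) * \<epsilon>\<close>;
      the 1 keeps \<open>D\<close> positive, and \<epsilon> is then chosen to make
      \<open>D * \<epsilon>\<close> half of \<open>e\<^sup>2\<close>.\<close>
    define D where "D = C1 * C0 * (C1 + C\<^sup>2) + 1"
    have D: "0 < D" using pos by (auto simp: D_def intro!: add_nonneg_pos)
    define \<epsilon> where "\<epsilon> = e\<^sup>2 / (2 * D)"
    have \<epsilon>: "0 < \<epsilon>" using e D by (simp add: \<epsilon>_def)
    obtain \<eta> where \<eta>: "0 < \<eta>" and sm: "\<And>K l. 1 \<le> K \<Longrightarrow> 0 \<le> l \<Longrightarrow> l < \<eta> * K\<^sup>2 \<Longrightarrow> f K l \<le> ennreal \<epsilon> * w l"
      using small[OF \<epsilon>] by blast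
    obtain \<kappa> where \<kappa>: "0 < \<kappa>" and eq: "\<And>q p. (q, p) \<in> \<Omega> \<Longrightarrow> phase_norm A s (proj_ge A \<kappa> q, proj_ge A \<kappa> p) \<le> sqrt \<epsilon>"
      using \<Omega>(2) \<epsilon> unfolding equicontinuous_in_def by (metis (no_types, lifting) case_prodD real_sqrt_gt_zero)
    \<comment> \<open>Large enough that frequencies below \<kappa>, about which equicontinuity of
      \<Omega> says nothing, fall into the range where \<open>f K\<close> is small. The 1 ensures
      \<open>1 \<le> K\<close>.\<close>
    define K where "K = 1 + \<kappa> / sqrt \<eta>"
    have K1: "1 \<le> K" using \<kappa> \<eta> by (simp add: K_def)
    have "\<kappa>\<^sup>2 = \<eta> * (\<kappa> / sqrt \<eta>)\<^sup>2" using \<eta> by (simp add: power_divide)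
    also have "\<dots> \<le> \<eta> * K\<^sup>2" using \<eta> \<kappa> by (intro mult_left_mono power_mono) (auto simp: K_def)
    finally have \<kappa>K: "\<kappa>\<^sup>2 \<le> \<eta> * K\<^sup>2" .
    show "\<exists>\<kappa>>0. \<forall>(q, p)\<in>\<Omega>'. phase_norm A s (proj_ge A \<kappa> q, proj_ge A \<kappa> p) \<le> e"
    proof (intro exI conjI ballI)
      show "0 < K" using K1 by simp
      fix z' assume z': "z' \<in> \<Omega>'"
      then obtain z where z: "z \<in> \<Omega>" and ez: "energy z' (f K) \<le> ennreal C0 * energy z (f K)"
        using ev K1 by blast
      obtain q' p' where z'_eq: "z' = (q', p')" by force
      obtain q p where z_eq: "z = (q, p)" by force
      let ?w1 = "\<lambda>l. indicator {\<kappa>\<^sup>2..} l * w l"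
      have w1m: "?w1 \<in> borel_measurable borel" using wm by measurable
      have "energy z (f K) \<le> energy z (\<lambda>l. ennreal C1 * ?w1 l + ennreal \<epsilon> * w l)"
      proof (rule energy_mono)
        fix l :: real assume l: "0 \<le> l"
        \<comment> \<open>Above \<kappa>^2 the tail of the data pays for the weight, below it the
          smallness of \<open>f K\<close>.\<close>
        show "f K l \<le> ennreal C1 * ?w1 l + ennreal \<epsilon> * w l"
          using le[OF K1 l] sm[OF K1 l] \<kappa>K by (cases "\<kappa>\<^sup>2 \<le> l") (auto simp: add_increasing2)
      qed
      also have "\<dots> = ennreal C1 * energy z ?w1 + ennreal \<epsilon> * energy z w"
        by (rule energy_lincomb[OF w1m wm])
      also have "\<dots> \<le> ennreal C1 * ennreal \<epsilon> + ennreal \<epsilon> * ennreal (C\<^sup>2)"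
      proof (intro add_mono mult_left_mono Ew z)
        have "energy z ?w1 = ennreal ((phase_norm A s (proj_ge A \<kappa> q, proj_ge A \<kappa> p))\<^sup>2)"
          using phase_norm_proj_sq[of q p s \<kappa>] sub0 z by (auto simp: z_eq w_def)
        also have "\<dots> \<le> ennreal ((sqrt \<epsilon>)\<^sup>2)"
          using eq z pn0 by (intro ennreal_leI power_mono) (auto simp: z_eq)
        finally show "energy z ?w1 \<le> ennreal \<epsilon>" using \<epsilon> by simp
      qed auto
      finally have Ez: "energy z (f K) \<le> ennreal C1 * ennreal \<epsilon> + ennreal \<epsilon> * ennreal (C\<^sup>2)" .
      have "ennreal ((phase_norm A s (proj_ge A K q', proj_ge A K p'))\<^sup>2) = energy z' (\<lambda>l. indicator {K\<^sup>2..} l * w l)"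
        using phase_norm_proj_sq[of q' p' s K] sub z' by (auto simp: z'_eq w_def)
      also have "\<dots> \<le> energy z' (\<lambda>l. ennreal C1 * f K l)"
        using ge[OF K1] by (intro energy_mono) (auto simp: indicator_def)
      also have "\<dots> = ennreal C1 * energy z' (f K)" by (rule energy_cmult[OF fm])
      also have "\<dots> \<le> ennreal C1 * (ennreal C0 * (ennreal C1 * ennreal \<epsilon> + ennreal \<epsilon> * ennreal (C\<^sup>2)))"
        by (intro mult_left_mono order_trans[OF ez] Ez) auto
      also have "\<dots> = ennreal (C1 * (C0 * (C1 * \<epsilon> + \<epsilon> * C\<^sup>2)))"
        using pos \<epsilon> by (simp add: ennreal_plus ennreal_mult)
      finally have "(phase_norm A s (proj_ge A K q', proj_ge A K p'))\<^sup>2 \<le> C1 * (C0 * (C1 * \<epsilon> + \<epsilon> * C\<^sup>2))"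
        using pos \<epsilon> by (subst (asm) ennreal_le_iff) auto
      also have "\<dots> = (D - 1) * \<epsilon>" by (simp add: D_def algebra_simps)
      also have "\<dots> \<le> D * \<epsilon>" using \<epsilon> by (intro mult_right_mono) auto
      also have "\<dots> = e\<^sup>2 / 2" using D by (simp add: \<epsilon>_def)
      also have "\<dots> \<le> e\<^sup>2" by simp
      finally have "(phase_norm A s (proj_ge A K q', proj_ge A K p'))\<^sup>2 \<le> e\<^sup>2" .
      then have "phase_norm A s (proj_ge A K q', proj_ge A K p') \<le> e"
        by (rule power2_le_imp_le) (use e in simp)
      then show "case z' of (q, p) \<Rightarrow> phase_norm A s (proj_ge A K q, proj_ge A K p) \<le> e"
        by (simp add: z'_eq)
    qed
  qed
qed

text \<open>\<open>B\<close> is fixed before the orbit, so c is written out as a fraction. These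
  bounds are all that the later comparisons need from the Hamiltonian.\<close>

lemma uniform_orbit_bounds:
  assumes sign: "\<sigma> = 1 \<or> \<sigma> = -1" and s: "1 \<le> s"
    and \<Omega>: "phase_bounded A s \<Omega>" "equicontinuous_in A s \<Omega>" "bdd_above (hamiltonian A \<sigma> ` \<Omega>)"
  obtains B where "1 \<le> B"
    "\<And>q p t. solution_inf A \<sigma> UNIV q p \<Longrightarrow> (q 0, p 0) \<in> \<Omega> \<Longrightarrow> \<bar>t\<bar> \<le> T \<Longrightarrow>
      1 / B \<le> 1 / (1 + \<sigma> * A_form A (q t)) \<and> 1 / (1 + \<sigma> * A_form A (q t)) \<le> B \<and>
      A_form A (q t) \<le> B \<and> p t \<bullet> p t \<le> B"
proof -
  obtain H where H: "\<And>z. z \<in> \<Omega> \<Longrightarrow> hamiltonian A \<sigma> z \<le> H"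
    using \<Omega>(3) unfolding bdd_above_def by blast
  \<comment> \<open>\<open>H\<close> is merely an upper bound and could be negative;
    \<open>K\<close> keeps \<open>1 + 2 * K\<close> at least 1.\<close>
  define K where "K = max H 0"
  have K: "0 \<le> K" "\<And>z. z \<in> \<Omega> \<Longrightarrow> hamiltonian A \<sigma> z \<le> K" using H by (auto simp: K_def max_def intro: order_trans)
  obtain C where C: "\<And>z. z \<in> \<Omega> \<Longrightarrow> phase_norm A s z \<le> C" and sub: "\<Omega> \<subseteq> phase_space A s"
    using \<Omega>(1) unfolding phase_bounded_def by blast
  have pn0: "0 \<le> phase_norm A s z" for z by (simp add: phase_norm_def)
  have E1: "energy z (\<lambda>_. 1) \<le> ennreal (C\<^sup>2)" if "z \<in> \<Omega>" for z
    using energy_1_le_phase_norm[OF subsetD[OF sub that] s]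
    by (rule order_trans) (intro ennreal_leI power_mono C that pn0)
  have Q0: "A_form A q \<le> C\<^sup>2" if "(q, p) \<in> \<Omega>" for q p
  proof -
    have "q \<in> domf sqrt" using sub that by (auto simp: phase_space_iff)
    from E1[OF that] energy_1[OF this, of p] have "A_form A q + p \<bullet> p \<le> C\<^sup>2"
      by (simp del: ennreal_plus)
    then show ?thesis using inner_ge_zero[of p] by linarith
  qed
  show thesis
  proof (cases "\<sigma> = 1")
    case False
    then have sg: "\<sigma> = -1" using sign by simp
    show thesis
    proof (rule that[of "1 + 2 * K"])
      fix q p t assume sol: "solution_inf A \<sigma> UNIV q p" "(q 0, p 0) \<in> \<Omega>"
      interpret o: orbit E A \<sigma> q p by unfold_locales (use sol sign in auto)
      have "1 / (1 + 2 * K) \<le> 1" using K(1) by simp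
      then have "1 / (1 + 2 * K) \<le> o.c t"
        using o.c_bounds_neg(1)[OF K(2)[OF sol(2)] sg, of t] by linarith
      then show "1 / (1 + 2 * K) \<le> 1 / (1 + \<sigma> * A_form A (q t)) \<and> 1 / (1 + \<sigma> * A_form A (q t)) \<le> 1 + 2 * K \<and>
          A_form A (q t) \<le> 1 + 2 * K \<and> p t \<bullet> p t \<le> 1 + 2 * K"
        using o.c_bounds_neg[OF K(2)[OF sol(2)] sg, of t] o.H_bounds(1)[OF K(2)[OF sol(2)], of t] K(1)
        by (simp add: o.c_def)
    qed (use K in simp)
  next
    case True
    \<comment> \<open>A uniform bound for a at time 0. The aim is u + v \<le> 1 / (2 M) at time 0,
      so that J \<le> M (u + v) \<le> 1/2.\<close>
    define M where "M = 1 + C\<^sup>2"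
    have M: "1 \<le> M" by (simp add: M_def)
    \<comment> \<open>The square of \<delta> is half of the allowance 1 / (2 M), spent on the
      frequencies above \<kappa>.\<close>
    define \<delta> where "\<delta> = sqrt (1 / (4 * M))"
    have "0 < \<delta>" using M by (simp add: \<delta>_def)
    then obtain \<kappa> where \<kappa>: "0 < \<kappa>" and eq: "\<And>q p. (q, p) \<in> \<Omega> \<Longrightarrow> phase_norm A s (proj_ge A \<kappa> q, proj_ge A \<kappa> p) \<le> \<delta>"
      using \<Omega>(2) unfolding equicontinuous_in_def by (metis (no_types, lifting) case_prodD)
    \<comment> \<open>Below \<kappa> the cutoff is at most \<kappa>^2 / k; this k makes that times
      \<open>M\<close> equal to 1 / (4 M), the other half of the allowance.\<close>
    define k where "k = 4 * M * \<kappa>\<^sup>2 * M"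
    have k: "0 < k" using \<kappa> M by (simp add: k_def)
    have small: "energy (q, p) (\<lambda>l. ennreal (cutoff k l)) \<le> ennreal (1 / (2 * M))" if z: "(q, p) \<in> \<Omega>" for q p
    proof -
      let ?w1 = "\<lambda>l. indicator {\<kappa>\<^sup>2..} l * ennreal ((1 + l) powr (s - 1))"
      have "energy (q, p) (\<lambda>l. ennreal (cutoff k l)) \<le> energy (q, p) (\<lambda>l. ?w1 l + ennreal (\<kappa>\<^sup>2 / k) * 1)"
      proof (rule energy_mono)
        fix l :: real assume l: "0 \<le> l"
        show "ennreal (cutoff k l) \<le> ?w1 l + ennreal (\<kappa>\<^sup>2 / k) * 1"
        proof (cases "\<kappa>\<^sup>2 \<le> l")
          case True
          have "ennreal (cutoff k l) \<le> ennreal ((1 + l) powr (s - 1))"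
            using cutoff_bounds(2)[OF k, of l] ge_one_powr_ge_zero[of "1 + l" "s - 1"] l s
            by (intro ennreal_leI) simp
          then show ?thesis using True by (simp add: add_increasing2)
        next
          case False
          have "cutoff k l \<le> \<kappa>\<^sup>2 / k"
            using cutoff_le[OF k l] False k by (intro order_trans[OF cutoff_le[OF k l]] divide_right_mono) auto
          then show ?thesis using False by (simp add: ennreal_leI)
        qed
      qed
      also have "\<dots> = energy (q, p) ?w1 + ennreal (\<kappa>\<^sup>2 / k) * energy (q, p) (\<lambda>_. 1)"
        by (subst energy_add; (subst energy_cmult)?; measurable?)
      also have "\<dots> \<le> ennreal (\<delta>\<^sup>2) + ennreal (\<kappa>\<^sup>2 / k) * ennreal (C\<^sup>2)"
      proof (intro add_mono mult_left_mono E1 z)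
        show "energy (q, p) ?w1 \<le> ennreal (\<delta>\<^sup>2)"
          unfolding phase_norm_proj_sq[OF subsetD[OF sub z], symmetric]
          by (intro ennreal_leI power_mono eq z pn0)
      qed simp
      also have "\<dots> \<le> ennreal (1 / (2 * M))"
      proof -
        have "\<kappa>\<^sup>2 / k * C\<^sup>2 \<le> \<kappa>\<^sup>2 / k * M" using k by (intro mult_left_mono) (auto simp: M_def)
        also have "\<dots> = 1 / (4 * M)" using \<kappa> M by (simp add: k_def)
        finally have "\<delta>\<^sup>2 + \<kappa>\<^sup>2 / k * C\<^sup>2 \<le> 1 / (2 * M)" using M by (simp add: \<delta>_def)
        then show ?thesis using k by (simp add: ennreal_leI flip: ennreal_plus ennreal_mult)
      qed
      finally show ?thesis .
    qed
    \<comment> \<open>The first two summands bound 1 + Q, the last one bounds <p, p>.\<close>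
    define B where "B = 2 + 2 * (exp (sqrt k * \<bar>T\<bar>) * M) + 2 * K"
    show thesis
    proof (rule that[of B])
      show "1 \<le> B" using M K by (simp add: B_def)
      fix q p t assume sol: "solution_inf A \<sigma> UNIV q p" "(q 0, p 0) \<in> \<Omega>" and t: "\<bar>t\<bar> \<le> T"
      interpret o: orbit E A \<sigma> q p by unfold_locales (use sol sign in auto)
      have uv: "o.u k 0 + o.v k 0 \<le> 1 / (2 * M)"
        using small[OF sol(2)] M o.energy_cutoff_eq[OF k, of 0] by simp
      have aM: "1 + \<sigma> * A_form A (q 0) \<le> M" using Q0[OF sol(2)] True by (simp add: M_def)
      have a1: "1 \<le> 1 + \<sigma> * A_form A (q x)" for x using o.Q_nonneg True by simp
      have c1: "o.c x \<le> 1" for x using a1[of x] by (simp add: o.c_def)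
      have "o.J k 0 \<le> o.c 0 * o.u k 0 + (1 + \<sigma> * A_form A (q 0)) * o.v k 0" by (rule o.J_bounds(2)[OF k True])
      also have "\<dots> \<le> M * o.u k 0 + M * o.v k 0"
        using c1[of 0] M aM o.u_nonneg[OF k, of 0] o.v_nonneg[OF k, of 0] by (intro add_mono mult_right_mono) auto
      also have "\<dots> \<le> M * (1 / (2 * M))"
        using uv M by (simp only: distrib_left[symmetric]) (intro mult_left_mono; simp)
      also have "\<dots> = 1 / 2" using M by simp
      finally have "o.J k 0 \<le> 1 / 2" .
      from o.Q_bound_pos[OF True k this, of t]
      have "A_form A (q t) \<le> 1 + 2 * (exp (sqrt k * \<bar>t\<bar>) * (1 + A_form A (q 0)))" .
      also have "\<dots> \<le> 1 + 2 * (exp (sqrt k * \<bar>T\<bar>) * M)"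
        using t k aM True o.Q_nonneg[of 0] by (intro add_left_mono mult_left_mono mult_mono) auto
      finally have QB: "1 + A_form A (q t) \<le> B" using K(1) by (simp add: B_def)
      have "1 / B \<le> 1 / (1 + \<sigma> * A_form A (q t))"
        using QB a1[of t] True by (intro divide_left_mono) auto
      then show "1 / B \<le> 1 / (1 + \<sigma> * A_form A (q t)) \<and> 1 / (1 + \<sigma> * A_form A (q t)) \<le> B \<and>
          A_form A (q t) \<le> B \<and> p t \<bullet> p t \<le> B"
        using QB c1[of t] \<open>1 \<le> B\<close> o.H_bounds(1)[OF K(2)[OF sol(2)], of t] M K(1)
        by (auto simp: o.c_def B_def intro: order_trans)
    qed
  qed
qed

end

section \<open>The ranges s < 2 and s \<ge> 2\<close>

context nonneg_spectral begin

text \<open>The superposition is rescaled to K^(2 \<alpha>) F(l / K^2), a combination of cutoffs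
  with k = K^2 4^n. Each of them is compared along the orbit with the same constant, and above K^2
  the sum is comparable to l^\<alpha> uniformly in K.\<close>

lemma orbits_bounded_equicontinuous_below_2:
  fixes s \<sigma> T :: real and \<Omega> :: "('x \<times> 'x) set"
  assumes s: "1 \<le> s" "s < 2" and sign: "\<sigma> = 1 \<or> \<sigma> = -1"
    and \<Omega>: "phase_bounded A s \<Omega>" "equicontinuous_in A s \<Omega>" "bdd_above (hamiltonian A \<sigma> ` \<Omega>)"
  defines "orbits \<equiv> {(q t, p t) | q p t. solution_inf A \<sigma> UNIV q p \<and> (q 0, p 0) \<in> \<Omega> \<and> \<bar>t\<bar> \<le> T}"
  shows "phase_bounded A s orbits \<and> equicontinuous_in A s orbits"
proof -
  obtain B where B: "1 \<le> B" and sp: "\<And>q p t. solution_inf A \<sigma> UNIV q p \<Longrightarrow> (q 0, p 0) \<in> \<Omega> \<Longrightarrow> \<bar>t\<bar> \<le> T \<Longrightarrow>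
      1 / B \<le> 1 / (1 + \<sigma> * A_form A (q t)) \<and> 1 / (1 + \<sigma> * A_form A (q t)) \<le> B \<and>
      A_form A (q t) \<le> B \<and> p t \<bullet> p t \<le> B"
    using uniform_orbit_bounds[OF sign s(1) \<Omega>, of T] by blast
  define \<alpha> where "\<alpha> = s - 1"
  have \<alpha>: "0 \<le> \<alpha>" "\<alpha> < 1" using s by (auto simp: \<alpha>_def)
  obtain \<beta> :: "nat \<Rightarrow> real" and F D where D: "0 < D" and \<beta>: "\<And>n. 0 \<le> \<beta> n"
    and Fs: "\<And>\<theta>. 0 \<le> \<theta> \<Longrightarrow> (\<lambda>n. \<beta> n * cutoff (4 ^ n) \<theta>) sums F \<theta>"
    and F1: "\<And>\<theta>. 0 \<le> \<theta> \<Longrightarrow> F \<theta> \<le> D * \<theta>"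
    and F2: "\<And>\<theta>. 1 \<le> \<theta> \<Longrightarrow> F \<theta> \<le> D * \<theta> powr \<alpha>" and F3: "\<And>\<theta>. 1 \<le> \<theta> \<Longrightarrow> \<theta> powr \<alpha> \<le> D * F \<theta>"
    using exists_cutoff_superposition[OF \<alpha>] by blast
  define \<gamma> where "\<gamma> K n = K powr (2 * \<alpha>) * \<beta> n" for K n
  have \<gamma>: "0 \<le> \<gamma> K n" for K n using \<beta> by (simp add: \<gamma>_def)
  define f where "f K l = (\<Sum>n. ennreal (\<gamma> K n) * ennreal (cutoff (K\<^sup>2 * 4 ^ n) l))" for K l
  have f_eq: "f K l = ennreal (K powr (2 * \<alpha>) * F (l / K\<^sup>2))" if "1 \<le> K" "0 \<le> l" for K l
  proof -
    have c: "cutoff (K\<^sup>2 * 4 ^ n) l = cutoff (4 ^ n) (l / K\<^sup>2)" for n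
      using cutoff_scale[of "K\<^sup>2" "4 ^ n" "l / K\<^sup>2"] that by simp
    have "(\<lambda>n. K powr (2 * \<alpha>) * (\<beta> n * cutoff (4 ^ n) (l / K\<^sup>2))) sums (K powr (2 * \<alpha>) * F (l / K\<^sup>2))"
      using that by (intro sums_mult Fs) auto
    note sums = this
    have "ennreal (\<gamma> K n) * ennreal (cutoff (K\<^sup>2 * 4 ^ n) l)
        = ennreal (K powr (2 * \<alpha>) * (\<beta> n * cutoff (4 ^ n) (l / K\<^sup>2)))" for n
      unfolding c using \<gamma>[of K n]
      by (subst ennreal_mult[symmetric]) (auto simp: \<gamma>_def cutoff_bounds mult.assoc)
    then have "f K l = (\<Sum>n. ennreal (K powr (2 * \<alpha>) * (\<beta> n * cutoff (4 ^ n) (l / K\<^sup>2))))"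
      unfolding f_def by (rule suminf_cong)
    also have "\<dots> = ennreal (K powr (2 * \<alpha>) * F (l / K\<^sup>2))"
      using \<beta> by (intro suminf_ennreal_eq[OF _ sums]) (auto simp: cutoff_bounds)
    finally show ?thesis .
  qed
  have scale: "K powr (2 * \<alpha>) * (l / K\<^sup>2) powr \<alpha> = l powr \<alpha>" if "1 \<le> K" "0 \<le> l" for K l :: real
  proof -
    have "(K\<^sup>2) powr \<alpha> = K powr (2 * \<alpha>)"
      using that by (simp add: powr_powr flip: powr_numeral)
    then show ?thesis using that by (simp add: powr_divide)
  qed
  have w_le: "l powr \<alpha> \<le> (1 + l) powr (s - 1)" if "0 \<le> l" for l
    unfolding \<alpha>_def using that s by (intro powr_mono2) auto
  \<comment> \<open>The linear bound on F leaves the factor (l / K^2)^(1 - \<alpha>), which is small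
    far below K^2.\<close>
  have lin: "K powr (2 * \<alpha>) * F (l / K\<^sup>2) \<le> D * (l / K\<^sup>2) powr (1 - \<alpha>) * l powr \<alpha>"
    if K: "1 \<le> K" and l: "0 \<le> l" for K l
  proof -
    let ?\<theta> = "l / K\<^sup>2"
    have "K powr (2 * \<alpha>) * F ?\<theta> \<le> K powr (2 * \<alpha>) * (D * ?\<theta>)"
      using l by (intro mult_left_mono F1) auto
    also have "\<dots> = K powr (2 * \<alpha>) * (D * (?\<theta> powr (1 - \<alpha>) * ?\<theta> powr \<alpha>))"
      using l by (simp flip: powr_add)
    also have "\<dots> = D * ?\<theta> powr (1 - \<alpha>) * (K powr (2 * \<alpha>) * ?\<theta> powr \<alpha>)" by (simp only: mult_ac)
    finally show ?thesis unfolding scale[OF K l] .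
  qed
  show ?thesis
  proof (rule bounded_equicontinuous_transport[where f = f and ?C0.0 = "B\<^sup>2" and ?C1.0 = "2 * D" and ?B0.0 = "2 * B", OF s(1) \<Omega>(1,2)])
    show "orbits \<subseteq> phase_space A s"
      using solution_infD(6)[OF _ sign _] s(1) by (auto simp: orbits_def)
    show "f K \<in> borel_measurable borel" for K unfolding f_def by measurable
    fix z' assume "z' \<in> orbits"
    then obtain q p t where z': "z' = (q t, p t)" and sol: "solution_inf A \<sigma> UNIV q p" "(q 0, p 0) \<in> \<Omega>" and t: "\<bar>t\<bar> \<le> T"
      by (auto simp: orbits_def)
    interpret o: orbit E A \<sigma> q p by unfold_locales (use sol sign in auto)
    have ct: "1 / B \<le> o.c x" "o.c x \<le> B" if "\<bar>x\<bar> \<le> T" for x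
      using sp[OF sol that] by (auto simp: o.c_def)
    show "\<exists>z\<in>\<Omega>. \<forall>K\<ge>1. energy z' (f K) \<le> ennreal (B\<^sup>2) * energy z (f K)"
    proof (intro bexI[OF _ sol(2)] allI impI)
      fix K :: real assume K: "1 \<le> K"
      have e: "energy z (f K) = (\<Sum>n. ennreal (\<gamma> K n) * energy z (\<lambda>l. ennreal (cutoff (K\<^sup>2 * 4 ^ n) l)))" for z
        unfolding f_def by (subst energy_suminf) (auto simp: energy_cmult)
      have "energy z' (f K) \<le> (\<Sum>n. ennreal (B\<^sup>2) * (ennreal (\<gamma> K n) * energy (q 0, p 0) (\<lambda>l. ennreal (cutoff (K\<^sup>2 * 4 ^ n) l))))"
        unfolding e z'
      proof (rule suminf_le)
        fix n
        have "energy (q t, p t) (\<lambda>l. ennreal (cutoff (K\<^sup>2 * 4 ^ n) l))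
            \<le> ennreal (B\<^sup>2) * energy (q 0, p 0) (\<lambda>l. ennreal (cutoff (K\<^sup>2 * 4 ^ n) l))"
          using ct[OF t] ct[of 0] t K B by (intro o.energy_cutoff_comparison) auto
        from mult_left_mono[OF this, of "ennreal (\<gamma> K n)"]
        show "ennreal (\<gamma> K n) * energy (q t, p t) (\<lambda>l. ennreal (cutoff (K\<^sup>2 * 4 ^ n) l))
            \<le> ennreal (B\<^sup>2) * (ennreal (\<gamma> K n) * energy (q 0, p 0) (\<lambda>l. ennreal (cutoff (K\<^sup>2 * 4 ^ n) l)))"
          by (simp add: mult.left_commute)
      qed auto
      then show "energy z' (f K) \<le> ennreal (B\<^sup>2) * energy (q 0, p 0) (f K)"
        unfolding e by simp
    qed
    have "energy z' (\<lambda>_. 1) = ennreal (o.Q t + p t \<bullet> p t)"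
      unfolding z' by (rule energy_1[OF domf_id_sqrt[OF o.solD(1)]])
    also have "\<dots> \<le> ennreal (2 * B)" using sp[OF sol t] by (intro ennreal_leI) simp
    finally show "energy z' (\<lambda>_. 1) \<le> ennreal (2 * B)" .
  next
    fix K l :: real assume K: "1 \<le> K" and l: "K\<^sup>2 \<le> l"
    have "1 \<le> K\<^sup>2" using K by simp
    then have l1: "1 \<le> l" using l by simp
    have th: "1 \<le> l / K\<^sup>2" using K l by (simp add: field_simps)
    \<comment> \<open>The 2 in the constant \<open>2 * D\<close> comes from 1 + l \<le> 2 l and
      2^\<alpha> \<le> 2.\<close>
    have "(1 + l) powr \<alpha> \<le> (2 * l) powr \<alpha>" using l1 \<alpha> by (intro powr_mono2) auto
    also have "\<dots> = 2 powr \<alpha> * l powr \<alpha>" using l1 by (simp add: powr_mult)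
    also have "2 powr \<alpha> \<le> 2 powr (1::real)" using \<alpha> by (intro powr_mono) auto
    finally have "(1 + l) powr \<alpha> \<le> 2 * l powr \<alpha>" by (simp add: mult_right_mono)
    also have "l powr \<alpha> = K powr (2 * \<alpha>) * (l / K\<^sup>2) powr \<alpha>" using scale[OF K, of l] l1 by simp
    also have "2 * (K powr (2 * \<alpha>) * (l / K\<^sup>2) powr \<alpha>) \<le> 2 * (K powr (2 * \<alpha>) * (D * F (l / K\<^sup>2)))"
      by (intro mult_left_mono F3 th) auto
    finally have "(1 + l) powr \<alpha> \<le> 2 * D * (K powr (2 * \<alpha>) * F (l / K\<^sup>2))" by (simp add: mult_ac)
    then show "ennreal ((1 + l) powr (s - 1)) \<le> ennreal (2 * D) * f K l"
      using D l1 by (simp add: f_eq[OF K] \<alpha>_def ennreal_leI flip: ennreal_mult')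
  next
    fix K l :: real assume K: "1 \<le> K" and l: "0 \<le> l"
    have "K powr (2 * \<alpha>) * F (l / K\<^sup>2) \<le> D * l powr \<alpha>"
    proof (cases "1 \<le> l / K\<^sup>2")
      case True
      have "K powr (2 * \<alpha>) * F (l / K\<^sup>2) \<le> K powr (2 * \<alpha>) * (D * (l / K\<^sup>2) powr \<alpha>)"
        by (intro mult_left_mono F2 True) auto
      then show ?thesis using scale[OF K l] by (simp add: mult.left_commute)
    next
      case False
      then have "(l / K\<^sup>2) powr (1 - \<alpha>) \<le> 1" using l \<alpha> by (intro powr_le1) auto
      then have "D * (l / K\<^sup>2) powr (1 - \<alpha>) * l powr \<alpha> \<le> D * 1 * l powr \<alpha>"
        using D by (intro mult_right_mono mult_left_mono) auto
      then show ?thesis using lin[OF K l] by simp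
    qed
    also have "\<dots> \<le> 2 * D * (1 + l) powr (s - 1)" using w_le[OF l] D by (intro mult_mono) auto
    finally show "f K l \<le> ennreal (2 * D) * ennreal ((1 + l) powr (s - 1))"
      using D by (simp add: f_eq[OF K l] ennreal_leI flip: ennreal_mult')
  next
    fix \<epsilon> :: real assume \<epsilon>: "0 < \<epsilon>"
    \<comment> \<open>The solution of D \<eta>^(1 - \<alpha>) = \<epsilon>, in view of
      \<open>lin\<close>.\<close>
    define \<eta> where "\<eta> = (\<epsilon> / D) powr (1 / (1 - \<alpha>))"
    have \<eta>: "0 < \<eta>" "\<eta> powr (1 - \<alpha>) = \<epsilon> / D" using \<epsilon> D \<alpha> by (auto simp: \<eta>_def powr_powr)
    show "\<exists>\<eta>>0. \<forall>K\<ge>1. \<forall>l\<ge>0. l < \<eta> * K\<^sup>2 \<longrightarrow> f K l \<le> ennreal \<epsilon> * ennreal ((1 + l) powr (s - 1))"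
    proof (intro exI[of _ \<eta>] conjI allI impI \<eta>(1))
      fix K l :: real assume K: "1 \<le> K" and l: "0 \<le> l" "l < \<eta> * K\<^sup>2"
      have "l / K\<^sup>2 \<le> \<eta>" using l K by (simp add: field_simps)
      then have "(l / K\<^sup>2) powr (1 - \<alpha>) \<le> \<epsilon> / D"
        unfolding \<eta>(2)[symmetric] using l \<alpha> by (intro powr_mono2) auto
      then have "D * (l / K\<^sup>2) powr (1 - \<alpha>) * l powr \<alpha> \<le> D * (\<epsilon> / D) * l powr \<alpha>"
        using D by (intro mult_right_mono mult_left_mono) auto
      also have "\<dots> = \<epsilon> * l powr \<alpha>" using D by simp
      also have "\<dots> \<le> \<epsilon> * (1 + l) powr (s - 1)" using w_le[OF l(1)] \<epsilon> by (intro mult_left_mono) auto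
      finally have "K powr (2 * \<alpha>) * F (l / K\<^sup>2) \<le> \<epsilon> * (1 + l) powr (s - 1)"
        using lin[OF K l(1)] by simp
      then show "f K l \<le> ennreal \<epsilon> * ennreal ((1 + l) powr (s - 1))"
        using \<epsilon> by (simp add: f_eq[OF K l(1)] ennreal_leI flip: ennreal_mult')
    qed
  qed (use D B in auto)
qed

text \<open>Every weight can be transported here, so \<open>f K\<close> is the phase-space weight
  cut off sharply at K^2; it vanishes below, and smallness holds with \<eta> = 1.\<close>

lemma orbits_bounded_equicontinuous_from_2:
  fixes s \<sigma> T :: real and \<Omega> :: "('x \<times> 'x) set"
  assumes s: "2 \<le> s" and sign: "\<sigma> = 1 \<or> \<sigma> = -1"
    and \<Omega>: "phase_bounded A s \<Omega>" "equicontinuous_in A s \<Omega>" "bdd_above (hamiltonian A \<sigma> ` \<Omega>)"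
  defines "orbits \<equiv> {(q t, p t) | q p t. solution_inf A \<sigma> UNIV q p \<and> (q 0, p 0) \<in> \<Omega> \<and> \<bar>t\<bar> \<le> T}"
  shows "phase_bounded A s orbits \<and> equicontinuous_in A s orbits"
proof -
  have s1: "1 \<le> s" using s by simp
  obtain B where B: "1 \<le> B" and sp: "\<And>q p t. solution_inf A \<sigma> UNIV q p \<Longrightarrow> (q 0, p 0) \<in> \<Omega> \<Longrightarrow> \<bar>t\<bar> \<le> T \<Longrightarrow>
      1 / B \<le> 1 / (1 + \<sigma> * A_form A (q t)) \<and> 1 / (1 + \<sigma> * A_form A (q t)) \<le> B \<and>
      A_form A (q t) \<le> B \<and> p t \<bullet> p t \<le> B"
    using uniform_orbit_bounds[OF sign s1 \<Omega>, of T] by blast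
  obtain C where C: "\<And>z. z \<in> \<Omega> \<Longrightarrow> phase_norm A s z \<le> C" and sub: "\<Omega> \<subseteq> phase_space A s"
    using \<Omega>(1) unfolding phase_bounded_def by blast
  have pn0: "0 \<le> phase_norm A s z" for z by (simp add: phase_norm_def)
  define f where "f K l = indicator {K\<^sup>2..} l * ennreal ((1 + l) powr (s - 1))" for K l :: real
  have fm: "f K \<in> borel_measurable borel" for K unfolding f_def by measurable
  \<comment> \<open>The factors bound the norm of p, the norm of A q and c. The absolute value
    covers a negative \<open>C\<close>, possible when \<Omega> is empty.\<close>
  define M where "M = 2 * (sqrt B * (B * \<bar>C\<bar>)) * B"
  have M0: "0 \<le> M" using B by (simp add: M_def)
  let ?C0 = "B\<^sup>2 * exp (M * \<bar>T\<bar>)"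
  show ?thesis
  proof (rule bounded_equicontinuous_transport[where f = f and ?C0.0 = ?C0 and ?C1.0 = 1 and ?B0.0 = "2 * B", OF s1 \<Omega>(1,2)])
    show "orbits \<subseteq> phase_space A s"
      using solution_infD(6)[OF _ sign _] s1 by (auto simp: orbits_def)
    fix z' assume "z' \<in> orbits"
    then obtain q p t where z': "z' = (q t, p t)" and sol: "solution_inf A \<sigma> UNIV q p" "(q 0, p 0) \<in> \<Omega>" and t: "\<bar>t\<bar> \<le> T"
      by (auto simp: orbits_def)
    interpret o: orbit E A \<sigma> q p by unfold_locales (use sol sign in auto)
    have ct: "1 / B \<le> o.c x" "o.c x \<le> B" if "\<bar>x\<bar> \<le> T" for x
      using sp[OF sol that] by (auto simp: o.c_def)
    have Mb: "2 * \<bar>p x \<bullet> spec (\<lambda>l. l) (q x)\<bar> * o.c x \<le> M" if x: "\<bar>x\<bar> \<le> T" for x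
    proof -
      have "ennreal ((norm (spec (\<lambda>l. l) (q x)))\<^sup>2) \<le> energy (q x, p x) ennreal" by (rule o.norm_A_sq)
      also have "\<dots> \<le> ennreal (B\<^sup>2) * energy (q 0, p 0) ennreal"
        using ct[OF x] ct[of 0] x B by (intro o.energy_ennreal_comparison) auto
      also have "\<dots> \<le> ennreal (B\<^sup>2) * energy (q 0, p 0) (\<lambda>l. ennreal ((1 + l) powr (s - 1)))"
      proof (intro mult_left_mono energy_mono ennreal_leI)
        fix l :: real assume l: "0 \<le> l"
        have "l \<le> (1 + l) powr 1" using l by simp
        \<comment> \<open>Here \<open>2 \<le> s\<close> enters: the weight l, whose energy controls
          the norm of A q, is dominated by the weight of the phase space.\<close>
        also have "\<dots> \<le> (1 + l) powr (s - 1)" using l s by (intro powr_mono) auto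
        finally show "l \<le> (1 + l) powr (s - 1)" .
      qed simp
      also have "\<dots> = ennreal (B\<^sup>2) * ennreal ((phase_norm A s (q 0, p 0))\<^sup>2)"
        using phase_norm_sq[OF subsetD[OF sub sol(2)]] by simp
      also have "\<dots> = ennreal ((B * phase_norm A s (q 0, p 0))\<^sup>2)"
        by (simp add: power_mult_distrib ennreal_mult)
      finally have "(norm (spec (\<lambda>l. l) (q x)))\<^sup>2 \<le> (B * phase_norm A s (q 0, p 0))\<^sup>2" by simp
      then have "norm (spec (\<lambda>l. l) (q x)) \<le> B * phase_norm A s (q 0, p 0)"
        by (rule power2_le_imp_le) (use B pn0 in simp)
      also have "\<dots> \<le> B * \<bar>C\<bar>" using C[OF sol(2)] B by (intro mult_left_mono) auto
      finally have r: "norm (spec (\<lambda>l. l) (q x)) \<le> B * \<bar>C\<bar>" .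
      have np: "norm (p x) \<le> sqrt B"
        using sp[OF sol x] by (simp add: norm_eq_sqrt_inner)
      have "\<bar>p x \<bullet> spec (\<lambda>l. l) (q x)\<bar> \<le> norm (p x) * norm (spec (\<lambda>l. l) (q x))"
        by (rule Cauchy_Schwarz_ineq2)
      also have "\<dots> \<le> sqrt B * (B * \<bar>C\<bar>)" using np r B by (intro mult_mono) auto
      finally have "2 * \<bar>p x \<bullet> spec (\<lambda>l. l) (q x)\<bar> \<le> 2 * (sqrt B * (B * \<bar>C\<bar>))" by simp
      then show ?thesis unfolding M_def
        using ct[OF x] o.c_pos[of x] B by (intro mult_mono) auto
    qed
    show "\<exists>z\<in>\<Omega>. \<forall>K\<ge>1. energy z' (f K) \<le> ennreal ?C0 * energy z (f K)"
    proof (intro bexI[OF _ sol(2)] allI impI)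
      fix K :: real
      have "energy z' (f K) \<le> ennreal (B\<^sup>2 * exp (M * \<bar>t\<bar>)) * energy (q 0, p 0) (f K)"
        unfolding z' by (rule o.energy_comparison[OF B ct Mb t fm])
      also have "\<dots> \<le> ennreal ?C0 * energy (q 0, p 0) (f K)"
        using t M0 by (intro mult_right_mono ennreal_leI mult_left_mono) (auto intro!: mult_left_mono)
      finally show "energy z' (f K) \<le> ennreal ?C0 * energy (q 0, p 0) (f K)" .
    qed
    have "energy z' (\<lambda>_. 1) = ennreal (o.Q t + p t \<bullet> p t)"
      unfolding z' by (rule energy_1[OF domf_id_sqrt[OF o.solD(1)]])
    also have "\<dots> \<le> ennreal (2 * B)" using sp[OF sol t] by (intro ennreal_leI) simp
    finally show "energy z' (\<lambda>_. 1) \<le> ennreal (2 * B)" .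
  next
    show "\<exists>\<eta>>0. \<forall>K\<ge>1. \<forall>l\<ge>0. l < \<eta> * K\<^sup>2 \<longrightarrow> f K l \<le> ennreal \<epsilon> * ennreal ((1 + l) powr (s - 1))" for \<epsilon>
      by (intro exI[of _ 1]) (auto simp: f_def)
  qed (use B fm in \<open>auto simp: f_def indicator_def\<close>)
qed

end

theorem theorem1p3:
  fixes A :: "('x::{real_inner, banach} \<times> 'x) set"
    and \<sigma> s T :: real
    and \<Omega> :: "('x \<times> 'x) set"
  assumes "nonneg_self_adjoint A"
    and "\<sigma> = 1 \<or> \<sigma> = -1"
    and "s \<ge> 1"
    and "T > 0"
    and "\<Omega> \<subseteq> phase_space_inf A"
    and "\<sigma> = -1 \<longrightarrow> (\<forall>(q, p)\<in>\<Omega>. A_form A q < 1)"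
    and "phase_bounded A s \<Omega>"
    and "equicontinuous_in A s \<Omega>"
    and "bdd_above (hamiltonian A \<sigma> ` \<Omega>)"
  defines "orbits \<equiv> {(q t, p t) | q p t.
      solution_inf A \<sigma> UNIV q p \<and> (q 0, p 0) \<in> \<Omega> \<and> \<bar>t\<bar> \<le> T}"
  shows "phase_bounded A s orbits \<and> equicontinuous_in A s orbits"
proof (cases "\<Omega> = {}")
  case True
  then have "orbits = {}" by (simp add: orbits_def)
  then show ?thesis
    by (auto simp: phase_bounded_def equicontinuous_in_def intro: exI[of _ 1])
next
  case False
  then obtain q p where "(q, p) \<in> phase_space A s"
    using assms(7) by (auto simp: phase_bounded_def)
  then have "q \<in> sqrt_dom A" by (simp add: phase_space_def)
  \<comment> \<open>Membership in the domain of the square root is defined through some spectral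
    measure of A, so a point of \<Omega> supplies one. This is the reason for treating empty
    \<Omega> separately.\<close>
  then obtain E where E: "spectral_measure_of A E"
    by (auto simp: sqrt_dom_def fun_calc_def)
  interpret nonneg_spectral E A
    using E assms(1) by unfold_locales (auto simp: spectral_measure_of_def nonneg_self_adjoint_def)
  show ?thesis
  proof (cases "s < 2")
    case True
    then show ?thesis
      unfolding orbits_def using assms(2,3,7-9) by (intro orbits_bounded_equicontinuous_below_2)
  next
    case False
    then show ?thesis
      unfolding orbits_def using assms(2,3,7-9) by (intro orbits_bounded_equicontinuous_from_2) auto
  qed
qed

end
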